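(* Let $A$ be a non-pyramidal configuration such that $X_A$ is self-dual. Then there exists a generalized Lawrence matrix $A'=\mathrm{GLM}(\mathbf a'_1,\ldots,\mathbf a'_s\mid\mathbf c'_1,\ldots,\mathbf c'_s)$ such that $X_A=X_{A'}$ after a possible renumeration of the columns, where $\mathbf a'_1,\ldots,\mathbf a'_s\in\mathbb Z^d$ (for some $d$) is a non-pyramidal configuration and $\sum_j c'_{ij}=0$ for all $i=1,\ldots,s$.
   Context: A configuration is a finite list $\mathbf a_1,\ldots,\mathbf a_n$ of vectors in some $\mathbb Z^m$ (repetitions allowed), identified with the integer matrix $A$ having these columns. Non-pyramidal: the vector $\mathbf a_i$ is called free if every $\mathbf u\in\ker_{\mathbb Z}(A)$ has $u_i=0$. The configuration is non-pyramidal if it has no free vectors. Generalized Lawrence matrices: let $\mathbf a'_1,\ldots,\mathbf a'_s\in\mathbb Z^d$ be a configuration and let $\mathbf c'_i=(c'_{i1},\ldots,c'_{im_i})\in\mathbb Z^{m_i}$, $m_i\ge 1$ ($i=1,\ldots,s$) be primitive vectors (gcd of the components is $1$), each having full support (all components nonzero) and positive first component. Let $C_i\in\mathbb Z^{(m_i-1)\times m_i}$ be the matrix whose $r$-th row ($1\le r\le m_i-1$) has first entry $-c'_{i,r+1}$, $(r+1)$-st entry $c'_{i1}$, and all other entries $0$. Choose integers $\lambda_{i1},\ldots,\lambda_{im_i}$ with $\lambda_{i1}c'_{i1}+\cdots+\lambda_{im_i}c'_{im_i}=1$ and put $A_i=[\lambda_{i1}\mathbf a'_i,\ldots,\lambda_{im_i}\mathbf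 a'_i]\in\mathbb Z^{d\times m_i}$. Then $\mathrm{GLM}(\mathbf a'_1,\ldots,\mathbf a'_s\mid\mathbf c'_1,\ldots,\mathbf c'_s)$ is the block matrix with first block row $(A_1\ A_2\ \cdots\ A_s)$ and, below it, the block diagonal matrix $\mathrm{diag}(C_1,\ldots,C_s)$; it has $n=m_1+\cdots+m_s$ columns and $d+\sum_i(m_i-1)$ rows. Different choices of the $\lambda_{ij}$ give matrices with the same kernel, so the toric variety does not depend on this choice. Toric varieties: $K$ is an algebraically closed field of characteristic zero. For an integer matrix $A$ with $n$ columns, $I_A\subset K[x_1,\ldots,x_n]$ is the toric ideal generated by all binomials $x^{\mathbf u^+}-x^{\mathbf u^-}$, $\mathbf u\in\ker_{\mathbb Z}(A)$, where $\mathbf u=\mathbf u^+-\mathbf u^-$ with $\mathbf u^+,\mathbf u^-\in\mathbb N^n$ of disjoint support. Standing assumption: $(1,\ldots,1)$ lies in the (rational) row span of $A$; then $I_A$ is homogeneous and $X_A=V(I_A)\subset\mathbb P_K^{n-1}$ is a projective toric variety. The dual variety $X_A^*$ is the closure, in the dual projective space, of the set of hyperplanes that intersect the regular points of $X_A$ non-transversally. $X_A$ is self-dual if it is isomorphic to $X_A^*$ as embedded projective varieties, i.e. some linear isomorphism of the ambient projective spaces carries $X_A$ onto $X_A^*$. "After a possible renumeration of the columns" means after permuting the columns (equivalently the coordinates of $\mathbb P_K^{n-1}$). *)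

theory Defs
  imports
    "Jordan_Normal_Form.Matrix_Kernel"
    "HOL-Library.Poly_Mapping"
    "HOL-Library.Extended_Nat"
    "HOL-Computational_Algebra.Polynomial"
    "HOL-Combinatorics.Permutations"
    "HOL-Algebra.Ideal"
begin

text \<open>
  All indices are zero-based. A configuration of \<open>n\<close> vectors in \<open>\<int>\<^sup>m\<close> is the integer matrix with
  these vectors as columns.
\<close>

section \<open>Configurations\<close>

definition free_column :: "int mat \<Rightarrow> nat \<Rightarrow> bool" where
  "free_column A i \<longleftrightarrow> (\<forall>u \<in> mat_kernel A. u $ i = 0)"

definition non_pyramidal :: "int mat \<Rightarrow> bool" where
  "non_pyramidal A \<longleftrightarrow> (\<forall>i < dim_col A. \<not> free_column A i)"

definition ones_in_rational_row_span :: "int mat \<Rightarrow> bool" where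
  "ones_in_rational_row_span A \<longleftrightarrow>
     (\<exists>r \<in> carrier_vec (dim_row A).
        transpose_mat (map_mat rat_of_int A) *\<^sub>v r = vec (dim_col A) (\<lambda>_. 1))"

definition permute_columns :: "(nat \<Rightarrow> nat) \<Rightarrow> int mat \<Rightarrow> int mat" where
  "permute_columns \<pi> A = mat (dim_row A) (dim_col A) (\<lambda>(i, j). A $$ (i, \<pi> j))"


section \<open>Generalized Lawrence matrices\<close>

text \<open>
  The data are the dimension \<open>d\<close>, the list \<open>as\<close> of the vectors \<open>a'\<^sub>i\<close>, the list \<open>cs\<close> of the vectors
  \<open>c'\<^sub>i\<close> (each a list of length \<open>m\<^sub>i\<close>) and the list \<open>ls\<close> of the coefficient vectors \<open>\<lambda>\<^sub>i\<close>.
\<close>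

definition GLM_data :: "nat \<Rightarrow> int vec list \<Rightarrow> int list list \<Rightarrow> int list list \<Rightarrow> bool" where
  "GLM_data d as cs ls \<longleftrightarrow>
     set as \<subseteq> carrier_vec d \<and>
     length cs = length as \<and> length ls = length as \<and>
     (\<forall>i < length as.
        length (cs ! i) \<ge> 1 \<and>
        Gcd (set (cs ! i)) = 1 \<and>
        0 \<notin> set (cs ! i) \<and>
        cs ! i ! 0 > 0 \<and>
        length (ls ! i) = length (cs ! i) \<and>
        (\<Sum>j < length (cs ! i). ls ! i ! j * cs ! i ! j) = 1)"

definition GLM_block :: "int list \<Rightarrow> int mat" where
  "GLM_block c = mat (length c - 1) (length c)
     (\<lambda>(r, j). if j = 0 then - (c ! Suc r) else if j = Suc r then c ! 0 else 0)"

definition GLM :: "nat \<Rightarrow> int vec list \<Rightarrow> int list list \<Rightarrow> int list list \<Rightarrow> int mat" where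
  "GLM d as cs ls =
     mat_of_cols d (concat (map2 (\<lambda>a l. map (\<lambda>x. x \<cdot>\<^sub>v a) l) as ls))
     @\<^sub>r diag_block_mat (map GLM_block cs)"


section \<open>Polynomials in finitely many variables\<close>

type_synonym 'k mpoly = "(nat \<Rightarrow>\<^sub>0 nat) \<Rightarrow>\<^sub>0 'k"

definition mpoly_ring :: "nat \<Rightarrow> ('k::comm_ring_1) mpoly ring" where
  "mpoly_ring n =
     \<lparr>carrier = {p. \<forall>m \<in> Poly_Mapping.keys p. Poly_Mapping.keys m \<subseteq> {..<n}},
      mult = (*), one = 1, zero = 0, add = (+)\<rparr>"

lemma mpoly_ring_cring: "cring (mpoly_ring n :: ('k::comm_ring_1) mpoly ring)"
proof -
  define C where "C = {p :: 'k mpoly. \<forall>m \<in> Poly_Mapping.keys p. Poly_Mapping.keys m \<subseteq> {..<n}}"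
  have add: "p + q \<in> C" if "p \<in> C" "q \<in> C" for p q
    using that Poly_Mapping.keys_add[of p q] unfolding C_def by blast
  have mult: "p * q \<in> C" if "p \<in> C" "q \<in> C" for p q
  proof -
    have "Poly_Mapping.keys m \<subseteq> {..<n}" if m: "m \<in> Poly_Mapping.keys (p * q)" for m
    proof -
      obtain a b where ab: "a \<in> Poly_Mapping.keys p" "b \<in> Poly_Mapping.keys q"
        and "m = a + b"
        using keys_mult[of p q] m by blast
      then have "Poly_Mapping.keys m \<subseteq> Poly_Mapping.keys a \<union> Poly_Mapping.keys b"
        using Poly_Mapping.keys_add[of a b] by simp
      moreover have "Poly_Mapping.keys a \<subseteq> {..<n}" "Poly_Mapping.keys b \<subseteq> {..<n}"
        using ab \<open>p \<in> C\<close> \<open>q \<in> C\<close> unfolding C_def by blast+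
      ultimately show ?thesis by blast
    qed
    then show ?thesis unfolding C_def by blast
  qed
  have minus: "- p \<in> C" if "p \<in> C" for p using that unfolding C_def by simp
  have one: "1 \<in> C" and zero: "0 \<in> C" unfolding C_def by auto
  show ?thesis
    unfolding mpoly_ring_def C_def[symmetric]
  proof (rule cringI)
    show "abelian_group \<lparr>carrier = C, mult = (*), one = 1, zero = 0, add = (+)\<rparr>"
    proof (rule abelian_groupI, goal_cases)
      case (1 x y)
      then show ?case using add by simp
    next
      case 2
      show ?case using zero by simp
    next
      case (3 x y z)
      show ?case by (simp add: add.assoc)
    next
      case (4 x y)
      show ?case by (simp add: add.commute)
    next
      case (5 x)
      show ?case by simp
    next
      case (6 x)
      then show ?case using minus[of x] by (intro bexI[of _ "- x"]) simp_all
    qed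
    show "Group.comm_monoid \<lparr>carrier = C, mult = (*), one = 1, zero = 0, add = (+)\<rparr>"
    proof (rule comm_monoidI, goal_cases)
      case (1 x y)
      then show ?case using mult by simp
    next
      case 2
      show ?case using one by simp
    next
      case (3 x y z)
      show ?case by (simp add: mult.assoc)
    next
      case (4 x)
      show ?case by simp
    next
      case (5 x y)
      show ?case by (simp add: mult.commute)
    qed
  qed (simp add: distrib_right)
qed

definition mpoly_eval :: "('k::comm_ring_1) mpoly \<Rightarrow> 'k vec \<Rightarrow> 'k" where
  "mpoly_eval p v =
     (\<Sum>m \<in> Poly_Mapping.keys p.
        Poly_Mapping.lookup p m * (\<Prod>i \<in> Poly_Mapping.keys m. v $ i ^ Poly_Mapping.lookup m i))"

text \<open>
  If \<open>x\<^sub>i\<close> does not occur in the monomial \<open>m\<close>, the corresponding coefficient below is \<open>0\<close>, so the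
  truncated difference of exponents is harmless.
\<close>

definition mpoly_deriv :: "nat \<Rightarrow> ('k::comm_ring_1) mpoly \<Rightarrow> 'k mpoly" where
  "mpoly_deriv i p =
     (\<Sum>m \<in> Poly_Mapping.keys p.
        Poly_Mapping.single (m - Poly_Mapping.single i 1)
          (of_nat (Poly_Mapping.lookup m i) * Poly_Mapping.lookup p m))"


section \<open>Projective varieties\<close>

text \<open>
  A point of projective space is the set of its homogeneous coordinate vectors. A polynomial is
  required to vanish at all of them; over an infinite field this means that each homogeneous
  component vanishes at the point, so neither \<open>zero_locus\<close> nor \<open>vanishing_ideal\<close> has to mention
  homogeneity, and the zero loci are exactly the Zariski closed sets.
\<close>

definition proj_point :: "('k::field) vec \<Rightarrow> 'k vec set" where
  "proj_point v = {c \<cdot>\<^sub>v v | c. c \<noteq> 0}"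

definition proj_space :: "nat \<Rightarrow> ('k::field) vec set set" where
  "proj_space n = proj_point ` (carrier_vec n - {0\<^sub>v n})"

definition zero_locus :: "nat \<Rightarrow> ('k::field) mpoly set \<Rightarrow> 'k vec set set" where
  "zero_locus n F = {P \<in> proj_space n. \<forall>f \<in> F. \<forall>v \<in> P. mpoly_eval f v = 0}"

definition vanishing_ideal :: "nat \<Rightarrow> ('k::field) vec set set \<Rightarrow> 'k mpoly set" where
  "vanishing_ideal n X =
     {f \<in> carrier (mpoly_ring n). \<forall>P \<in> X. \<forall>v \<in> P. mpoly_eval f v = 0}"

definition zariski_closed :: "nat \<Rightarrow> ('k::field) vec set set \<Rightarrow> bool" where
  "zariski_closed n Z \<longleftrightarrow> (\<exists>F \<subseteq> carrier (mpoly_ring n). Z = zero_locus n F)"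

definition zariski_closure :: "nat \<Rightarrow> ('k::field) vec set set \<Rightarrow> 'k vec set set" where
  "zariski_closure n S = \<Inter>{Z. zariski_closed n Z \<and> S \<subseteq> Z}"

definition irreducible_closed :: "nat \<Rightarrow> ('k::field) vec set set \<Rightarrow> bool" where
  "irreducible_closed n Z \<longleftrightarrow>
     zariski_closed n Z \<and> Z \<noteq> {} \<and>
     (\<forall>Z1 Z2. zariski_closed n Z1 \<longrightarrow> zariski_closed n Z2 \<longrightarrow> Z = Z1 \<union> Z2 \<longrightarrow> Z = Z1 \<or> Z = Z2)"

text \<open>
  The Krull dimension of the local ring of \<open>X\<close> at \<open>P\<close>: the supremum of the lengths \<open>k\<close> of chains
  \<open>Z\<^sub>0 \<subset> \<dots> \<subset> Z\<^sub>k\<close> of irreducible closed subsets of \<open>X\<close> that contain \<open>P\<close>.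
\<close>

definition local_dim :: "nat \<Rightarrow> ('k::field) vec set set \<Rightarrow> 'k vec set \<Rightarrow> enat" where
  "local_dim n X P =
     Sup {enat k | k. \<exists>Z :: nat \<Rightarrow> 'k vec set set.
            (\<forall>i \<le> k. irreducible_closed n (Z i) \<and> Z i \<subseteq> X \<and> P \<in> Z i) \<and>
            (\<forall>i < k. Z i \<subset> Z (Suc i))}"

text \<open>
  The linear subspace of \<open>K\<^sup>n\<close> whose projectivization is the embedded tangent space of \<open>X\<close> at \<open>P\<close>.
\<close>

definition affine_tangent_space :: "nat \<Rightarrow> ('k::field) vec set set \<Rightarrow> 'k vec set \<Rightarrow> 'k vec set" where
  "affine_tangent_space n X P =
     {w \<in> carrier_vec n. \<forall>f \<in> vanishing_ideal n X. \<forall>v \<in> P.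
        (\<Sum>i < n. mpoly_eval (mpoly_deriv i f) v * w $ i) = 0}"

text \<open>
  Jacobian criterion: the linear dimension of the space above exceeds that of the Zariski tangent
  space by one.
\<close>

definition regular_points :: "nat \<Rightarrow> ('k::field) vec set set \<Rightarrow> 'k vec set set" where
  "regular_points n X =
     {P \<in> X. enat (vectorspace.dim class_ring
                     ((module_vec TYPE('k) n)\<lparr>carrier := affine_tangent_space n X P\<rparr>))
             = local_dim n X P + 1}"


section \<open>Dual varieties and self-duality\<close>

text \<open>
  The dual projective space is identified with \<open>proj_space n\<close>: a point \<open>H\<close> of it stands for the
  hyperplane whose coefficient vectors are the elements of \<open>H\<close>.
\<close>

definition hyperplane :: "nat \<Rightarrow> ('k::field) vec set \<Rightarrow> 'k vec set" where
  "hyperplane n H = {w \<in> carrier_vec n. \<forall>h \<in> H. h \<bullet> w = 0}"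

text \<open>
  A hyperplane meets \<open>X\<close> non-transversally at a regular point \<open>P\<close> if it passes through \<open>P\<close> and
  contains the embedded tangent space there.
\<close>

definition dual_variety :: "nat \<Rightarrow> ('k::field) vec set set \<Rightarrow> 'k vec set set" where
  "dual_variety n X =
     zariski_closure n
       {H \<in> proj_space n. \<exists>P \<in> regular_points n X.
          P \<subseteq> hyperplane n H \<and> affine_tangent_space n X P \<subseteq> hyperplane n H}"

definition self_dual :: "nat \<Rightarrow> ('k::field) vec set set \<Rightarrow> bool" where
  "self_dual n X \<longleftrightarrow>
     (\<exists>M \<in> carrier_mat n n. invertible_mat M \<and>
        (\<lambda>P. (*\<^sub>v) M ` P) ` X = dual_variety n X)"


section \<open>Toric varieties\<close>

definition vec_monomial :: "nat \<Rightarrow> (nat \<Rightarrow> nat) \<Rightarrow> ('k::comm_ring_1) mpoly" where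
  "vec_monomial n e = Poly_Mapping.single (\<Sum>i < n. Poly_Mapping.single i (e i)) 1"

definition toric_binomial :: "int vec \<Rightarrow> ('k::comm_ring_1) mpoly" where
  "toric_binomial u =
     vec_monomial (dim_vec u) (\<lambda>i. nat (u $ i)) - vec_monomial (dim_vec u) (\<lambda>i. nat (- (u $ i)))"

definition toric_ideal :: "int mat \<Rightarrow> ('k::comm_ring_1) mpoly set" where
  "toric_ideal A = Idl\<^bsub>mpoly_ring (dim_col A)\<^esub> (toric_binomial ` mat_kernel A)"

definition toric_variety :: "int mat \<Rightarrow> ('k::field) vec set set" where
  "toric_variety A = zero_locus (dim_col A) (toric_ideal A)"

end

theory Submission
  imports Defs "Jordan_Normal_Form.DL_Rank"
begin

text \<open>
  At the torus point \<open>p\<close> the tangent space of \<open>X\<^sub>A\<close> is \<open>p \<cdot> R\<close>, where \<open>R\<close> is the row space of \<open>A\<close>, so the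
  cone over the dual variety contains \<open>T \<cdot> k\<close> for every \<open>k \<in> R\<^sup>\<bottom> = ker A\<close>, where \<open>T\<close> is the torus of
  \<open>X\<^sub>A\<close>. If \<open>X\<^sub>A\<close> is self-dual, the cone over the dual variety has the dimension of \<open>T\<close>, hence the
  closure of a single orbit \<open>T \<cdot> k\<close> with \<open>k\<close> of full support contains \<open>ker A\<close>. Equivalently, for every
  integral relation \<open>u\<close> the Laurent monomial \<open>\<Prod>\<^sub>i k\<^sub>i\<^bsup>u\<^sub>i\<^esup>\<close> is constant on the relations \<open>k\<close> of full support.
  The coordinates \<open>k\<^sub>i\<close> are linear forms on \<open>ker A\<close>; comparing orders of vanishing along the zero set of
  one of them shows that the \<open>u\<^sub>i\<close> sum to zero over each class of proportional coordinates. Each class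
  contributes a primitive vector \<open>c'\<^sub>i\<close>, and merging the columns of a class with weights \<open>c'\<^sub>i\<close> gives \<open>a'\<^sub>i\<close>.

  Dimensions are compared through algebraically independent polynomial functions: along a strictly
  increasing chain of irreducible sets one more independent function appears in each step, while the
  number of monomials of degree at most \<open>N\<close> that are distinct on \<open>X\<^sub>A\<close> is \<open>O(N\<^sup>r)\<close> with \<open>r = dim R\<close>.
\<close>

section \<open>Polynomial functions\<close>

text \<open>The obstacle is the passage from equal dimension to density of one orbit, with dimension
  visible only through functions on point sets. It is settled on affine cones. The binomial
  \<open>v^(u+) * k^(u-) - v^(u-) * k^(u+)\<close> plays two roles. For \<open>u = U j\<close> it
  vanishes on the partial orbit of \<open>k\<close> under the first \<open>j\<close> torus
  parameters but not once parameter \<open>j\<close> moves as well; these binomials exhibit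
  \<open>r\<close> independent functions on the orbit of \<open>k\<close>. For a relation
  \<open>u\<close> it vanishes on the full orbit of \<open>k\<close>. If it were nonzero at another
  relation \<open>k'\<close>, it would be an \<open>(r+1)\<close>-st independent function on the
  union of the orbits of all relations. Self-duality places that union in a linear image of the cone
  of the toric variety, where the monomial count allows only \<open>r\<close>.

  The degree bound carried by \<open>polyfun\<close> serves this count. Questions about zeros are
  reduced along polynomial curves to polynomials in one variable, which over an infinite field
  vanish once they vanish at cofinitely many parameters.\<close>

inductive polyfun :: "nat \<Rightarrow> nat \<Rightarrow> ('k::field vec \<Rightarrow> 'k) \<Rightarrow> bool" for n where
  const: "polyfun n D (\<lambda>_. c)"
| coord: "i < n \<Longrightarrow> polyfun n (Suc D) (\<lambda>v. v $ i)"
| add: "polyfun n D f \<Longrightarrow> polyfun n D g \<Longrightarrow> polyfun n D (\<lambda>v. f v + g v)"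
| mult: "polyfun n D f \<Longrightarrow> polyfun n E g \<Longrightarrow> polyfun n (D + E) (\<lambda>v. f v * g v)"

lemma polyfun_mono: "polyfun n D f \<Longrightarrow> D \<le> E \<Longrightarrow> polyfun n E f"
  using polyfun.mult[of n D f "E - D" "\<lambda>_. 1"] polyfun.const[of n "E - D" 1] by simp

lemma polyfun_sum:
  "(\<And>i. i \<in> I \<Longrightarrow> polyfun n D (f i)) \<Longrightarrow> polyfun n D (\<lambda>v. \<Sum>i\<in>I. f i v)"
  by (induction I rule: infinite_finite_induct) (auto intro: polyfun.intros)

lemma polyfun_scale: "polyfun n D f \<Longrightarrow> polyfun n D (\<lambda>v. c * f v)"
  using polyfun.mult[OF polyfun.const[of n 0 c], of D f] by simp

lemma polyfun_diff:
  assumes "polyfun n D f" "polyfun n D g" shows "polyfun n D (\<lambda>v. f v - g v)"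
  using polyfun.add[OF assms(1) polyfun_scale[OF assms(2), of "-1"]] by simp

lemma polyfun_power: "polyfun n D f \<Longrightarrow> polyfun n (e * D) (\<lambda>v. f v ^ e)"
  by (induction e) (auto intro: polyfun.intros)

lemma polyfun_prod:
  "(\<And>i. i \<in> I \<Longrightarrow> \<exists>D. polyfun n D (f i)) \<Longrightarrow> \<exists>D. polyfun n D (\<lambda>v. \<Prod>i\<in>I. f i v)"
proof (induction I rule: infinite_finite_induct)
  case (insert i I)
  obtain D where D: "polyfun n D (f i)" using insert.prems by blast
  obtain E where E: "polyfun n E (\<lambda>v. \<Prod>i\<in>I. f i v)" using insert by blast
  from polyfun.mult[OF D E] insert.hyps show ?case by auto
qed (auto intro: polyfun.const)

lemma polyfun_sum':
  "(\<And>i. i \<in> I \<Longrightarrow> \<exists>D. polyfun n D (f i)) \<Longrightarrow> \<exists>D. polyfun n D (\<lambda>v. \<Sum>i\<in>I. f i v)"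
proof (induction I rule: infinite_finite_induct)
  case (insert i I)
  obtain D where D: "polyfun n D (f i)" using insert.prems by blast
  obtain E where E: "polyfun n E (\<lambda>v. \<Sum>i\<in>I. f i v)" using insert by blast
  have "polyfun n (max D E) (\<lambda>v. f i v + (\<Sum>i\<in>I. f i v))"
    by (intro polyfun.add) (auto intro: polyfun_mono[OF D] polyfun_mono[OF E])
  with insert.hyps show ?case by auto
qed (auto intro: polyfun.const)

text \<open>A linear substitution respects degree bounds; this is how the matrix of a self-duality
  enters the count of monomials.\<close>

lemma polyfun_mult_mat_vec:
  assumes "polyfun n D f" and M: "M \<in> carrier_mat n n"
  shows "\<exists>g. polyfun n D g \<and> (\<forall>v \<in> carrier_vec n. g v = f (M *\<^sub>v v))"
  using assms(1)
proof induction
  case (const D c)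
  show ?case by (rule exI[of _ "\<lambda>_. c"]) (simp add: polyfun.const)
next
  case (coord i D)
  have "polyfun n (Suc D) (\<lambda>v. \<Sum>j<n. M $$ (i, j) * v $ j)"
    by (intro polyfun_sum polyfun_scale polyfun.coord) auto
  then show ?case using M coord
    by (intro exI[of _ "\<lambda>v. \<Sum>j<n. M $$ (i, j) * v $ j"])
       (auto simp: scalar_prod_def lessThan_atLeast0 intro!: sum.cong)
next
  case (add D f g)
  then obtain f' g' where "polyfun n D f'" "\<forall>v \<in> carrier_vec n. f' v = f (M *\<^sub>v v)"
    "polyfun n D g'" "\<forall>v \<in> carrier_vec n. g' v = g (M *\<^sub>v v)" by blast
  then show ?case by (intro exI[of _ "\<lambda>v. f' v + g' v"]) (simp add: polyfun.add)
next
  case (mult D f E g)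
  then obtain f' g' where "polyfun n D f'" "\<forall>v \<in> carrier_vec n. f' v = f (M *\<^sub>v v)"
    "polyfun n E g'" "\<forall>v \<in> carrier_vec n. g' v = g (M *\<^sub>v v)" by blast
  then show ?case by (intro exI[of _ "\<lambda>v. f' v * g' v"]) (simp add: polyfun.mult)
qed

lemma polyfun_curve:
  assumes "polyfun n D f"
  shows "\<exists>F. \<forall>s. f (vec n (\<lambda>i. poly (\<gamma> i) s)) = poly F s"
  using assms
proof induction
  case (const D c)
  show ?case by (rule exI[of _ "[:c:]"]) simp
next
  case (coord i D)
  then show ?case by auto
next
  case (add D f g)
  then show ?case by (metis poly_add)
next
  case (mult D f E g)
  then show ?case by (metis poly_mult)
qed

section \<open>Formal polynomials and the functions they define\<close>

definition monomial_eval :: "('k::comm_ring_1) vec \<Rightarrow> (nat \<Rightarrow>\<^sub>0 nat) \<Rightarrow> 'k" where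
  "monomial_eval v m = (\<Prod>i \<in> Poly_Mapping.keys m. v $ i ^ Poly_Mapping.lookup m i)"

lemma monomial_eval_superset:
  assumes "finite I" "Poly_Mapping.keys m \<subseteq> I"
  shows "monomial_eval v m = (\<Prod>i \<in> I. v $ i ^ Poly_Mapping.lookup m i)"
  unfolding monomial_eval_def
  by (rule prod.mono_neutral_left) (use assms in \<open>auto simp: in_keys_iff\<close>)

lemma monomial_eval_add: "monomial_eval v (a + b) = monomial_eval v a * monomial_eval v b"
proof -
  let ?I = "Poly_Mapping.keys a \<union> Poly_Mapping.keys b"
  have "monomial_eval v (a + b) = (\<Prod>i \<in> ?I. v $ i ^ Poly_Mapping.lookup (a + b) i)"
    by (rule monomial_eval_superset) (auto simp: Poly_Mapping.keys_add)
  also have "\<dots> = (\<Prod>i \<in> ?I. v $ i ^ Poly_Mapping.lookup a i) * (\<Prod>i \<in> ?I. v $ i ^ Poly_Mapping.lookup b i)"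
    by (simp add: lookup_add power_add prod.distrib)
  also have "\<dots> = monomial_eval v a * monomial_eval v b"
    by (simp add: monomial_eval_superset[of ?I])
  finally show ?thesis .
qed

lemma mpoly_eval_superset:
  assumes "finite K" "Poly_Mapping.keys p \<subseteq> K"
  shows "mpoly_eval p v = (\<Sum>m \<in> K. Poly_Mapping.lookup p m * monomial_eval v m)"
  unfolding mpoly_eval_def monomial_eval_def[symmetric]
  by (rule sum.mono_neutral_left) (use assms in \<open>auto simp: in_keys_iff\<close>)

lemma mpoly_eval_single: "mpoly_eval (Poly_Mapping.single m c) v = c * monomial_eval v m"
  by (subst mpoly_eval_superset[of "{m}"]) (auto simp: lookup_single)

lemma mpoly_eval_0 [simp]: "mpoly_eval 0 v = 0"
  by (simp add: mpoly_eval_def)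

lemma mpoly_eval_add: "mpoly_eval (p + q) v = mpoly_eval p v + mpoly_eval q v"
proof -
  let ?K = "Poly_Mapping.keys p \<union> Poly_Mapping.keys q"
  have "mpoly_eval (p + q) v = (\<Sum>m \<in> ?K. Poly_Mapping.lookup (p + q) m * monomial_eval v m)"
    by (rule mpoly_eval_superset) (auto simp: Poly_Mapping.keys_add)
  then show ?thesis
    by (simp add: mpoly_eval_superset[of ?K] lookup_add sum.distrib distrib_right)
qed

lemma mpoly_eval_uminus: "mpoly_eval (- p) v = - mpoly_eval p v"
  using mpoly_eval_add[of "- p" p v] by (simp add: eq_neg_iff_add_eq_0)

lemma mpoly_eval_diff: "mpoly_eval (p - q) v = mpoly_eval p v - mpoly_eval q v"
  using mpoly_eval_add[of p "- q" v] by (simp add: mpoly_eval_uminus)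

lemma mpoly_eval_sum: "mpoly_eval (\<Sum>i\<in>I. p i) v = (\<Sum>i\<in>I. mpoly_eval (p i) v)"
  by (induction I rule: infinite_finite_induct) (auto simp: mpoly_eval_add)

lemma poly_mapping_sum_single:
  "(\<Sum>m\<in>Poly_Mapping.keys p. Poly_Mapping.single m (Poly_Mapping.lookup p m)) = p"
  by (rule poly_mapping_eqI) (simp add: lookup_sum lookup_single when_def in_keys_iff)

lemma mpoly_eval_mult: "mpoly_eval (p * q) v = mpoly_eval p v * mpoly_eval q v"
proof -
  have "p * q = (\<Sum>a\<in>Poly_Mapping.keys p. \<Sum>b\<in>Poly_Mapping.keys q.
     Poly_Mapping.single (a + b) (Poly_Mapping.lookup p a * Poly_Mapping.lookup q b))"
    by (subst (1 2) poly_mapping_sum_single[symmetric])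
       (simp add: sum_product mult_single)
  then have "mpoly_eval (p * q) v = (\<Sum>a\<in>Poly_Mapping.keys p. \<Sum>b\<in>Poly_Mapping.keys q.
     Poly_Mapping.lookup p a * Poly_Mapping.lookup q b * (monomial_eval v a * monomial_eval v b))"
    by (simp add: mpoly_eval_sum mpoly_eval_single monomial_eval_add)
  then show ?thesis
    by (simp add: mpoly_eval_superset[OF finite_keys subset_refl] sum_product ac_simps)
qed

lemma carrier_mpoly_ring:
  "p \<in> carrier (mpoly_ring n) \<longleftrightarrow> (\<forall>m \<in> Poly_Mapping.keys p. Poly_Mapping.keys m \<subseteq> {..<n})"
  by (simp add: mpoly_ring_def)

lemma polyfun_mpoly_eval:
  assumes "p \<in> carrier (mpoly_ring n)"
  shows "\<exists>D. polyfun n D (mpoly_eval p)"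
proof -
  have "\<exists>D. polyfun n D (\<lambda>v. \<Sum>m \<in> Poly_Mapping.keys p. Poly_Mapping.lookup p m * monomial_eval v m)"
  proof (rule polyfun_sum')
    fix m assume m: "m \<in> Poly_Mapping.keys p"
    have "\<exists>D. polyfun n D (\<lambda>v. \<Prod>i\<in>Poly_Mapping.keys m. v $ i ^ Poly_Mapping.lookup m i)"
    proof (rule polyfun_prod)
      fix i assume "i \<in> Poly_Mapping.keys m"
      then have "i < n" using m assms by (auto simp: carrier_mpoly_ring)
      from polyfun_power[OF polyfun.coord[OF this]]
      show "\<exists>D. polyfun n D (\<lambda>v. v $ i ^ Poly_Mapping.lookup m i)" by blast
    qed
    then show "\<exists>D. polyfun n D (\<lambda>v. Poly_Mapping.lookup p m * monomial_eval v m)"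
      unfolding monomial_eval_def using polyfun_scale by fast
  qed
  then show ?thesis by (simp add: mpoly_eval_superset[OF finite_keys subset_refl, abs_def])
qed

lemma polyfun_imp_mpoly_eval:
  assumes "polyfun n D f"
  shows "\<exists>p \<in> carrier (mpoly_ring n). mpoly_eval p = f"
  using assms
proof induction
  case (const D c)
  show ?case
    by (rule bexI[of _ "Poly_Mapping.single 0 c"])
       (auto simp: carrier_mpoly_ring fun_eq_iff mpoly_eval_single monomial_eval_def)
next
  case (coord i D)
  then show ?case
    by (intro bexI[of _ "Poly_Mapping.single (Poly_Mapping.single i 1) 1"])
       (auto simp: carrier_mpoly_ring fun_eq_iff mpoly_eval_single monomial_eval_superset[of "{i}"] lookup_single)
next
  case (add D f g)
  then obtain p q where "p \<in> carrier (mpoly_ring n)" "mpoly_eval p = f"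
    "q \<in> carrier (mpoly_ring n)" "mpoly_eval q = g" by blast
  then show ?case
    using Poly_Mapping.keys_add[of p q]
    by (intro bexI[of _ "p + q"]) (auto simp: mpoly_eval_add carrier_mpoly_ring)
next
  case (mult D f E g)
  then obtain p q where pq: "p \<in> carrier (mpoly_ring n)" "mpoly_eval p = f"
    "q \<in> carrier (mpoly_ring n)" "mpoly_eval q = g" by blast
  interpret cring "mpoly_ring n :: 'a mpoly ring" by (rule mpoly_ring_cring)
  have "p * q \<in> carrier (mpoly_ring n)"
    using m_closed[OF pq(1,3)] by (simp add: mpoly_ring_def)
  then show ?case using pq by (intro bexI[of _ "p * q"]) (auto simp: mpoly_eval_mult)
qed

section \<open>Algebraic independence along chains of irreducible sets\<close>

text \<open>Primality of the vanishing ideal of \<open>S\<close>, expressed on points. It makes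
  sense for sets that are not closed, so it applies directly to orbits.\<close>

definition irreducible_set :: "nat \<Rightarrow> ('k::field) vec set \<Rightarrow> bool" where
  "irreducible_set n S \<longleftrightarrow> S \<noteq> {} \<and> S \<subseteq> carrier_vec n \<and>
     (\<forall>f g D E. polyfun n D f \<longrightarrow> polyfun n E g \<longrightarrow> (\<forall>v \<in> S. f v * g v = 0) \<longrightarrow>
        (\<forall>v \<in> S. f v = 0) \<or> (\<forall>v \<in> S. g v = 0))"

lemma irreducible_setD:
  assumes "irreducible_set n S" "polyfun n D f" "polyfun n E g" "\<And>v. v \<in> S \<Longrightarrow> f v * g v = 0"
    "u \<in> S" "f u \<noteq> 0" "v \<in> S"
  shows "g v = 0"
  using assms unfolding irreducible_set_def by blast

lemma irreducible_set_power:
  assumes S: "irreducible_set n S" "polyfun n D f" "polyfun n E g"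
    and u: "u \<in> S" "f u \<noteq> 0"
    and z: "\<And>v. v \<in> S \<Longrightarrow> f v ^ e * g v = 0" and "v \<in> S"
  shows "g v = 0"
  using irreducible_setD[OF S(1) polyfun_power[OF S(2), of e] S(3) z u(1) _ \<open>v \<in> S\<close>] u(2) by simp

lemma poly_cofinite_zero:
  fixes F :: "'k::field_char_0 poly"
  assumes "finite {s. poly F s \<noteq> 0}"
  shows "F = 0"
proof (rule ccontr)
  assume "F \<noteq> 0"
  then have "finite {s. poly F s = 0}" by (rule poly_roots_finite)
  with assms have "finite ({s. poly F s = 0} \<union> {s. poly F s \<noteq> 0})" by blast
  moreover have "{s. poly F s = 0} \<union> {s. poly F s \<noteq> 0} = UNIV" by auto
  ultimately show False using infinite_UNIV_char_0[where 'a='k] by simp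
qed

text \<open>If \<open>f\<close> is nonzero at \<open>p\<close> and \<open>g\<close> at
  \<open>q\<close>, their restrictions to a curve from \<open>p\<close> to \<open>q\<close> are
  nonzero polynomials, and so is the product; but the product vanishes at every parameter whose
  point is in \<open>S\<close>. Finitely many exceptional parameters are allowed because a curve of
  torus elements may degenerate.\<close>

lemma irreducible_set_curves:
  fixes S :: "'k::field_char_0 vec set"
  assumes "S \<noteq> {}" "S \<subseteq> carrier_vec n"
    and curve: "\<And>p q. p \<in> S \<Longrightarrow> q \<in> S \<Longrightarrow> \<exists>\<gamma>. vec n (\<lambda>i. poly (\<gamma> i) 0) = p \<and>
           vec n (\<lambda>i. poly (\<gamma> i) 1) = q \<and> finite {s. vec n (\<lambda>i. poly (\<gamma> i) s) \<notin> S}"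
  shows "irreducible_set n S"
  unfolding irreducible_set_def
proof (intro conjI allI impI assms(1,2))
  fix f g :: "'k vec \<Rightarrow> 'k" and D E
  assume fg: "polyfun n D f" "polyfun n E g" and z: "\<forall>v \<in> S. f v * g v = 0"
  show "(\<forall>v \<in> S. f v = 0) \<or> (\<forall>v \<in> S. g v = 0)"
  proof (rule ccontr)
    assume "\<not> ?thesis"
    then obtain p q where pq: "p \<in> S" "f p \<noteq> 0" "q \<in> S" "g q \<noteq> 0" by blast
    obtain \<gamma> where \<gamma>: "vec n (\<lambda>i. poly (\<gamma> i) 0) = p" "vec n (\<lambda>i. poly (\<gamma> i) 1) = q"
      "finite {s. vec n (\<lambda>i. poly (\<gamma> i) s) \<notin> S}"
      using curve[OF pq(1,3)] by blast
    obtain F where F: "\<And>s. f (vec n (\<lambda>i. poly (\<gamma> i) s)) = poly F s"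
      using polyfun_curve[OF fg(1)] by blast
    obtain G where G: "\<And>s. g (vec n (\<lambda>i. poly (\<gamma> i) s)) = poly G s"
      using polyfun_curve[OF fg(2)] by blast
    have "{s. poly (F * G) s \<noteq> 0} \<subseteq> {s. vec n (\<lambda>i. poly (\<gamma> i) s) \<notin> S}"
      using z by (auto simp: F[symmetric] G[symmetric])
    then have "F * G = 0" by (intro poly_cofinite_zero) (rule finite_subset[OF _ \<gamma>(3)])
    then show False using F[of 0] G[of 1] \<gamma>(1,2) pq by auto
  qed
qed

section \<open>Algebraic independence of functions on a set\<close>

definition exponent_box :: "nat \<Rightarrow> nat \<Rightarrow> nat list set" where
  "exponent_box N k = {\<alpha>. set \<alpha> \<subseteq> {..N} \<and> length \<alpha> = k}"

definition monomial_in :: "('a \<Rightarrow> 'k::field) list \<Rightarrow> nat list \<Rightarrow> 'a \<Rightarrow> 'k" where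
  "monomial_in gs \<alpha> v = prod_list (map2 (\<lambda>g e. g v ^ e) gs \<alpha>)"

text \<open>Every polynomial relation fits into some box of exponents, so ranging over all
  \<open>N\<close> covers them all. Boxes, unlike bounds on the total degree, have a simple
  cardinality and split off the first exponent.\<close>

definition alg_indep_on :: "'a set \<Rightarrow> ('a \<Rightarrow> 'k::field) list \<Rightarrow> bool" where
  "alg_indep_on S gs \<longleftrightarrow>
     (\<forall>N c. (\<forall>v \<in> S. (\<Sum>\<alpha>\<in>exponent_box N (length gs). c \<alpha> * monomial_in gs \<alpha> v) = 0) \<longrightarrow>
        (\<forall>\<alpha> \<in> exponent_box N (length gs). c \<alpha> = 0))"

lemma alg_indep_onD:
  assumes "alg_indep_on S gs" "\<alpha> \<in> exponent_box N (length gs)"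
    and "\<And>v. v \<in> S \<Longrightarrow> (\<Sum>\<alpha>\<in>exponent_box N (length gs). c \<alpha> * monomial_in gs \<alpha> v) = 0"
  shows "c \<alpha> = 0"
  using assms unfolding alg_indep_on_def by blast

lemma finite_exponent_box [simp]: "finite (exponent_box N k)"
  and card_exponent_box: "card (exponent_box N k) = Suc N ^ k"
  by (simp_all add: exponent_box_def finite_lists_length_eq card_lists_length_eq)

lemma exponent_box_0 [simp]: "exponent_box N 0 = {[]}"
  by (auto simp: exponent_box_def)

lemma sum_exponent_box_Suc:
  "(\<Sum>\<alpha>\<in>exponent_box N (Suc k). F \<alpha>) = (\<Sum>e\<le>N. \<Sum>\<beta>\<in>exponent_box N k. F (e # \<beta>))"
proof -
  have "exponent_box N (Suc k) = (\<lambda>(e, \<beta>). e # \<beta>) ` ({..N} \<times> exponent_box N k)"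
    by (auto simp: exponent_box_def length_Suc_conv image_iff)
  moreover have "inj_on (\<lambda>(e, \<beta>). e # \<beta>) ({..N} \<times> exponent_box N k)"
    by (auto simp: inj_on_def)
  ultimately have "(\<Sum>\<alpha>\<in>exponent_box N (Suc k). F \<alpha>) =
      (\<Sum>(e, \<beta>)\<in>{..N} \<times> exponent_box N k. F (e # \<beta>))"
    by (simp add: sum.reindex case_prod_unfold)
  then show ?thesis by (simp add: sum.cartesian_product)
qed

lemma alg_indep_on_Nil: "S \<noteq> {} \<Longrightarrow> alg_indep_on S []"
  by (auto simp: alg_indep_on_def monomial_in_def)

lemma polyfun_monomial_in:
  assumes "\<And>g. g \<in> set gs \<Longrightarrow> polyfun n D g" "length \<alpha> = length gs" "set \<alpha> \<subseteq> {..N}"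
  shows "polyfun n (length gs * (N * D)) (monomial_in gs \<alpha>)"
  using assms
proof (induction gs arbitrary: \<alpha>)
  case Nil
  then show ?case by (simp add: monomial_in_def[abs_def] polyfun.const)
next
  case (Cons g gs)
  then obtain e \<beta> where \<alpha>: "\<alpha> = e # \<beta>" by (cases \<alpha>) auto
  have "polyfun n (N * D) (\<lambda>v. g v ^ e)"
    by (rule polyfun_mono[OF polyfun_power]) (use Cons.prems \<alpha> in auto)
  moreover have "polyfun n (length gs * (N * D)) (monomial_in gs \<beta>)"
    using Cons \<alpha> by auto
  ultimately show ?case
    using polyfun.mult \<alpha> by (fastforce simp: monomial_in_def[abs_def])
qed

lemma polyfuns_common_degree:
  assumes "\<And>g. g \<in> set gs \<Longrightarrow> \<exists>D. polyfun n D g"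
  shows "\<exists>D. \<forall>g \<in> set gs. polyfun n D g"
proof -
  obtain d where d: "\<And>g. g \<in> set gs \<Longrightarrow> polyfun n (d g) g" using assms by metis
  have "polyfun n (Max (d ` set gs)) g" if "g \<in> set gs" for g
    by (rule polyfun_mono[OF d[OF that]]) (use that in auto)
  then show ?thesis by blast
qed

text \<open>
  In a relation \<open>\<Sum>\<^sub>e g\<^sup>e h\<^sub>e = 0\<close> on \<open>S'\<close>, the lowest power of \<open>g\<close> can be cancelled because \<open>S'\<close> is
  irreducible; restricting to \<open>S\<close> then kills the lowest coefficient \<open>h\<^sub>e\<close>.
\<close>

lemma alg_indep_on_Cons:
  assumes gs: "\<And>h. h \<in> set gs \<Longrightarrow> \<exists>D. polyfun n D h" and ind: "alg_indep_on S gs"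
    and g: "polyfun n D g" "\<And>v. v \<in> S \<Longrightarrow> g v = 0" "u \<in> S'" "g u \<noteq> 0"
    and S': "irreducible_set n S'"
    and restr: "\<And>E f v. polyfun n E f \<Longrightarrow> (\<And>w. w \<in> S' \<Longrightarrow> f w = 0) \<Longrightarrow> v \<in> S \<Longrightarrow> f v = 0"
  shows "alg_indep_on S' (g # gs)"
  unfolding alg_indep_on_def
proof (intro allI impI)
  fix N c
  let ?B = "exponent_box N (length gs)"
  define h where "h e v = (\<Sum>\<beta>\<in>?B. c (e # \<beta>) * monomial_in gs \<beta> v)" for e v
  assume "\<forall>v \<in> S'. (\<Sum>\<alpha>\<in>exponent_box N (length (g # gs)). c \<alpha> * monomial_in (g # gs) \<alpha> v) = 0"
  then have rel: "(\<Sum>e\<le>N. g v ^ e * h e v) = 0" if "v \<in> S'" for v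
    using that by (simp add: sum_exponent_box_Suc monomial_in_def h_def sum_distrib_left mult.left_commute)
  have h_poly: "\<exists>D. polyfun n D (h e)" for e
  proof -
    obtain D where D: "\<And>g. g \<in> set gs \<Longrightarrow> polyfun n D g"
      using polyfuns_common_degree[of gs n] gs by blast
    have "polyfun n (length gs * (N * D)) (h e)" unfolding h_def
      by (intro polyfun_sum polyfun_scale polyfun_monomial_in D)
         (auto simp: exponent_box_def)
    then show ?thesis ..
  qed
  have zero: "e \<le> N \<longrightarrow> (\<forall>\<beta> \<in> ?B. c (e # \<beta>) = 0)" for e
  proof (induction e rule: less_induct)
    case (less e)
    show ?case
    proof
      assume e: "e \<le> N"
      have h0: "h e' v = 0" if "e' < e" for e' v
        using less that e by (simp add: h_def)
      define H where "H v = (\<Sum>i\<in>{e..N}. g v ^ (i - e) * h i v)" for v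
      have "g v ^ e * H v = (\<Sum>i\<le>N. g v ^ i * h i v)" for v
      proof -
        have "g v ^ e * H v = (\<Sum>i\<in>{e..N}. g v ^ i * h i v)"
          by (auto simp: H_def sum_distrib_left power_add[symmetric] mult.assoc[symmetric] intro!: sum.cong)
        also have "\<dots> = (\<Sum>i\<le>N. g v ^ i * h i v)"
          by (rule sum.mono_neutral_left) (auto simp: h0)
        finally show ?thesis .
      qed
      then have gH: "g v ^ e * H v = 0" if "v \<in> S'" for v using rel that by simp
      have "\<exists>D. polyfun n D H" unfolding H_def
      proof (rule polyfun_sum')
        fix i
        obtain E where "polyfun n E (h i)" using h_poly by blast
        from polyfun.mult[OF polyfun_power[OF g(1)] this]
        show "\<exists>D. polyfun n D (\<lambda>v. g v ^ (i - e) * h i v)" by blast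
      qed
      then obtain E where E: "polyfun n E H" by blast
      have "H v = 0" if "v \<in> S'" for v
        by (rule irreducible_set_power[OF S' g(1) E g(3,4) gH that])
      then have HS: "H v = 0" if "v \<in> S" for v using restr[OF E _ that] by blast
      have "h e v = 0" if "v \<in> S" for v
      proof -
        have "H v = (\<Sum>i\<in>{e..N}. if i = e then h e v else 0)"
          unfolding H_def by (rule sum.cong) (auto simp: g(2)[OF that])
        then show ?thesis using HS[OF that] e by simp
      qed
      then show "\<forall>\<beta> \<in> ?B. c (e # \<beta>) = 0"
        unfolding h_def by (intro ballI alg_indep_onD[OF ind, where c = "\<lambda>\<beta>. c (e # \<beta>)"])
    qed
  qed
  show "\<forall>\<alpha> \<in> exponent_box N (length (g # gs)). c \<alpha> = 0"
    using zero by (auto simp: exponent_box_def length_Suc_conv)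
qed

section \<open>Bounds for the transcendence degree\<close>

definition trdeg_ge :: "nat \<Rightarrow> ('k::field) vec set \<Rightarrow> nat \<Rightarrow> bool" where
  "trdeg_ge n S k \<longleftrightarrow>
     (\<exists>gs. length gs = k \<and> (\<forall>g \<in> set gs. \<exists>D. polyfun n D g) \<and> alg_indep_on S gs)"

lemma trdeg_ge_0: "S \<noteq> {} \<Longrightarrow> trdeg_ge n S 0"
  by (auto simp: trdeg_ge_def alg_indep_on_Nil)

text \<open>The last hypothesis says that \<open>S\<close> lies in the Zariski closure of
  \<open>S'\<close>. This is weaker than inclusion and lets a chain start at the origin, which an
  orbit of nonzero points only has in its closure.\<close>

lemma trdeg_ge_Suc:
  assumes "trdeg_ge n S k"
    and "polyfun n D g" "\<And>v. v \<in> S \<Longrightarrow> g v = 0" "u \<in> S'" "g u \<noteq> 0" "irreducible_set n S'"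
    and "\<And>E f v. polyfun n E f \<Longrightarrow> (\<And>w. w \<in> S' \<Longrightarrow> f w = 0) \<Longrightarrow> v \<in> S \<Longrightarrow> f v = 0"
  shows "trdeg_ge n S' (Suc k)"
proof -
  obtain gs where gs: "length gs = k" "\<forall>g \<in> set gs. \<exists>D. polyfun n D g" "alg_indep_on S gs"
    using assms(1) by (auto simp: trdeg_ge_def)
  have "alg_indep_on S' (g # gs)"
    by (rule alg_indep_on_Cons[where S = S and u = u]) (use assms gs in blast)+
  with gs assms(2) show ?thesis
    by (auto simp: trdeg_ge_def intro!: exI[of _ "g # gs"])
qed

lemma trdeg_ge_Suc_subset:
  assumes "trdeg_ge n S k" "S \<subseteq> S'"
    and "polyfun n D g" "\<And>v. v \<in> S \<Longrightarrow> g v = 0" "u \<in> S'" "g u \<noteq> 0" "irreducible_set n S'"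
  shows "trdeg_ge n S' (Suc k)"
  by (rule trdeg_ge_Suc[OF assms(1,3-7)]) (use assms(2) in blast)+

lemma underdetermined_system:
  fixes M :: "'i \<Rightarrow> 'b \<Rightarrow> 'k::field"
  assumes "finite B" "finite I" "card B < card I"
  shows "\<exists>c. (\<exists>i\<in>I. c i \<noteq> 0) \<and> (\<forall>b\<in>B. (\<Sum>i\<in>I. c i * M i b) = 0)"
  using assms
proof (induction B arbitrary: I M rule: finite_induct)
  case empty
  then have "I \<noteq> {}" by auto
  then show ?case by (intro exI[of _ "\<lambda>_. 1"]) auto
next
  case (insert b B)
  show ?case
  proof (cases "\<exists>j\<in>I. M j b \<noteq> 0")
    case False
    have "card B < card I" using insert by simp
    from insert.IH[OF insert.prems(1) this, of M] False show ?thesis by auto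
  next
    case True
    then obtain j where j: "j \<in> I" "M j b \<noteq> 0" by blast
    \<comment> \<open>Equation \<open>b\<close> is solved for the unknown \<open>j\<close>. The
      \<open>M'\<close> are the coefficients after substitution, with \<open>M' i b = 0\<close>, and
      \<open>t\<close> below is the value recovered for that unknown.\<close>
    define M' where "M' i a = M i a - M i b / M j b * M j a" for i a
    have "card B < card (I - {j})" using insert j by simp
    then obtain c where c: "\<exists>i\<in>I - {j}. c i \<noteq> 0" "\<forall>a\<in>B. (\<Sum>i\<in>I - {j}. c i * M' i a) = 0"
      using insert.IH[of "I - {j}" M'] insert.prems(1) by auto
    define t where "t = - (\<Sum>i\<in>I - {j}. c i * (M i b / M j b))"
    define c' where "c' = c(j := t)"
    have sum: "(\<Sum>i\<in>I. c' i * M i a) = (\<Sum>i\<in>I - {j}. c i * M' i a)" for a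
    proof -
      have "(\<Sum>i\<in>I. c' i * M i a) = c' j * M j a + (\<Sum>i\<in>I - {j}. c' i * M i a)"
        using j insert.prems(1) by (simp add: sum.remove)
      also have "(\<Sum>i\<in>I - {j}. c' i * M i a) = (\<Sum>i\<in>I - {j}. c i * M i a)"
        by (rule sum.cong) (auto simp: c'_def)
      finally show ?thesis
        by (simp add: c'_def t_def M'_def sum_distrib_right sum_distrib_left right_diff_distrib sum_subtractf mult.assoc)
    qed
    have "(\<Sum>i\<in>I. c' i * M i a) = 0" if "a \<in> insert b B" for a
    proof (cases "a \<in> B")
      case False
      then have "a = b" using that by simp
      then show ?thesis unfolding sum M'_def using j by simp
    qed (use sum c in simp)
    moreover have "\<exists>i\<in>I. c' i \<noteq> 0" using c(1) by (auto simp: c'_def)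
    ultimately show ?thesis by blast
  qed
qed

text \<open>Counting monomials: a polynomially bounded Hilbert function bounds the transcendence degree.\<close>

lemma trdeg_ge_le:
  fixes V :: "'k::field vec set" and \<chi> :: "nat \<Rightarrow> 'b \<Rightarrow> 'k vec \<Rightarrow> 'k"
  assumes tr: "trdeg_ge n S k" and "S \<subseteq> V"
    and fin: "\<And>D. finite (B D)" and card: "\<And>D. card (B D) \<le> Suc (C * D) ^ r"
    and span: "\<And>D f. polyfun n D f \<Longrightarrow> \<exists>c. \<forall>v \<in> V. f v = (\<Sum>b\<in>B D. c b * \<chi> D b v)"
  shows "k \<le> r"
proof (rule ccontr)
  assume "\<not> k \<le> r"
  obtain gs where gs: "length gs = k" "\<forall>g \<in> set gs. \<exists>D. polyfun n D g" "alg_indep_on S gs"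
    using tr by (auto simp: trdeg_ge_def)
  obtain D where D: "\<forall>g \<in> set gs. polyfun n D g" using polyfuns_common_degree gs by blast
  \<comment> \<open>\<open>E\<close> bounds the degree of the box monomials in \<open>gs\<close>. By
    the choice of \<open>N\<close>, at most \<open>((C' + 1) * (N + 1))^r = N * (N + 1)^r\<close>
    functions span that degree, fewer than the \<open>(N + 1)^k\<close> monomials when
    \<open>k > r\<close>.\<close>
  define C' where "C' = C * k * D"
  define N where "N = Suc C' ^ r"
  define E where "E = k * (N * D)"
  let ?I = "exponent_box N k"
  have "Suc (C * E) \<le> Suc C' * Suc N" by (simp add: E_def C'_def)
  then have "card (B E) \<le> (Suc C' * Suc N) ^ r"
    using card[of E] power_mono[of "Suc (C * E)" "Suc C' * Suc N" r] by simp
  also have "\<dots> = N * Suc N ^ r" by (simp only: power_mult_distrib N_def)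
  also have "\<dots> < Suc N ^ Suc r" by simp
  also have "\<dots> \<le> Suc N ^ k" using \<open>\<not> k \<le> r\<close> by (intro power_increasing) auto
  finally have lt: "card (B E) < card ?I" by (simp add: card_exponent_box)
  have "\<exists>M. \<forall>v\<in>V. monomial_in gs \<alpha> v = (\<Sum>b\<in>B E. M b * \<chi> E b v)" if "\<alpha> \<in> ?I" for \<alpha>
    using polyfun_monomial_in[of gs n D \<alpha> N] that D gs(1)
    by (intro span) (auto simp: exponent_box_def E_def)
  then obtain M where M: "\<And>\<alpha> v. \<alpha> \<in> ?I \<Longrightarrow> v \<in> V \<Longrightarrow> monomial_in gs \<alpha> v = (\<Sum>b\<in>B E. M \<alpha> b * \<chi> E b v)"
    by metis
  obtain c where c: "\<exists>\<alpha>\<in>?I. c \<alpha> \<noteq> 0" "\<forall>b\<in>B E. (\<Sum>\<alpha>\<in>?I. c \<alpha> * M \<alpha> b) = 0"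
    using underdetermined_system[OF fin finite_exponent_box lt] by blast
  have "(\<Sum>\<alpha>\<in>?I. c \<alpha> * monomial_in gs \<alpha> v) = 0" if "v \<in> S" for v
  proof -
    have v: "v \<in> V" using that assms(2) by blast
    have "(\<Sum>\<alpha>\<in>?I. c \<alpha> * monomial_in gs \<alpha> v) = (\<Sum>\<alpha>\<in>?I. \<Sum>b\<in>B E. c \<alpha> * M \<alpha> b * \<chi> E b v)"
      using M[OF _ v] by (simp add: sum_distrib_left mult.assoc)
    also have "\<dots> = (\<Sum>b\<in>B E. (\<Sum>\<alpha>\<in>?I. c \<alpha> * M \<alpha> b) * \<chi> E b v)"
      by (subst sum.swap) (simp add: sum_distrib_right)
    also have "\<dots> = 0" using c(2) by simp
    finally show ?thesis .
  qed
  then show False using gs(3) c(1) unfolding alg_indep_on_def gs(1) by blast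
qed

section \<open>The cone over a toric variety\<close>

definition power_product :: "nat \<Rightarrow> ('k::comm_monoid_mult) vec \<Rightarrow> (nat \<Rightarrow> nat) \<Rightarrow> 'k" where
  "power_product n v e = (\<Prod>i<n. v $ i ^ e i)"

abbreviation pos_exp :: "(nat \<Rightarrow> int) \<Rightarrow> nat \<Rightarrow> nat" where "pos_exp u \<equiv> \<lambda>i. nat (u i)"
abbreviation neg_exp :: "(nat \<Rightarrow> int) \<Rightarrow> nat \<Rightarrow> nat" where "neg_exp u \<equiv> \<lambda>i. nat (- u i)"

lemma power_product_add:
  "power_product n v (\<lambda>i. e i + e' i) = power_product n v e * power_product n v e'"
  by (simp add: power_product_def power_add prod.distrib)

lemma power_product_nonzero:
  "(\<And>i. i < n \<Longrightarrow> v $ i \<noteq> 0) \<Longrightarrow> power_product n v e \<noteq> (0::'k::field)"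
  by (simp add: power_product_def)

lemma polyfun_power_product: "\<exists>D. polyfun n D (\<lambda>v. power_product n v e)"
  unfolding power_product_def
proof (rule polyfun_prod)
  fix i assume "i \<in> {..<n}"
  then have "i < n" by simp
  from polyfun_power[OF polyfun.coord[OF this]]
  show "\<exists>D. polyfun n D (\<lambda>v. v $ i ^ e i)" by blast
qed

text \<open>For \<open>k\<close> of full support this is the equation \<Prod>
  \<open>(v i / k i)^(u i) = 1\<close> with denominators cleared, that is, a toric equation
  translated by \<open>k\<close>.\<close>

definition shifted_binomial :: "nat \<Rightarrow> ('k::field) vec \<Rightarrow> (nat \<Rightarrow> int) \<Rightarrow> 'k vec \<Rightarrow> 'k" where
  "shifted_binomial n k u v =
     power_product n v (pos_exp u) * power_product n k (neg_exp u)
     - power_product n v (neg_exp u) * power_product n k (pos_exp u)"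

lemma polyfun_shifted_binomial:
  fixes k :: "'k::field vec"
  shows "\<exists>D. polyfun n D (shifted_binomial n k u)"
proof -
  obtain D where D: "polyfun n D (\<lambda>v :: 'k vec. power_product n v (pos_exp u))"
    using polyfun_power_product by blast
  obtain E where E: "polyfun n E (\<lambda>v :: 'k vec. power_product n v (neg_exp u))"
    using polyfun_power_product by blast
  have "polyfun n (max D E) (\<lambda>v. power_product n k (neg_exp u) * power_product n v (pos_exp u)
     - power_product n k (pos_exp u) * power_product n v (neg_exp u))"
    by (intro polyfun_diff polyfun_scale) (auto intro: polyfun_mono[OF D] polyfun_mono[OF E])
  then show ?thesis by (auto simp: shifted_binomial_def[abs_def] mult.commute)
qed

text \<open>
  The rows \<open>W j\<close> span the rational row space of the configuration; the dual family \<open>U\<close> together with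
  the lattice of relations \<open>lker\<close> generates a subgroup of finite index in \<open>\<int>\<^sup>n\<close>.
\<close>

locale toric_data =
  fixes n r :: nat and W :: "nat \<Rightarrow> nat \<Rightarrow> nat" and U :: "nat \<Rightarrow> nat \<Rightarrow> int" and D :: int
  assumes n_pos: "0 < n" and r_pos: "0 < r" and W0: "\<And>i. i < n \<Longrightarrow> W 0 i = 1"
    and D_nz: "D \<noteq> 0"
    and dual: "\<And>l j. l < r \<Longrightarrow> j < r \<Longrightarrow> (\<Sum>i<n. int (W l i) * U j i) = (if l = j then D else 0)"
begin

definition lker :: "(nat \<Rightarrow> int) set" where
  "lker = {u. \<forall>j<r. (\<Sum>i<n. int (W j i) * u i) = 0}"

text \<open>The conormal space at the all-ones point: the coefficient vectors of the linear forms
  that vanish on the span of the rows \<open>W j\<close>.\<close>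

definition fker :: "'k::field vec set" where
  "fker = {q \<in> carrier_vec n. \<forall>j<r. (\<Sum>i<n. of_nat (W j i) * q $ i) = 0}"

definition cone :: "'k::field vec set" where
  "cone = {v \<in> carrier_vec n. \<forall>u \<in> lker. power_product n v (pos_exp u) = power_product n v (neg_exp u)}"

definition weight :: "(nat \<Rightarrow> nat) \<Rightarrow> nat \<Rightarrow> nat" where
  "weight e j = (\<Sum>i<n. W j i * e i)"

text \<open>The exponents are natural numbers, so this is polynomial in \<open>t\<close>: it can be
  evaluated where parameters vanish and along polynomial curves.\<close>

definition torus :: "nat \<Rightarrow> (nat \<Rightarrow> 'k::field) \<Rightarrow> nat \<Rightarrow> 'k" where
  "torus j t i = (\<Prod>l<j. t l ^ W l i)"

definition act :: "nat \<Rightarrow> (nat \<Rightarrow> 'k::field) \<Rightarrow> 'k vec \<Rightarrow> 'k vec" where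
  "act j t q = vec n (\<lambda>i. q $ i * torus j t i)"

text \<open>Only the first \<open>j\<close> parameters move. For a point of full support,
  \<open>j = 1, ..., r\<close> gives a flag of orbits in which each step adds one dimension.\<close>

definition orbit :: "nat \<Rightarrow> 'k::field vec set \<Rightarrow> 'k vec set" where
  "orbit j Q = {act j t q | t q. q \<in> Q \<and> (\<forall>l<j. t l \<noteq> 0)}"

lemma torus_nonzero: "(\<And>l. l < j \<Longrightarrow> t l \<noteq> 0) \<Longrightarrow> torus j t i \<noteq> 0"
  by (simp add: torus_def)

lemma act_carrier [simp]: "act j t q \<in> carrier_vec n" and act_dim [simp]: "dim_vec (act j t q) = n"
  by (simp_all add: act_def)

lemma act_index [simp]: "i < n \<Longrightarrow> act j t q $ i = q $ i * torus j t i"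
  by (simp add: act_def)

lemma weight_add: "weight (\<lambda>i. e i + e' i) j = weight e j + weight e' j"
  by (simp add: weight_def algebra_simps sum.distrib)

lemma weight_pos_neg:
  "int (weight (pos_exp u) j) - int (weight (neg_exp u) j) = (\<Sum>i<n. int (W j i) * u i)"
proof -
  have "int (weight (pos_exp u) j) - int (weight (neg_exp u) j)
      = (\<Sum>i<n. int (W j i) * (int (nat (u i)) - int (nat (- u i))))"
    by (simp add: weight_def sum_subtractf right_diff_distrib)
  also have "\<dots> = (\<Sum>i<n. int (W j i) * u i)" by (intro sum.cong) auto
  finally show ?thesis .
qed

lemma weight_lker: "u \<in> lker \<Longrightarrow> j < r \<Longrightarrow> weight (pos_exp u) j = weight (neg_exp u) j"
  using weight_pos_neg[of u j] by (simp add: lker_def)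

lemma power_product_act:
  "power_product n (act j t q) e = power_product n q e * (\<Prod>l<j. t l ^ weight e l)"
proof -
  have "power_product n (act j t q) e = (\<Prod>i<n. q $ i ^ e i * (\<Prod>l<j. t l ^ (W l i * e i)))"
    unfolding power_product_def
    by (intro prod.cong) (auto simp: torus_def power_mult_distrib prod_power_distrib power_mult)
  also have "\<dots> = power_product n q e * (\<Prod>l<j. \<Prod>i<n. t l ^ (W l i * e i))"
    by (simp add: prod.distrib power_product_def) (subst prod.swap, simp)
  finally show ?thesis by (simp add: weight_def power_sum)
qed

text \<open>The difference of two exponents of equal weight is a relation, and their common part
  \<open>m\<close> is a shared factor. Hence a monomial on the cone depends only on its
  \<open>r\<close> weights, however many variables there are.\<close>

lemma cone_power_product:
  assumes v: "v \<in> cone" and w: "\<And>j. j < r \<Longrightarrow> weight e j = weight e' j"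
  shows "power_product n v e = power_product n v e'"
proof -
  define u where "u i = int (e i) - int (e' i)" for i
  define m where "m i = min (e i) (e' i)" for i
  have "(\<Sum>i<n. int (W j i) * u i) = 0" if "j < r" for j
  proof -
    have "(\<Sum>i<n. int (W j i) * u i) = int (weight e j) - int (weight e' j)"
      by (simp add: u_def weight_def right_diff_distrib sum_subtractf)
    then show ?thesis using w[OF that] by simp
  qed
  then have u: "u \<in> lker" by (simp add: lker_def)
  have e: "e = (\<lambda>i. m i + pos_exp u i)" and e': "e' = (\<lambda>i. m i + neg_exp u i)"
    by (auto simp: u_def m_def fun_eq_iff)
  show ?thesis
    by (subst e, subst e') (use u v in \<open>simp add: power_product_add cone_def\<close>)
qed

lemma act_cone: "v \<in> cone \<Longrightarrow> j \<le> r \<Longrightarrow> act j t v \<in> cone"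
  by (auto simp: cone_def power_product_act weight_lker)

lemma one_cone: "vec n (\<lambda>_. 1) \<in> cone"
  by (simp add: cone_def power_product_def)

text \<open>The row \<open>W 0\<close> of ones makes both monomials of a relation have the same
  degree, so at the origin they are both \<open>0\<close> or both the empty product.\<close>

lemma zero_cone: "0\<^sub>v n \<in> cone"
proof -
  have z: "power_product n (0\<^sub>v n) e = (if \<forall>i<n. e i = 0 then 1 else (0::'a))" for e
    by (auto simp: power_product_def zero_power)
  have "(\<forall>i<n. nat (u i) = 0) \<longleftrightarrow> (\<forall>i<n. nat (- u i) = 0)" if "u \<in> lker" for u
  proof -
    have "weight (pos_exp u) 0 = weight (neg_exp u) 0" using weight_lker that r_pos by blast
    then have "(\<Sum>i<n. nat (u i)) = (\<Sum>i<n. nat (- u i))" using W0 by (simp add: weight_def)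
    then have "(\<Sum>i<n. nat (u i)) = 0 \<longleftrightarrow> (\<Sum>i<n. nat (- u i)) = 0" by simp
    then show ?thesis by (simp add: Ball_def)
  qed
  then show ?thesis by (auto simp: cone_def z)
qed

lemma smult_eq_act:
  assumes "v \<in> carrier_vec n" shows "c \<cdot>\<^sub>v v = act 1 (\<lambda>_. c) v"
  using assms by (intro eq_vecI) (auto simp: torus_def W0 mult.commute)

lemma smult_cone: "v \<in> cone \<Longrightarrow> c \<cdot>\<^sub>v v \<in> cone"
  using act_cone[of v 1 "\<lambda>_. c"] r_pos smult_eq_act[of v c] by (simp add: cone_def Suc_le_eq)

section \<open>The Hilbert function of the cone\<close>

definition row_bound :: nat where "row_bound = (\<Sum>j<r. \<Sum>i<n. W j i)"

definition weights :: "(nat \<Rightarrow> nat) \<Rightarrow> nat list" where "weights e = map (weight e) [0..<r]"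

text \<open>A representative monomial of weight \<open>b\<close>, and zero if no monomial has that
  weight. On the cone the choice of representative is immaterial.\<close>

definition weight_char :: "nat list \<Rightarrow> 'k::field vec \<Rightarrow> 'k" where
  "weight_char b v = (if b \<in> range weights then power_product n v (SOME e. weights e = b) else 0)"

text \<open>Each variable has weights at most \<open>row_bound\<close>, so degree \<open>d\<close>
  reaches only the weights in this box, whose size is a polynomial of degree at most
  \<open>r\<close> in \<open>d\<close>.\<close>

definition spanned :: "nat \<Rightarrow> ('k::field vec \<Rightarrow> 'k) \<Rightarrow> bool" where
  "spanned d f \<longleftrightarrow> (\<exists>c. \<forall>v \<in> cone. f v = (\<Sum>b\<in>exponent_box (row_bound * d) r. c b * weight_char b v))"

lemma weights_eq_iff: "weights e = weights e' \<longleftrightarrow> (\<forall>j<r. weight e j = weight e' j)"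
  by (auto simp: weights_def)

lemma weight_char_weights:
  assumes "v \<in> cone" shows "weight_char (weights e) v = power_product n v e"
proof -
  define e' where "e' = (SOME e'. weights e' = weights e)"
  have "weights e' = weights e" unfolding e'_def by (rule someI[of "\<lambda>e'. weights e' = weights e" e]) simp
  then have "power_product n v e' = power_product n v e"
    by (intro cone_power_product[OF assms]) (simp add: weights_eq_iff)
  then show ?thesis by (simp add: weight_char_def e'_def)
qed

lemma spanned_power_product:
  assumes "weights e \<in> exponent_box (row_bound * d) r"
  shows "spanned d (\<lambda>v. power_product n v e)"
  unfolding spanned_def
  by (rule exI[of _ "\<lambda>b. if b = weights e then 1 else 0"])
     (use assms in \<open>simp add: weight_char_weights if_distrib[of "\<lambda>x. x * _"] cong: if_cong\<close>)

lemma spanned_cong: "spanned d f \<Longrightarrow> (\<And>v. v \<in> cone \<Longrightarrow> g v = f v) \<Longrightarrow> spanned d g"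
  by (auto simp: spanned_def)

lemma spanned_scale: "spanned d f \<Longrightarrow> spanned d (\<lambda>v. c * f v)"
  unfolding spanned_def by (erule exE, rule_tac x = "\<lambda>b. c * ca b" in exI) (simp add: sum_distrib_left mult.assoc)

lemma spanned_add: "spanned d f \<Longrightarrow> spanned d g \<Longrightarrow> spanned d (\<lambda>v. f v + g v)"
  unfolding spanned_def
  by (erule exE, erule exE, rule_tac x = "\<lambda>b. c b + ca b" in exI) (simp add: sum.distrib distrib_right)

lemma spanned_0: "spanned d (\<lambda>_. 0)"
  unfolding spanned_def by (rule exI[of _ "\<lambda>_. 0"]) simp

lemma spanned_sum: "(\<And>i. i \<in> I \<Longrightarrow> spanned d (f i)) \<Longrightarrow> spanned d (\<lambda>v. \<Sum>i\<in>I. f i v)"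
  by (induction I rule: infinite_finite_induct) (auto intro: spanned_0 spanned_add)

lemma spanned_mult:
  assumes "spanned d f" "spanned d' g" shows "spanned (d + d') (\<lambda>v. f v * g v)"
proof -
  let ?B = "\<lambda>d. exponent_box (row_bound * d) r"
  obtain c where c: "\<forall>v\<in>cone. f v = (\<Sum>b\<in>?B d. c b * weight_char b v)"
    using assms(1) by (auto simp: spanned_def)
  obtain c' where c': "\<forall>v\<in>cone. g v = (\<Sum>b\<in>?B d'. c' b * weight_char b v)"
    using assms(2) by (auto simp: spanned_def)
  have chars: "spanned (d + d') (\<lambda>v. weight_char b v * weight_char b' v)" if "b \<in> ?B d" "b' \<in> ?B d'" for b b'
  proof (cases "b \<in> range weights \<and> b' \<in> range weights")
    case True
    then obtain e e' where e: "b = weights e" "b' = weights e'" by blast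
    have le: "weight e j \<le> row_bound * d" "weight e' j \<le> row_bound * d'" if "j < r" for j
      using \<open>b \<in> ?B d\<close> \<open>b' \<in> ?B d'\<close> that by (fastforce simp: exponent_box_def e weights_def)+
    have "weights (\<lambda>i. e i + e' i) \<in> ?B (d + d')"
      using le by (auto simp: exponent_box_def weights_def weight_add distrib_left intro!: add_mono)
    from spanned_power_product[OF this] show ?thesis
      by (rule spanned_cong) (simp add: e weight_char_weights power_product_add)
  next
    case False
    then show ?thesis by (intro spanned_cong[OF spanned_0]) (auto simp: weight_char_def)
  qed
  have "spanned (d + d') (\<lambda>v. \<Sum>b\<in>?B d. \<Sum>b'\<in>?B d'. c b * c' b' * (weight_char b v * weight_char b' v))"
    by (intro spanned_sum spanned_scale chars)
  then show ?thesis
    by (rule spanned_cong) (simp add: c c' sum_product mult.assoc mult.left_commute[of "c' _"])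
qed

lemma polyfun_spanned: "polyfun n d f \<Longrightarrow> spanned d f"
proof (induction rule: polyfun.induct)
  case (const d c)
  have "spanned d (\<lambda>v. c * power_product n v (\<lambda>_. 0))"
    by (intro spanned_scale spanned_power_product) (auto simp: exponent_box_def weights_def weight_def)
  then show ?case by (rule spanned_cong) (simp add: power_product_def)
next
  case (coord i d)
  let ?e = "\<lambda>i'. if i' = i then 1 else 0"
  have "weight ?e j \<le> row_bound" if "j < r" for j
  proof -
    have "weight ?e j = W j i"
      using coord by (simp add: weight_def if_distrib[of "\<lambda>x. _ * x"] cong: if_cong)
    also have "\<dots> \<le> (\<Sum>i<n. W j i)" using coord by (intro member_le_sum) auto
    also have "\<dots> \<le> row_bound" unfolding row_bound_def using that by (intro member_le_sum) auto
    finally show ?thesis .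
  qed
  then have "spanned (Suc d) (\<lambda>v. power_product n v ?e)"
    by (intro spanned_power_product) (auto simp: exponent_box_def weights_def intro: trans_le_add1)
  then show ?case
    by (rule spanned_cong) (use coord in \<open>simp add: power_product_def if_distrib[of "\<lambda>x. _ ^ x"] cong: if_cong\<close>)
qed (auto intro: spanned_add spanned_mult)

text \<open>A function on the image is pulled back along \<open>M\<close> and expanded on the cone
  without raising the degree bound. The chosen preimage \<open>w v\<close> turns the characters of
  the cone into functions on the image.\<close>

lemma trdeg_ge_cone_image:
  assumes "trdeg_ge n S k" and M: "M \<in> carrier_mat n n" and S: "S \<subseteq> (*\<^sub>v) M ` cone"
  shows "k \<le> r"
proof -
  define w where "w v = (SOME w. w \<in> cone \<and> M *\<^sub>v w = v)" for v
  have w: "w v \<in> cone" "M *\<^sub>v w v = v" if "v \<in> (*\<^sub>v) M ` cone" for v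
  proof -
    have "w v \<in> cone \<and> M *\<^sub>v w v = v" unfolding w_def by (rule someI_ex) (use that in auto)
    then show "w v \<in> cone" "M *\<^sub>v w v = v" by auto
  qed
  show ?thesis
  proof (rule trdeg_ge_le[OF assms(1) S, where C = row_bound and B = "\<lambda>d. exponent_box (row_bound * d) r"
        and \<chi> = "\<lambda>_ b v. weight_char b (w v)"])
    fix d f assume "polyfun n d (f :: 'a vec \<Rightarrow> 'a)"
    then obtain g where g: "polyfun n d g" "\<forall>v \<in> carrier_vec n. g v = f (M *\<^sub>v v)"
      using polyfun_mult_mat_vec[OF _ M] by blast
    from polyfun_spanned[OF g(1)] obtain c where
      c: "\<forall>v\<in>cone. g v = (\<Sum>b\<in>exponent_box (row_bound * d) r. c b * weight_char b v)"
      by (auto simp: spanned_def)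
    have "f v = (\<Sum>b\<in>exponent_box (row_bound * d) r. c b * weight_char b (w v))"
      if "v \<in> (*\<^sub>v) M ` cone" for v
      using w[OF that] g(2) c by (auto simp: cone_def)
    then show "\<exists>c. \<forall>v\<in>(*\<^sub>v) M ` cone. f v = (\<Sum>b\<in>exponent_box (row_bound * d) r. c b * weight_char b (w v))"
      by blast
  qed (simp_all add: card_exponent_box)
qed

lemma trdeg_ge_cone: "trdeg_ge n S k \<Longrightarrow> S \<subseteq> cone \<Longrightarrow> k \<le> r"
  by (erule trdeg_ge_cone_image[of _ _ "1\<^sub>m n"]) (auto simp: cone_def image_iff)

section \<open>Torus orbits: irreducibility and dimension\<close>

lemma orbit_irreducible:
  fixes Q :: "'k::field_char_0 vec set"
  assumes "Q \<noteq> {}" "Q \<subseteq> carrier_vec n"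
    and line: "\<And>q q' s. q \<in> Q \<Longrightarrow> q' \<in> Q \<Longrightarrow> vec n (\<lambda>i. q $ i + s * (q' $ i - q $ i)) \<in> Q"
  shows "irreducible_set n (orbit j Q)"
proof (rule irreducible_set_curves)
  obtain q where "q \<in> Q" using assms(1) by blast
  then have "act j (\<lambda>_. 1) q \<in> orbit j Q" by (force simp: orbit_def)
  then show "orbit j Q \<noteq> {}" by blast
  show "orbit j Q \<subseteq> carrier_vec n" by (auto simp: orbit_def)
next
  fix p p' assume "p \<in> orbit j Q" "p' \<in> orbit j Q"
  then obtain t q t' q' where p: "p = act j t q" "q \<in> Q" "\<forall>l<j. t l \<noteq> 0"
    and p': "p' = act j t' q'" "q' \<in> Q" "\<forall>l<j. t' l \<noteq> 0" by (auto simp: orbit_def)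
  \<comment> \<open>Torus parameters and base point move along straight lines simultaneously. The
    curve can leave the orbit only where some \<open>\<tau> l\<close> vanishes, which happens
    finitely often because \<open>\<tau> l\<close> is nonzero at \<open>0\<close>.\<close>
  define \<tau> where "\<tau> l = [:t l, t' l - t l:]" for l
  define \<gamma> where "\<gamma> i = [:q $ i, q' $ i - q $ i:] * (\<Prod>l<j. \<tau> l ^ W l i)" for i
  have \<gamma>: "vec n (\<lambda>i. poly (\<gamma> i) s) = act j (\<lambda>l. poly (\<tau> l) s) (vec n (\<lambda>i. q $ i + s * (q' $ i - q $ i)))" for s
    by (intro eq_vecI) (auto simp: \<gamma>_def torus_def poly_prod algebra_simps)
  have Q: "q \<in> carrier_vec n" "q' \<in> carrier_vec n" using p(2) p'(2) assms(2) by auto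
  have "\<tau> l \<noteq> 0" if "l < j" for l using p(3) that by (auto simp: \<tau>_def)
  then have "finite (\<Union>l<j. {s. poly (\<tau> l) s = 0})" by (auto intro: poly_roots_finite)
  moreover have "{s. vec n (\<lambda>i. poly (\<gamma> i) s) \<notin> orbit j Q} \<subseteq> (\<Union>l<j. {s. poly (\<tau> l) s = 0})"
  proof clarify
    fix s assume "vec n (\<lambda>i. poly (\<gamma> i) s) \<notin> orbit j Q"
    then have "\<not> (\<forall>l<j. poly (\<tau> l) s \<noteq> 0)"
      using line[OF p(2) p'(2), of s] unfolding \<gamma> orbit_def by blast
    then show "s \<in> (\<Union>l<j. {s. poly (\<tau> l) s = 0})" by auto
  qed
  ultimately have "finite {s. vec n (\<lambda>i. poly (\<gamma> i) s) \<notin> orbit j Q}" by (rule rev_finite_subset)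
  moreover have "vec n (\<lambda>i. poly (\<gamma> i) 0) = p" "vec n (\<lambda>i. poly (\<gamma> i) 1) = p'"
    using Q unfolding p(1) p'(1) by (auto simp: \<gamma>_def act_def \<tau>_def torus_def poly_prod algebra_simps intro!: eq_vecI)
  ultimately show "\<exists>\<gamma>. vec n (\<lambda>i. poly (\<gamma> i) 0) = p \<and> vec n (\<lambda>i. poly (\<gamma> i) 1) = p' \<and>
      finite {s. vec n (\<lambda>i. poly (\<gamma> i) s) \<notin> orbit j Q}" by blast
qed

lemma orbit_singleton_irreducible:
  fixes k :: "'k::field_char_0 vec"
  shows "k \<in> carrier_vec n \<Longrightarrow> irreducible_set n (orbit j {k})"
  by (rule orbit_irreducible) auto

lemma orbit_base: "q \<in> Q \<Longrightarrow> Q \<subseteq> carrier_vec n \<Longrightarrow> q \<in> orbit j Q"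
  unfolding orbit_def
  by (rule CollectI, intro exI[of _ "\<lambda>_. 1"] exI[of _ q]) (auto simp: act_def torus_def intro!: eq_vecI)

lemma orbit_mono: "Q \<subseteq> Q' \<Longrightarrow> orbit j Q \<subseteq> orbit j Q'"
  by (auto simp: orbit_def)

lemma orbit_Suc: "orbit j Q \<subseteq> orbit (Suc j) Q"
proof
  fix v assume "v \<in> orbit j Q"
  then obtain t q where "v = act j t q" "q \<in> Q" "\<forall>l<j. t l \<noteq> 0" by (auto simp: orbit_def)
  moreover from this have "v = act (Suc j) (t(j := 1)) q"
    by (simp add: act_def torus_def)
  ultimately show "v \<in> orbit (Suc j) Q"
    by (auto simp: orbit_def less_Suc_eq intro!: exI[of _ "t(j := 1)"] exI[of _ q])
qed

lemma shifted_binomial_act: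
  "shifted_binomial n k u (act j t k) = power_product n k (pos_exp u) * power_product n k (neg_exp u) *
     ((\<Prod>l<j. t l ^ weight (pos_exp u) l) - (\<Prod>l<j. t l ^ weight (neg_exp u) l))"
  by (simp add: shifted_binomial_def power_product_act algebra_simps)

text \<open>By duality the two monomials of \<open>U j\<close> have equal weights for all parameters
  before \<open>j\<close>, while their weights for parameter \<open>j\<close> differ by
  \<open>D\<close>.\<close>

lemma shifted_binomial_separates:
  fixes k :: "'k::field_char_0 vec"
  assumes j: "j < r" and k: "\<And>i. i < n \<Longrightarrow> k $ i \<noteq> 0"
  shows "v \<in> orbit j {k} \<Longrightarrow> shifted_binomial n k (U j) v = 0"
    and "\<exists>v \<in> orbit (Suc j) {k}. shifted_binomial n k (U j) v \<noteq> 0"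
proof -
  have eq: "weight (pos_exp (U j)) l = weight (neg_exp (U j)) l" if "l < j" for l
    using weight_pos_neg[of "U j" l] dual[of l j] that j by simp
  show "shifted_binomial n k (U j) v = 0" if "v \<in> orbit j {k}"
    using that by (auto simp: orbit_def shifted_binomial_act eq)
  \<comment> \<open>In characteristic zero \<open>2\<close> is not a root of unity, so this
    parameter detects any difference of weights.\<close>
  define t where "t = (\<lambda>l. if l = j then 2 else 1 :: 'k)"
  have t: "(\<Prod>l<Suc j. t l ^ e l) = of_nat (2 ^ e j)" for e
    by (simp add: t_def)
  have "weight (pos_exp (U j)) j \<noteq> weight (neg_exp (U j)) j"
    using weight_pos_neg[of "U j" j] dual[of j j] j D_nz by auto
  then have "shifted_binomial n k (U j) (act (Suc j) t k) \<noteq> 0"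
    unfolding shifted_binomial_act t of_nat_diff[symmetric]
    using power_product_nonzero[of n k, OF k] by (simp only: mult_eq_0_iff right_minus_eq of_nat_eq_iff) simp
  moreover have "act (Suc j) t k \<in> orbit (Suc j) {k}" by (auto simp: orbit_def t_def intro!: exI[of _ t] split: if_splits)
  ultimately show "\<exists>v \<in> orbit (Suc j) {k}. shifted_binomial n k (U j) v \<noteq> 0" by blast
qed

lemma polyfun_zero_limit:
  fixes k :: "'k::field_char_0 vec"
  assumes f: "polyfun n d f" "\<And>c. c \<noteq> 0 \<Longrightarrow> f (c \<cdot>\<^sub>v k) = 0" and k: "k \<in> carrier_vec n"
  shows "f (0\<^sub>v n) = 0"
proof -
  obtain F where F: "\<And>s. f (vec n (\<lambda>i. poly [:0, k $ i:] s)) = poly F s"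
    using polyfun_curve[OF f(1), of "\<lambda>i. [:0, k $ i:]"] by blast
  have "vec n (\<lambda>i. poly [:0, k $ i:] s) = s \<cdot>\<^sub>v k" for s using k by (intro eq_vecI) auto
  with F f(2) have "poly F s = 0" if "s \<noteq> 0" for s using that by metis
  then have "{s. poly F s \<noteq> 0} \<subseteq> {0}" by auto
  then have "F = 0" by (intro poly_cofinite_zero) (rule finite_subset, auto)
  moreover have "vec n (\<lambda>i. poly [:0, k $ i:] 0) = 0\<^sub>v n" by (intro eq_vecI) auto
  ultimately show ?thesis using F[of 0] by simp
qed

text \<open>The origin lies in the closure of the punctured line through \<open>v\<close>, and a
  coordinate that is nonzero at \<open>v\<close> vanishes there. This first function accounts for
  the cone having one dimension more than its projectivization.\<close>

lemma trdeg_ge_first: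
  fixes S :: "'k::field_char_0 vec set"
  assumes S: "irreducible_set n S" "\<And>v c. v \<in> S \<Longrightarrow> c \<noteq> 0 \<Longrightarrow> c \<cdot>\<^sub>v v \<in> S" and v: "v \<in> S" "v \<noteq> 0\<^sub>v n"
  shows "trdeg_ge n S 1"
proof -
  have vc: "v \<in> carrier_vec n" using S(1) v by (auto simp: irreducible_set_def)
  then obtain i where i: "i < n" "v $ i \<noteq> 0" using v(2) by (metis eq_vecI carrier_vecD index_zero_vec(1,2))
  have "trdeg_ge n {0\<^sub>v n :: 'k vec} 0" by (simp add: trdeg_ge_0)
  then have "trdeg_ge n S (Suc 0)"
  proof (rule trdeg_ge_Suc[OF _ polyfun.coord[OF i(1), of 0] _ v(1) i(2) S(1)])
    fix E f w assume f: "polyfun n E f" "\<And>w. w \<in> S \<Longrightarrow> f w = (0 :: 'k)" and "w \<in> {0\<^sub>v n :: 'k vec}"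
    then show "f w = 0" using polyfun_zero_limit[OF f(1) f(2)[OF S(2)[OF v(1)]] vc] by simp
  qed (use i in auto)
  then show ?thesis by simp
qed

lemma orbit_smult:
  assumes "v \<in> orbit j Q" "c \<noteq> 0" "0 < j" shows "c \<cdot>\<^sub>v v \<in> orbit j Q"
proof -
  obtain t q where v: "v = act j t q" "q \<in> Q" "\<forall>l<j. t l \<noteq> 0" using assms(1) by (auto simp: orbit_def)
  \<comment> \<open>Because \<open>W 0\<close> is constantly one, a scalar is absorbed by the
    parameter \<open>t 0\<close>.\<close>
  have "torus j (t(0 := c * t 0)) i = c * torus j t i" if "i < n" for i
  proof -
    have "{..<j} = insert 0 {1..<j}" using assms(3) by auto
    then show ?thesis using that W0 by (simp add: torus_def mult.assoc)
  qed
  then have "c \<cdot>\<^sub>v v = act j (t(0 := c * t 0)) q" by (intro eq_vecI) (auto simp: v(1))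
  then show ?thesis using v assms(2)
    by (auto simp: orbit_def intro!: exI[of _ "t(0 := c * t 0)"] exI[of _ q] split: if_splits)
qed

text \<open>The orbit for \<open>j = 1\<close> is a punctured line and supplies the first function;
  each further parameter supplies the shifted binomial of its dual vector.\<close>

lemma trdeg_ge_orbit:
  fixes k :: "'k::field_char_0 vec"
  assumes k: "k \<in> carrier_vec n" "\<And>i. i < n \<Longrightarrow> k $ i \<noteq> 0" and "0 < j" "j \<le> r"
  shows "trdeg_ge n (orbit j {k}) j"
  using assms(3,4)
proof (induction j rule: nat_induct_non_zero)
  case 1
  have "k \<in> orbit 1 {k}" using k by (auto intro: orbit_base)
  moreover have "k \<noteq> 0\<^sub>v n" using k n_pos by auto
  ultimately show ?case
    by (intro trdeg_ge_first orbit_singleton_irreducible k) (auto intro: orbit_smult)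
next
  case (Suc j)
  then have j: "j < r" by simp
  obtain v where v: "v \<in> orbit (Suc j) {k}" "shifted_binomial n k (U j) v \<noteq> 0"
    using shifted_binomial_separates(2)[OF j k(2)] by blast
  obtain d where d: "polyfun n d (shifted_binomial n k (U j))" using polyfun_shifted_binomial by blast
  show ?case
    by (rule trdeg_ge_Suc_subset[OF _ orbit_Suc d _ v orbit_singleton_irreducible[OF k(1)]])
       (use Suc shifted_binomial_separates(1)[OF j k(2)] in auto)
qed

text \<open>
  If the conormal cone is contained in a linear image of the cone, both have the same dimension \<open>r\<close>,
  so the orbit of a generic relation is dense in it.
\<close>

lemma shifted_binomial_vanishes_on_fker:
  fixes k k' :: "'k::field_char_0 vec"
  assumes M: "M \<in> carrier_mat n n" "orbit r fker \<subseteq> (*\<^sub>v) M ` (cone :: 'k vec set)"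
    and k: "k \<in> fker" "\<And>i. i < n \<Longrightarrow> k $ i \<noteq> 0" and k': "k' \<in> fker" and u: "u \<in> lker"
  shows "shifted_binomial n k u k' = 0"
proof (rule ccontr)
  assume nz: "shifted_binomial n k u k' \<noteq> 0"
  obtain d where d: "polyfun n d (shifted_binomial n k u)" using polyfun_shifted_binomial by blast
  have kc: "k \<in> carrier_vec n" using k by (simp add: fker_def)
  have "irreducible_set n (orbit r (fker :: 'k vec set))"
  proof (rule orbit_irreducible)
    fix q q' s assume "q \<in> (fker :: 'k vec set)" "q' \<in> (fker :: 'k vec set)"
    moreover have "(\<Sum>i<n. of_nat (W j i) * (q $ i + s * (q' $ i - q $ i))) =
      (\<Sum>i<n. of_nat (W j i) * q $ i) + s * ((\<Sum>i<n. of_nat (W j i) * q' $ i) - (\<Sum>i<n. of_nat (W j i) * q $ i))" for j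
      by (simp add: algebra_simps sum.distrib sum_distrib_left sum_subtractf)
    ultimately show "vec n (\<lambda>i. q $ i + s * (q' $ i - q $ i)) \<in> fker"
      by (simp add: fker_def)
  qed (use k in \<open>auto simp: fker_def\<close>)
  moreover have "k' \<in> orbit r fker" using k' by (intro orbit_base) (auto simp: fker_def)
  moreover have "shifted_binomial n k u v = 0" if "v \<in> orbit r {k}" for v
    using that by (auto simp: orbit_def shifted_binomial_act weight_lker[OF u])
  moreover have "orbit r {k} \<subseteq> orbit r fker" using k by (intro orbit_mono) auto
  \<comment> \<open>The binomial vanishes on the \<open>r\<close>-dimensional orbit of
    \<open>k\<close> but not at \<open>k'\<close>, so it raises the count to \<open>r + 1\<close> on
    the irreducible set \<open>orbit r fker\<close>.\<close>
  ultimately have "trdeg_ge n (orbit r (fker :: 'k vec set)) (Suc r)"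
    using trdeg_ge_Suc_subset[OF trdeg_ge_orbit[OF kc k(2) r_pos order_refl] _ d _ _ nz] by blast
  from trdeg_ge_cone_image[OF this M] show False by simp
qed

end

section \<open>Irreducible closed sets and regular points\<close>

lemma proj_point_mem: "v \<in> proj_point v"
  unfolding proj_point_def by (rule CollectI, rule exI[of _ 1]) simp

lemma proj_point_smult: "c \<noteq> 0 \<Longrightarrow> proj_point (c \<cdot>\<^sub>v v) = proj_point (v :: 'k::field vec)"
proof -
  assume c: "c \<noteq> 0"
  have "d \<cdot>\<^sub>v v = (d / c) \<cdot>\<^sub>v (c \<cdot>\<^sub>v v)" for d using c by (simp add: smult_smult_assoc)
  moreover have "d / c \<noteq> 0" if "d \<noteq> 0" for d using c that by simp
  ultimately have "\<exists>e. d \<cdot>\<^sub>v v = e \<cdot>\<^sub>v (c \<cdot>\<^sub>v v) \<and> e \<noteq> 0" if "d \<noteq> 0" for d using that by blast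
  then show ?thesis using c by (auto simp: proj_point_def smult_smult_assoc)
qed

lemma proj_point_eq: "P \<in> proj_space n \<Longrightarrow> v \<in> P \<Longrightarrow> P = proj_point (v :: 'k::field vec)"
proof -
  assume "P \<in> proj_space n" "v \<in> P"
  then obtain w c where "P = proj_point w" "v = c \<cdot>\<^sub>v w" "c \<noteq> 0"
    by (auto simp: proj_space_def proj_point_def)
  then show ?thesis by (simp add: proj_point_smult)
qed

lemma proj_space_mem:
  assumes "P \<in> proj_space n" "v \<in> P"
  shows "v \<in> carrier_vec n" "v \<noteq> 0\<^sub>v n"
proof -
  obtain w c where w: "v = c \<cdot>\<^sub>v w" "c \<noteq> 0" "w \<in> carrier_vec n" "w \<noteq> 0\<^sub>v n"
    using assms by (auto simp: proj_space_def proj_point_def)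
  then show "v \<in> carrier_vec n" by simp
  obtain i where "i < n" "w $ i \<noteq> 0"
    using w(3,4) by (metis eq_vecI carrier_vecD index_zero_vec(1,2))
  then have "v $ i \<noteq> 0" using w by simp
  then show "v \<noteq> 0\<^sub>v n" using \<open>i < n\<close> by auto
qed

lemma proj_space_nonempty: "P \<in> proj_space n \<Longrightarrow> \<exists>v. v \<in> P"
  using proj_point_mem by (auto simp: proj_space_def)

lemma proj_space_smult:
  assumes "P \<in> proj_space n" "v \<in> P" "c \<noteq> 0"
  shows "c \<cdot>\<^sub>v v \<in> P"
  using proj_point_eq[OF assms(1,2)] assms(3) by (auto simp: proj_point_def)

text \<open>Given as a zero locus rather than as an intersection of closed sets, so that closedness
  is immediate.\<close>

definition projective_closure :: "nat \<Rightarrow> ('k::field) vec set \<Rightarrow> 'k vec set set" where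
  "projective_closure n S = zero_locus n (vanishing_ideal n (proj_point ` S))"

lemma projective_closure_closed: "zariski_closed n (projective_closure n S)"
  unfolding zariski_closed_def projective_closure_def
  by (intro exI[of _ "vanishing_ideal n (proj_point ` S)"] conjI refl) (auto simp: vanishing_ideal_def)

lemma projective_closure_mem:
  assumes "S \<subseteq> carrier_vec n - {0\<^sub>v n}" "v \<in> S"
  shows "proj_point v \<in> projective_closure n S"
  using assms by (auto simp: projective_closure_def zero_locus_def vanishing_ideal_def proj_space_def)

lemma projective_closure_subset_closed:
  assumes "zariski_closed n Z" "proj_point ` S \<subseteq> Z"
  shows "projective_closure n S \<subseteq> Z"
proof -
  obtain F where F: "F \<subseteq> carrier (mpoly_ring n)" "Z = zero_locus n F"
    using assms(1) by (auto simp: zariski_closed_def)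
  then have "F \<subseteq> vanishing_ideal n (proj_point ` S)"
    using assms(2) by (fastforce simp: vanishing_ideal_def zero_locus_def)
  then show ?thesis by (auto simp: projective_closure_def F(2) zero_locus_def)
qed

text \<open>Stability of \<open>S\<close> under nonzero scalars puts every polynomial vanishing on
  \<open>S\<close> into the vanishing ideal of the projective points, homogeneous or not.\<close>

lemma projective_closure_strict:
  fixes S :: "'k::field vec set"
  assumes S: "S \<subseteq> S'" "S' \<subseteq> carrier_vec n - {0\<^sub>v n}" "\<And>v c. v \<in> S \<Longrightarrow> c \<noteq> 0 \<Longrightarrow> c \<cdot>\<^sub>v v \<in> S"
    and f: "polyfun n D f" "\<And>v. v \<in> S \<Longrightarrow> f v = 0" "u \<in> S'" "f u \<noteq> 0"
  shows "projective_closure n S \<subset> projective_closure n S'"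
proof
  show "projective_closure n S \<subseteq> projective_closure n S'"
    by (rule projective_closure_subset_closed[OF projective_closure_closed])
       (use S projective_closure_mem in blast)
  obtain p where p: "p \<in> carrier (mpoly_ring n)" "mpoly_eval p = f"
    using polyfun_imp_mpoly_eval[OF f(1)] by blast
  have "p \<in> vanishing_ideal n (proj_point ` S)"
    using p f(2) S(3) by (auto simp: vanishing_ideal_def proj_point_def)
  then have "proj_point u \<notin> projective_closure n S"
    using p(2) f(4) proj_point_mem[of u] by (auto simp: projective_closure_def zero_locus_def)
  moreover have "proj_point u \<in> projective_closure n S'" using projective_closure_mem S(2) f(3) by blast
  ultimately show "projective_closure n S \<noteq> projective_closure n S'" by blast
qed

lemma projective_closure_irreducible:
  fixes S :: "'k::field vec set"
  assumes irr: "irreducible_set n S" and S: "0\<^sub>v n \<notin> S" "\<And>v c. v \<in> S \<Longrightarrow> c \<noteq> 0 \<Longrightarrow> c \<cdot>\<^sub>v v \<in> S"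
  shows "irreducible_closed n (projective_closure n S)"
  unfolding irreducible_closed_def
proof (intro conjI allI impI projective_closure_closed)
  have sub: "S \<subseteq> carrier_vec n - {0\<^sub>v n}" using irr S(1) by (auto simp: irreducible_set_def)
  show "projective_closure n S \<noteq> {}"
    using irr projective_closure_mem[OF sub] by (auto simp: irreducible_set_def)
  fix Z1 Z2 assume Z: "zariski_closed n Z1" "zariski_closed n Z2" "projective_closure n S = Z1 \<union> Z2"
  have witness: "\<exists>f D v. polyfun n D f \<and> v \<in> S \<and> f v \<noteq> 0 \<and> (\<forall>P\<in>Z. \<forall>v\<in>P. f v = 0)"
    if Z: "zariski_closed n Z" "\<not> projective_closure n S \<subseteq> Z" for Z
  proof -
    obtain F where F: "F \<subseteq> carrier (mpoly_ring n)" "Z = zero_locus n F"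
      using Z(1) by (auto simp: zariski_closed_def)
    have "\<not> proj_point ` S \<subseteq> Z" using projective_closure_subset_closed Z by blast
    then obtain v where v: "v \<in> S" "proj_point v \<notin> Z" by blast
    then obtain f w where f: "f \<in> F" "w \<in> proj_point v" "mpoly_eval f w \<noteq> 0"
      using sub F(2) by (auto simp: zero_locus_def proj_space_def)
    then have "w \<in> S" using v S(2) by (auto simp: proj_point_def)
    then show ?thesis
      using f F polyfun_mpoly_eval[of f n] by (auto simp: zero_locus_def)
  qed
  show "projective_closure n S = Z1 \<or> projective_closure n S = Z2"
  proof (rule ccontr)
    assume neg: "\<not> ?thesis"
    obtain f D v where f: "polyfun n D f" "v \<in> S" "f v \<noteq> 0" "\<forall>P\<in>Z1. \<forall>v\<in>P. f v = 0"
      using witness[OF Z(1)] neg Z(3) by blast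
    obtain g E w where g: "polyfun n E g" "w \<in> S" "g w \<noteq> 0" "\<forall>P\<in>Z2. \<forall>v\<in>P. g v = 0"
      using witness[OF Z(2)] neg Z(3) by blast
    have "f x * g x = 0" if "x \<in> S" for x
      using projective_closure_mem[OF sub that] f(4) g(4) proj_point_mem[of x] unfolding Z(3) by auto
    then show False using irreducible_setD[OF irr f(1) g(1) _ f(2,3) g(2)] g(3) by blast
  qed
qed

text \<open>At different representatives of one point, different factors of \<open>f * g\<close>
  might vanish. Along the line through the point, however, the factors become polynomials in one
  variable with product zero, so one of them vanishes on the whole line; this splits
  \<open>Z\<close> into two closed sets.\<close>

lemma irreducible_closed_cone:
  fixes Z :: "'k::field_char_0 vec set set"
  assumes "irreducible_closed n Z"
  shows "irreducible_set n (\<Union>Z)"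
  unfolding irreducible_set_def
proof (intro conjI allI impI)
  obtain F where F: "F \<subseteq> carrier (mpoly_ring n)" "Z = zero_locus n F"
    using assms by (auto simp: irreducible_closed_def zariski_closed_def)
  have Zs: "Z \<subseteq> proj_space n" by (auto simp: F(2) zero_locus_def)
  obtain P where "P \<in> Z" using assms by (auto simp: irreducible_closed_def)
  then show "\<Union>Z \<noteq> {}" using proj_space_nonempty Zs by blast
  show "\<Union>Z \<subseteq> carrier_vec n" using Zs proj_space_mem(1) by blast
  fix f g :: "'k vec \<Rightarrow> 'k" and D E
  assume fg: "polyfun n D f" "polyfun n E g" and z: "\<forall>v\<in>\<Union>Z. f v * g v = 0"
  obtain p where p: "p \<in> carrier (mpoly_ring n)" "mpoly_eval p = f"
    using polyfun_imp_mpoly_eval[OF fg(1)] by blast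
  obtain q where q: "q \<in> carrier (mpoly_ring n)" "mpoly_eval q = g"
    using polyfun_imp_mpoly_eval[OF fg(2)] by blast
  let ?Z1 = "zero_locus n (insert p F)" and ?Z2 = "zero_locus n (insert q F)"
  have "P \<in> ?Z1 \<union> ?Z2" if P: "P \<in> Z" for P
  proof -
    have Ps: "P \<in> proj_space n" using P Zs by blast
    obtain v where v: "v \<in> P" using proj_space_nonempty[OF Ps] by blast
    have Pv: "P = proj_point v" by (rule proj_point_eq[OF Ps v])
    have vec: "vec n (\<lambda>i. poly [:0, v $ i:] s) = s \<cdot>\<^sub>v v" for s
      using proj_space_mem(1)[OF Ps v] by (intro eq_vecI) auto
    obtain G where G: "\<And>s. f (s \<cdot>\<^sub>v v) = poly G s"
      using polyfun_curve[OF fg(1), of "\<lambda>i. [:0, v $ i:]"] unfolding vec by blast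
    obtain H where H: "\<And>s. g (s \<cdot>\<^sub>v v) = poly H s"
      using polyfun_curve[OF fg(2), of "\<lambda>i. [:0, v $ i:]"] unfolding vec by blast
    have "poly (G * H) s = 0" if "s \<noteq> 0" for s
    proof -
      have "s \<cdot>\<^sub>v v \<in> \<Union>Z" using proj_space_smult[OF Ps v that] P by blast
      then have "f (s \<cdot>\<^sub>v v) * g (s \<cdot>\<^sub>v v) = 0" using z by blast
      then show ?thesis by (simp add: G H)
    qed
    then have "{s. poly (G * H) s \<noteq> 0} \<subseteq> {0}" by blast
    then have "G * H = 0" by (intro poly_cofinite_zero) (rule finite_subset, auto)
    then have "(\<forall>w\<in>P. f w = 0) \<or> (\<forall>w\<in>P. g w = 0)"
      by (auto simp: Pv proj_point_def G H)
    then show ?thesis using P Ps by (auto simp: F(2) zero_locus_def p q)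
  qed
  then have "Z = ?Z1 \<union> ?Z2" by (auto simp: F(2) zero_locus_def)
  moreover have "zariski_closed n ?Z1" "zariski_closed n ?Z2"
    using p q F(1) unfolding zariski_closed_def by blast+
  ultimately have "Z = ?Z1 \<or> Z = ?Z2" using assms unfolding irreducible_closed_def by blast
  then show "(\<forall>v\<in>\<Union>Z. f v = 0) \<or> (\<forall>v\<in>\<Union>Z. g v = 0)"
    by (auto simp: zero_locus_def p q)
qed

section \<open>Column spaces, and derivatives along curves\<close>

lemma dim_mat_range:
  fixes B :: "'k::field mat"
  assumes B: "B \<in> carrier_mat n k"
    and inj: "\<And>x. x \<in> carrier_vec k \<Longrightarrow> B *\<^sub>v x = 0\<^sub>v n \<Longrightarrow> x = 0\<^sub>v k"
  shows "vectorspace.dim class_ring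
     ((module_vec TYPE('k) n)\<lparr>carrier := {y. \<exists>x \<in> carrier_vec k. B *\<^sub>v x = y}\<rparr>) = k"
proof -
  interpret vec_space "TYPE('k)" n .
  have unit: "B *\<^sub>v unit_vec k i = col B i" if "i < k" for i
    using B that by (intro eq_vecI) (auto simp: scalar_prod_right_unit)
  have "distinct (cols B)"
    unfolding distinct_conv_nth
  proof (intro allI impI)
    fix i j assume ij: "i < length (cols B)" "j < length (cols B)" "i \<noteq> j"
    show "cols B ! i \<noteq> cols B ! j"
    proof
      assume eq: "cols B ! i = cols B ! j"
      let ?x = "unit_vec k i - unit_vec k j :: 'k vec"
      have "B *\<^sub>v ?x = B *\<^sub>v unit_vec k i - B *\<^sub>v unit_vec k j"
        by (rule mult_minus_distrib_mat_vec[OF B]) auto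
      also have "\<dots> = col B i - col B j"
        using ij B unit[of i] unit[of j] by simp
      also have "\<dots> = 0\<^sub>v n" using eq ij B by simp
      finally have "?x = 0\<^sub>v k" by (intro inj) auto
      then have "?x $ i = 0\<^sub>v k $ i" by simp
      then show False using ij B by simp
    qed
  qed
  moreover from this have "lin_indpt (set (cols B))"
    using lin_depE[OF B] inj by metis
  ultimately have "rank B = k" by (rule lin_indpt_full_rank[OF B])
  moreover have "span (set (cols B)) = {y. \<exists>x \<in> carrier_vec k. B *\<^sub>v x = y}"
    using col_space_eq[OF B] B unfolding col_space_def by auto
  ultimately show ?thesis by (simp add: rank_def)
qed

lemma poly_pderiv_prod_power:
  fixes \<gamma> :: "nat \<Rightarrow> 'k::field poly"
  assumes "finite J"
  shows "poly (pderiv (\<Prod>j\<in>J. \<gamma> j ^ e j)) s =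
     (\<Sum>i\<in>J. of_nat (e i) * poly (pderiv (\<gamma> i)) s * (\<Prod>j\<in>J. poly (\<gamma> j) s ^ (if j = i then e j - 1 else e j)))"
proof -
  have "poly (prod (\<lambda>j. \<gamma> j ^ e j) (J - {i}) * pderiv (\<gamma> i ^ e i)) s =
    of_nat (e i) * poly (pderiv (\<gamma> i)) s * (\<Prod>j\<in>J. poly (\<gamma> j) s ^ (if j = i then e j - 1 else e j))"
    if "i \<in> J" for i
  proof -
    have "(\<Prod>j\<in>J. poly (\<gamma> j) s ^ (if j = i then e j - 1 else e j)) =
      poly (\<gamma> i) s ^ (e i - 1) * (\<Prod>j\<in>J - {i}. poly (\<gamma> j) s ^ e j)"
      using assms that by (simp add: prod.remove)
    then show ?thesis by (simp add: pderiv_power poly_prod mult_ac)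
  qed
  then show ?thesis by (simp add: pderiv_prod poly_sum)
qed

lemma mpoly_eval_deriv:
  assumes f: "f \<in> carrier (mpoly_ring n)" and i: "i < n"
  shows "mpoly_eval (mpoly_deriv i f) v = (\<Sum>m\<in>Poly_Mapping.keys f. of_nat (Poly_Mapping.lookup m i) *
    Poly_Mapping.lookup f m * (\<Prod>j<n. v $ j ^ (if j = i then Poly_Mapping.lookup m j - 1 else Poly_Mapping.lookup m j)))"
proof -
  have "monomial_eval v (m - Poly_Mapping.single i 1) =
     (\<Prod>j<n. v $ j ^ (if j = i then Poly_Mapping.lookup m j - 1 else Poly_Mapping.lookup m j))"
    if "m \<in> Poly_Mapping.keys f" for m
  proof -
    have "Poly_Mapping.keys (m - Poly_Mapping.single i 1) \<subseteq> Poly_Mapping.keys m"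
      by (auto simp: in_keys_iff lookup_minus)
    then have "Poly_Mapping.keys (m - Poly_Mapping.single i 1) \<subseteq> {..<n}"
      using f that by (auto simp: carrier_mpoly_ring)
    then have "monomial_eval v (m - Poly_Mapping.single i 1) =
        (\<Prod>j<n. v $ j ^ Poly_Mapping.lookup (m - Poly_Mapping.single i 1) j)"
      by (intro monomial_eval_superset) auto
    then show ?thesis by (auto simp: lookup_minus lookup_single intro!: prod.cong)
  qed
  then show ?thesis by (simp add: mpoly_deriv_def mpoly_eval_sum mpoly_eval_single)
qed

lemma pderiv_sum: "pderiv (\<Sum>i\<in>I. F i) = (\<Sum>i\<in>I. pderiv (F i :: 'k::field poly))"
  by (induction I rule: infinite_finite_induct) (simp_all add: pderiv_add)

text \<open>The formal partial derivatives in the definition of the tangent space are accessed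
  through this lemma: a tangent condition becomes the derivative of a polynomial in one
  variable.\<close>

lemma mpoly_chain_rule:
  fixes \<gamma> :: "nat \<Rightarrow> 'k::field poly"
  assumes f: "f \<in> carrier (mpoly_ring n)"
  shows "\<exists>F. (\<forall>s. mpoly_eval f (vec n (\<lambda>i. poly (\<gamma> i) s)) = poly F s) \<and>
    (\<forall>s. poly (pderiv F) s =
       (\<Sum>i<n. mpoly_eval (mpoly_deriv i f) (vec n (\<lambda>i. poly (\<gamma> i) s)) * poly (pderiv (\<gamma> i)) s))"
proof -
  let ?K = "Poly_Mapping.keys f" and ?l = Poly_Mapping.lookup
  define F where "F = (\<Sum>m\<in>?K. Polynomial.smult (?l f m) (\<Prod>j<n. \<gamma> j ^ ?l m j))"
  have "mpoly_eval f (vec n (\<lambda>i. poly (\<gamma> i) s)) = poly F s" for s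
  proof -
  let ?v = "vec n (\<lambda>i. poly (\<gamma> i) s)"
  have "mpoly_eval f ?v = (\<Sum>m\<in>?K. ?l f m * (\<Prod>j<n. ?v $ j ^ ?l m j))"
    unfolding mpoly_eval_superset[OF finite_keys subset_refl]
    by (rule sum.cong) (use f in \<open>auto simp: carrier_mpoly_ring monomial_eval_superset[of "{..<n}"]\<close>)
  then show ?thesis by (simp add: F_def poly_sum poly_prod)
  qed
  moreover have "poly (pderiv F) s =
      (\<Sum>i<n. mpoly_eval (mpoly_deriv i f) (vec n (\<lambda>i. poly (\<gamma> i) s)) * poly (pderiv (\<gamma> i)) s)" for s
  proof -
    let ?v = "vec n (\<lambda>i. poly (\<gamma> i) s)"
  have "poly (pderiv F) s = (\<Sum>m\<in>?K. ?l f m * poly (pderiv (\<Prod>j<n. \<gamma> j ^ ?l m j)) s)"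
    by (simp add: F_def pderiv_sum poly_sum pderiv_smult)
  also have "\<dots> = (\<Sum>m\<in>?K. \<Sum>i<n. of_nat (?l m i) * ?l f m *
     (\<Prod>j<n. ?v $ j ^ (if j = i then ?l m j - 1 else ?l m j)) * poly (pderiv (\<gamma> i)) s)"
    by (simp add: poly_pderiv_prod_power sum_distrib_left mult_ac)
  also have "\<dots> = (\<Sum>i<n. mpoly_eval (mpoly_deriv i f) ?v * poly (pderiv (\<gamma> i)) s)"
    by (subst sum.swap) (simp add: mpoly_eval_deriv[OF f] sum_distrib_right)
  finally show ?thesis .
  qed
  ultimately show ?thesis by blast
qed

text \<open>The logarithmic derivative of a monomial, which is linear in the exponent. It turns the
  tangent condition of a binomial into a linear equation with the relation as coefficients.\<close>

lemma poly_pderiv_prod_power_nonzero: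
  fixes \<gamma> :: "nat \<Rightarrow> 'k::field poly"
  assumes "\<And>i. i < n \<Longrightarrow> poly (\<gamma> i) s \<noteq> 0"
  shows "poly (pderiv (\<Prod>j<n. \<gamma> j ^ e j)) s =
    (\<Prod>j<n. poly (\<gamma> j) s ^ e j) * (\<Sum>i<n. of_nat (e i) * (poly (pderiv (\<gamma> i)) s / poly (\<gamma> i) s))"
proof -
  have "of_nat (e i) * poly (pderiv (\<gamma> i)) s * (\<Prod>j<n. poly (\<gamma> j) s ^ (if j = i then e j - 1 else e j)) =
    (\<Prod>j<n. poly (\<gamma> j) s ^ e j) * (of_nat (e i) * (poly (pderiv (\<gamma> i)) s / poly (\<gamma> i) s))" if "i < n" for i
  proof (cases "e i")
    case (Suc m)
    have "(\<Prod>j<n. poly (\<gamma> j) s ^ h j) = poly (\<gamma> i) s ^ h i * (\<Prod>j\<in>{..<n}-{i}. poly (\<gamma> j) s ^ h j)" for h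
      using that by (simp add: prod.remove)
    then show ?thesis using assms[OF that] Suc by (simp add: field_simps)
  qed simp
  then show ?thesis by (simp add: poly_pderiv_prod_power sum_distrib_left)
qed

section \<open>Torus points: local dimension, tangent space, conormal vectors\<close>

context toric_data
begin

definition variety :: "'k::field vec set set" where
  "variety = {P \<in> proj_space n. P \<subseteq> cone}"

lemma variety_iff: "v \<in> carrier_vec n \<Longrightarrow> v \<noteq> 0\<^sub>v n \<Longrightarrow> proj_point v \<in> variety \<longleftrightarrow> v \<in> cone"
  using proj_point_mem[of v] smult_cone by (auto simp: variety_def proj_space_def proj_point_def)

lemma shifted_binomial_one:
  "shifted_binomial n (vec n (\<lambda>_. 1)) u v = power_product n v (pos_exp u) - power_product n v (neg_exp u)"
  by (simp add: shifted_binomial_def power_product_def)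

lemma binomial_polynomial:
  "\<exists>f \<in> carrier (mpoly_ring n). \<forall>v :: 'a::field vec. mpoly_eval f v = power_product n v (pos_exp u) - power_product n v (neg_exp u)"
proof -
  obtain d where "polyfun n d (shifted_binomial n (vec n (\<lambda>_. 1 :: 'a)) u)"
    using polyfun_shifted_binomial by blast
  from polyfun_imp_mpoly_eval[OF this] show ?thesis
    by (metis shifted_binomial_one)
qed

lemma variety_closed: "zariski_closed n variety"
  unfolding zariski_closed_def
proof (intro exI conjI)
  let ?F = "{f \<in> carrier (mpoly_ring n). \<exists>u\<in>lker. \<forall>v. mpoly_eval f v =
    power_product n v (pos_exp u) - power_product n v (neg_exp u)}"
  show "?F \<subseteq> carrier (mpoly_ring n)" by blast
  have "(\<forall>f\<in>?F. \<forall>v\<in>P. mpoly_eval f v = 0) \<longleftrightarrow> P \<subseteq> cone" if "P \<in> proj_space n" for P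
  proof
    assume z: "\<forall>f\<in>?F. \<forall>v\<in>P. mpoly_eval f v = 0"
    show "P \<subseteq> cone"
    proof
      fix v assume v: "v \<in> P"
      have "power_product n v (pos_exp u) - power_product n v (neg_exp u) = 0" if "u \<in> lker" for u
        using binomial_polynomial[of u] z v that by fastforce
      then show "v \<in> cone" using proj_space_mem(1)[OF that v] by (simp add: cone_def)
    qed
  qed (auto simp: cone_def)
  then show "variety = zero_locus n ?F" by (auto simp: variety_def zero_locus_def)
qed

lemma orbit_singleton_nonzero:
  fixes p :: "'k::field vec"
  assumes "\<And>i. i < n \<Longrightarrow> p $ i \<noteq> 0" "v \<in> orbit j {p}" "i < n"
  shows "v $ i \<noteq> 0"
proof -
  obtain t where t: "v = act j t p" "\<forall>l<j. t l \<noteq> 0" using assms(2) by (auto simp: orbit_def)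
  then show ?thesis using assms(1,3) torus_nonzero[of j t i] by simp
qed

text \<open>Upper bound: a chain of length \<open>k\<close> gives \<open>k + 1\<close> independent
  functions on the cone, the first one from scaling, and at most \<open>r\<close> exist. Lower
  bound: the closures of the partial orbits of \<open>p\<close> with \<open>1, ..., r\<close>
  parameters form a strict chain through \<open>p\<close>.\<close>

lemma local_dim_torus_point:
  fixes p :: "'k::field_char_0 vec"
  assumes p: "p \<in> cone" "\<And>i. i < n \<Longrightarrow> p $ i \<noteq> 0"
  shows "local_dim n variety (proj_point p) = enat (r - 1)"
proof (rule antisym)
  show "local_dim n (variety :: 'k vec set set) (proj_point p) \<le> enat (r - 1)"
    unfolding local_dim_def
  proof (rule Sup_least, clarify)
    fix k and Z :: "nat \<Rightarrow> 'k vec set set"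
    assume Z: "\<forall>i\<le>k. irreducible_closed n (Z i) \<and> Z i \<subseteq> variety \<and> proj_point p \<in> Z i"
      and strict: "\<forall>i<k. Z i \<subset> Z (Suc i)"
    have Zs: "Z i \<subseteq> proj_space n" if "i \<le> k" for i using Z that by (auto simp: variety_def)
    have "trdeg_ge n (\<Union>(Z i)) (Suc i)" if "i \<le> k" for i
      using that
    proof (induction i)
      case 0
      have "p \<in> \<Union>(Z 0)" using Z proj_point_mem by blast
      moreover have "p \<noteq> 0\<^sub>v n" using p(2) n_pos by auto
      moreover have "irreducible_set n (\<Union>(Z 0))" using Z irreducible_closed_cone by blast
      moreover have "c \<cdot>\<^sub>v v \<in> \<Union>(Z 0)" if "v \<in> \<Union>(Z 0)" "c \<noteq> 0" for v c
        using that proj_space_smult Zs[of 0] by blast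
      ultimately show ?case unfolding One_nat_def[symmetric] by (intro trdeg_ge_first[of "\<Union>(Z 0)" p])
    next
      case (Suc i)
      then have i: "i < k" by simp
      obtain F where F: "F \<subseteq> carrier (mpoly_ring n)" "Z i = zero_locus n F"
        using Z[rule_format, of i] i by (auto simp: irreducible_closed_def zariski_closed_def)
      obtain P where P: "P \<in> Z (Suc i)" "P \<notin> Z i" using strict i by blast
      moreover have "P \<in> proj_space n" using P(1) Zs Suc.prems by blast
      ultimately obtain f v where f: "f \<in> F" "v \<in> P" "mpoly_eval f v \<noteq> 0"
        by (auto simp: F(2) zero_locus_def)
      obtain d where "polyfun n d (mpoly_eval f)" using polyfun_mpoly_eval f(1) F(1) by blast
      moreover have "irreducible_set n (\<Union>(Z (Suc i)))" using Z Suc.prems irreducible_closed_cone by blast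
      moreover have "\<Union>(Z i) \<subseteq> \<Union>(Z (Suc i))" using strict i by blast
      moreover have "mpoly_eval f w = 0" if "w \<in> \<Union>(Z i)" for w
        using that f(1) by (auto simp: F(2) zero_locus_def)
      ultimately show ?case
        using trdeg_ge_Suc_subset[of n "\<Union>(Z i)" "Suc i" "\<Union>(Z (Suc i))" d "mpoly_eval f" v]
          Suc.IH i P(1) f(2,3) by auto
    qed
    from trdeg_ge_cone[OF this[OF order_refl]] have "Suc k \<le> r"
      using Z by (auto simp: variety_def)
    then show "enat k \<le> enat (r - 1)" by simp
  qed
next
  let ?S = "\<lambda>i. orbit (Suc i) {p}"
  have pc: "p \<in> carrier_vec n" using p by (simp add: cone_def)
  have sub: "?S i \<subseteq> carrier_vec n - {0\<^sub>v n}" for i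
  proof
    fix v assume v: "v \<in> ?S i"
    from orbit_singleton_nonzero[OF p(2) v n_pos] have "v \<noteq> 0\<^sub>v n" using n_pos by auto
    then show "v \<in> carrier_vec n - {0\<^sub>v n}" using v by (auto simp: orbit_def)
  qed
  have "irreducible_closed n (projective_closure n (?S i))" for i
    by (rule projective_closure_irreducible)
       (use orbit_singleton_irreducible[OF pc] orbit_smult[of _ "Suc i" "{p}"] sub[of i] in auto)
  moreover have "projective_closure n (?S i) \<subseteq> variety" if "i \<le> r - 1" for i
  proof (rule projective_closure_subset_closed[OF variety_closed])
    have "v \<in> cone" if "v \<in> ?S i" for v
      using that \<open>i \<le> r - 1\<close> r_pos act_cone[OF p(1), of "Suc i"] by (auto simp: orbit_def)
    then show "proj_point ` ?S i \<subseteq> variety" using variety_iff sub[of i] by blast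
  qed
  moreover have "proj_point p \<in> projective_closure n (?S i)" for i
    using pc by (intro projective_closure_mem[OF sub] orbit_base) auto
  moreover have "projective_closure n (?S i) \<subset> projective_closure n (?S (Suc i))" if "i < r - 1" for i
  proof -
    have i: "Suc i < r" using that by simp
    obtain u where u: "u \<in> ?S (Suc i)" "shifted_binomial n p (U (Suc i)) u \<noteq> 0"
      using shifted_binomial_separates(2)[OF i p(2)] by blast
    obtain d where d: "polyfun n d (shifted_binomial n p (U (Suc i)))"
      using polyfun_shifted_binomial by blast
    show ?thesis
      by (rule projective_closure_strict[OF orbit_Suc sub _ d _ u])
         (use orbit_smult[of _ "Suc i" "{p}"] shifted_binomial_separates(1)[OF i p(2)] in auto)
  qed
  ultimately show "enat (r - 1) \<le> local_dim n variety (proj_point p)"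
    unfolding local_dim_def
    by (intro Sup_upper CollectI exI[of _ "r - 1"] conjI exI[of _ "\<lambda>i. projective_closure n (?S i)"]) auto
qed

text \<open>The velocity at \<open>s = 0\<close> of the curve
  \<open>act r (\<lambda>j. 1 + s * d j) p\<close>, i.e. the differential at the identity of the map
  from the torus to the orbit of \<open>p\<close>.\<close>

definition tangent_vec :: "'k::field vec \<Rightarrow> (nat \<Rightarrow> 'k) \<Rightarrow> 'k vec" where
  "tangent_vec p d = vec n (\<lambda>i. p $ i * (\<Sum>j<r. of_nat (W j i) * d j))"

text \<open>Modulo \<open>lker\<close>, the vector \<open>D e\<^sub>i\<close> is the combination \<open>\<Sum>\<^sub>j W\<^sub>j\<^sub>i U\<^sub>j\<close>.\<close>

lemma annihilator_lker:
  fixes x :: "nat \<Rightarrow> 'k::field_char_0"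
  assumes x: "\<And>u. u \<in> lker \<Longrightarrow> (\<Sum>i<n. of_int (u i) * x i) = 0"
  shows "\<exists>d. \<forall>i<n. x i = (\<Sum>j<r. of_nat (W j i) * d j)"
proof -
  define y where "y j = (\<Sum>i<n. of_int (U j i) * x i)" for j
  have "of_int D * x i = (\<Sum>j<r. of_nat (W j i) * y j)" if i: "i < n" for i
  proof -
    define u where "u i' = (if i' = i then D else 0) - (\<Sum>j<r. int (W j i) * U j i')" for i'
    have "(\<Sum>i'<n. int (W l i') * u i') = 0" if l: "l < r" for l
    proof -
      have "(\<Sum>i'<n. int (W l i') * u i') =
          (\<Sum>i'<n. int (W l i') * (if i' = i then D else 0)) -
          (\<Sum>j<r. int (W j i) * (\<Sum>i'<n. int (W l i') * U j i'))"
        by (simp add: u_def right_diff_distrib sum_subtractf sum_distrib_left)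
           (subst sum.swap, simp add: mult_ac)
      also have "\<dots> = int (W l i) * D - (\<Sum>j<r. int (W j i) * (if l = j then D else 0))"
        using i l by (simp add: dual if_distrib[of "\<lambda>x. _ * x"] cong: if_cong)
      also have "\<dots> = 0" using l by (simp add: if_distrib[of "\<lambda>x. _ * x"] cong: if_cong)
      finally show ?thesis .
    qed
    then have "(\<Sum>i'<n. of_int (u i') * x i') = 0" by (intro x) (simp add: lker_def)
    also have "(\<Sum>i'<n. of_int (u i') * x i') =
        (\<Sum>i'<n. (if i' = i then of_int D * x i' else 0)) - (\<Sum>i'<n. \<Sum>j<r. of_nat (W j i) * (of_int (U j i') * x i'))"
      unfolding sum_subtractf[symmetric]
      by (rule sum.cong) (auto simp: u_def left_diff_distrib sum_distrib_right mult.assoc)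
    also have "\<dots> = of_int D * x i - (\<Sum>j<r. of_nat (W j i) * y j)"
      using i by (subst sum.swap) (simp add: y_def sum_distrib_left)
    finally show ?thesis by simp
  qed
  then have "\<forall>i<n. x i = (\<Sum>j<r. of_nat (W j i) * (y j / of_int D))"
    using D_nz by (simp add: sum_divide_distrib[symmetric] field_simps)
  then show ?thesis by (rule exI[of _ "\<lambda>j. y j / of_int D"])
qed

text \<open>Differentiating the toric binomials along the line \<open>p + s * w\<close> shows that
  the vector of quotients \<open>w i / p i\<close> is annihilated by all relations, hence is a
  combination of rows. Conversely, a polynomial vanishing on the variety vanishes along the torus
  curve with velocity \<open>tangent_vec p d\<close> at all but finitely many parameters, so its
  derivative there is zero.\<close>

lemma tangent_space_torus_point:
  fixes p :: "'k::field_char_0 vec"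
  assumes p: "p \<in> cone" "\<And>i. i < n \<Longrightarrow> p $ i \<noteq> 0"
  shows "affine_tangent_space n variety (proj_point p) = range (tangent_vec p)"
proof
  have pc: "p \<in> carrier_vec n" and pn: "p \<noteq> 0\<^sub>v n" using p n_pos by (auto simp: cone_def)
  show "affine_tangent_space n variety (proj_point p) \<subseteq> range (tangent_vec p)"
  proof
    fix w assume w: "w \<in> affine_tangent_space n variety (proj_point p)"
    have "(\<Sum>i<n. of_int (u i) * (w $ i / p $ i)) = 0" if u: "u \<in> lker" for u
    proof -
      obtain f where f: "f \<in> carrier (mpoly_ring n)"
        "\<And>v :: 'k vec. mpoly_eval f v = power_product n v (pos_exp u) - power_product n v (neg_exp u)"
        using binomial_polynomial by blast
      then have "f \<in> vanishing_ideal n variety"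
        using u by (auto simp: vanishing_ideal_def variety_def cone_def)
      then have wf: "(\<Sum>i<n. mpoly_eval (mpoly_deriv i f) p * w $ i) = 0"
        using w proj_point_mem[of p] by (auto simp: affine_tangent_space_def)
      define \<gamma> where "\<gamma> i = [:p $ i, w $ i:]" for i
      obtain F where F: "\<And>s. mpoly_eval f (vec n (\<lambda>i. poly (\<gamma> i) s)) = poly F s"
        "\<And>s. poly (pderiv F) s =
           (\<Sum>i<n. mpoly_eval (mpoly_deriv i f) (vec n (\<lambda>i. poly (\<gamma> i) s)) * poly (pderiv (\<gamma> i)) s)"
        using mpoly_chain_rule[OF f(1), of \<gamma>] by blast
      have "poly F s = poly ((\<Prod>j<n. \<gamma> j ^ pos_exp u j) - (\<Prod>j<n. \<gamma> j ^ neg_exp u j)) s" for s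
        by (simp add: F(1)[symmetric] f(2) power_product_def poly_prod)
      then have F_eq: "F = (\<Prod>j<n. \<gamma> j ^ pos_exp u j) - (\<Prod>j<n. \<gamma> j ^ neg_exp u j)"
        using poly_eq_poly_eq_iff by blast
      have "vec n (\<lambda>i. poly (\<gamma> i) 0) = p" using pc by (intro eq_vecI) (auto simp: \<gamma>_def)
      then have "poly (pderiv F) 0 = 0" using wf by (simp add: F(2) \<gamma>_def pderiv_pCons)
      moreover have "poly (pderiv (\<Prod>j<n. \<gamma> j ^ e j)) 0 =
          power_product n p e * (\<Sum>i<n. of_nat (e i) * (w $ i / p $ i))" for e
        using poly_pderiv_prod_power_nonzero[of n \<gamma> 0 e] p(2)
        by (simp add: \<gamma>_def pderiv_pCons power_product_def)
      moreover have "power_product n p (pos_exp u) = power_product n p (neg_exp u)"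
        using p(1) u by (simp add: cone_def)
      ultimately have "power_product n p (neg_exp u) *
          ((\<Sum>i<n. of_nat (nat (u i)) * (w $ i / p $ i)) - (\<Sum>i<n. of_nat (nat (- u i)) * (w $ i / p $ i))) = 0"
        by (simp add: F_eq pderiv_diff right_diff_distrib)
      then have "(\<Sum>i<n. of_nat (nat (u i)) * (w $ i / p $ i)) - (\<Sum>i<n. of_nat (nat (- u i)) * (w $ i / p $ i)) = 0"
        using power_product_nonzero[OF p(2)] by (simp only: mult_eq_0_iff) blast
      then have "(\<Sum>i<n. (of_nat (nat (u i)) - of_nat (nat (- u i))) * (w $ i / p $ i)) = 0"
        by (simp only: left_diff_distrib sum_subtractf)
      moreover have "of_nat (nat (u i)) - of_nat (nat (- u i)) = (of_int (u i) :: 'k)" for i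
        by (cases "u i \<ge> 0") (simp_all add: of_nat_nat)
      ultimately show ?thesis by simp
    qed
    then obtain d where d: "\<forall>i<n. w $ i / p $ i = (\<Sum>j<r. of_nat (W j i) * d j)"
      using annihilator_lker[of "\<lambda>i. w $ i / p $ i"] by blast
    have "w $ i = p $ i * (\<Sum>j<r. of_nat (W j i) * d j)" if "i < n" for i
      unfolding d[rule_format, OF that, symmetric] using p(2)[OF that] by simp
    moreover have "w \<in> carrier_vec n" using w by (simp add: affine_tangent_space_def)
    ultimately have "w = tangent_vec p d" by (intro eq_vecI) (auto simp: tangent_vec_def)
    then show "w \<in> range (tangent_vec p)" by blast
  qed
  show "range (tangent_vec p) \<subseteq> affine_tangent_space n variety (proj_point p)"
    unfolding affine_tangent_space_def
  proof clarify
    fix d :: "nat \<Rightarrow> 'k"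
    have "(\<Sum>i<n. mpoly_eval (mpoly_deriv i f) v * tangent_vec p d $ i) = 0"
      if f: "f \<in> vanishing_ideal n variety" and v: "v \<in> proj_point p" for f v
    proof -
      obtain c where c: "v = c \<cdot>\<^sub>v p" "c \<noteq> 0" using v by (auto simp: proj_point_def)
      have vc: "v \<in> cone" "v \<in> carrier_vec n" using c smult_cone p(1) pc by auto
      have vn: "v $ i \<noteq> 0" if "i < n" for i using that c p(2) pc by auto
      define \<gamma> where "\<gamma> i = [:v $ i:] * (\<Prod>j<r. [:1, d j:] ^ W j i)" for i
      obtain F where F: "\<And>s. mpoly_eval f (vec n (\<lambda>i. poly (\<gamma> i) s)) = poly F s"
        "\<And>s. poly (pderiv F) s =
           (\<Sum>i<n. mpoly_eval (mpoly_deriv i f) (vec n (\<lambda>i. poly (\<gamma> i) s)) * poly (pderiv (\<gamma> i)) s)"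
        using mpoly_chain_rule[of f n \<gamma>] f unfolding vanishing_ideal_def by blast
      have \<gamma>: "vec n (\<lambda>i. poly (\<gamma> i) s) = act r (\<lambda>j. 1 + s * d j) v" for s
        using vc(2) by (intro eq_vecI) (auto simp: \<gamma>_def torus_def poly_prod)
      have "poly F s = 0" if "\<forall>j<r. 1 + s * d j \<noteq> 0" for s
      proof -
        let ?w = "act r (\<lambda>j. 1 + s * d j) v"
        have "?w \<in> cone" by (rule act_cone[OF vc(1) order_refl])
        moreover have "?w $ 0 \<noteq> 0" using n_pos vn that torus_nonzero[of r "\<lambda>j. 1 + s * d j" 0] by simp
        then have "?w \<noteq> 0\<^sub>v n" using n_pos by (metis index_zero_vec(1))
        ultimately have "proj_point ?w \<in> variety" by (simp add: variety_iff)
        then have "mpoly_eval f ?w = 0" using f proj_point_mem[of ?w] by (auto simp: vanishing_ideal_def)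
        then show ?thesis using F(1)[of s] \<gamma> by simp
      qed
      then have "{s. poly F s \<noteq> 0} \<subseteq> (\<Union>j<r. {s. poly [:1, d j:] s = 0})" by auto
      moreover have "finite (\<Union>j<r. {s. poly [:1, d j:] s = 0})"
        by (intro finite_UN_I poly_roots_finite) auto
      ultimately have "F = 0" by (intro poly_cofinite_zero) (rule finite_subset)
      moreover have "vec n (\<lambda>i. poly (\<gamma> i) 0) = v" using vc(2) by (simp add: \<gamma>) (auto simp: act_def torus_def)
      moreover have "poly (pderiv (\<gamma> i)) 0 = c * tangent_vec p d $ i" if "i < n" for i
      proof -
        have "poly (pderiv (\<gamma> i)) 0 = v $ i * poly (pderiv (\<Prod>j<r. [:1, d j:] ^ W j i)) 0"
          by (simp add: \<gamma>_def pderiv_smult)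
        also have "\<dots> = v $ i * (\<Sum>j<r. of_nat (W j i) * d j)"
          using poly_pderiv_prod_power_nonzero[of r "\<lambda>j. [:1, d j:]" 0 "\<lambda>j. W j i"] by (simp add: pderiv_pCons)
        finally show ?thesis using that c pc by (simp add: tangent_vec_def)
      qed
      ultimately have "(\<Sum>i<n. mpoly_eval (mpoly_deriv i f) v * (c * tangent_vec p d $ i)) = 0"
        using F(2)[of 0] by simp
      then have "c * (\<Sum>i<n. mpoly_eval (mpoly_deriv i f) v * tangent_vec p d $ i) = 0"
        by (simp add: sum_distrib_left mult_ac)
      then show ?thesis using c(2) by simp
    qed
    then show "tangent_vec p d \<in> carrier_vec n \<and> (\<forall>f\<in>vanishing_ideal n variety. \<forall>v\<in>proj_point p.
        (\<Sum>i<n. mpoly_eval (mpoly_deriv i f) v * tangent_vec p d $ i) = 0)"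
      by (simp add: tangent_vec_def)
  qed
qed

lemma torus_point_regular:
  fixes p :: "'k::field_char_0 vec"
  assumes p: "p \<in> cone" "\<And>i. i < n \<Longrightarrow> p $ i \<noteq> 0"
  shows "proj_point p \<in> regular_points n variety"
proof -
  define B where "B = mat n r (\<lambda>(i, j). p $ i * of_nat (W j i))"
  have B: "B \<in> carrier_mat n r" by (simp add: B_def)
  have Bx: "B *\<^sub>v x = tangent_vec p (\<lambda>j. x $ j)" if "x \<in> carrier_vec r" for x
    using that by (intro eq_vecI)
      (auto simp: B_def tangent_vec_def scalar_prod_def lessThan_atLeast0 sum_distrib_left mult.assoc)
  have "x = 0\<^sub>v r" if x: "x \<in> carrier_vec r" "B *\<^sub>v x = 0\<^sub>v n" for x
  proof -
    have z: "(\<Sum>j<r. of_nat (W j i) * x $ j) = 0" if "i < n" for i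
    proof -
      have "(B *\<^sub>v x) $ i = 0" using x(2) that by simp
      then show ?thesis using that p(2) by (simp add: Bx[OF x(1)] tangent_vec_def)
    qed
    have "x $ l = 0" if l: "l < r" for l
    proof -
      \<comment> \<open>Pairing with the dual vector \<open>U l\<close> isolates the coordinate
        \<open>x l\<close>; this is the linear independence of the rows.\<close>
      have "0 = (\<Sum>i<n. of_int (U l i) * (\<Sum>j<r. of_nat (W j i) * x $ j))" by (simp add: z)
      also have "\<dots> = (\<Sum>j<r. of_int (\<Sum>i<n. int (W j i) * U l i) * x $ j)"
        by (simp add: sum_distrib_left sum_distrib_right) (subst sum.swap, simp add: mult_ac)
      also have "\<dots> = (\<Sum>j<r. if j = l then of_int D * x $ j else 0)"
        using l by (intro sum.cong) (auto simp: dual)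
      also have "\<dots> = of_int D * x $ l" using l by simp
      finally show ?thesis using D_nz by simp
    qed
    then show ?thesis using x(1) by (intro eq_vecI) auto
  qed
  from dim_mat_range[OF B this]
  have "vectorspace.dim class_ring ((module_vec TYPE('k) n)\<lparr>carrier := {y. \<exists>x\<in>carrier_vec r. B *\<^sub>v x = y}\<rparr>) = r" .
  moreover have "{y. \<exists>x\<in>carrier_vec r. B *\<^sub>v x = y} = range (tangent_vec p)"
  proof -
    have "\<exists>x\<in>carrier_vec r. B *\<^sub>v x = tangent_vec p d" for d
      by (rule bexI[of _ "vec r d"]) (auto simp: Bx tangent_vec_def)
    then show ?thesis using Bx by auto
  qed
  ultimately have "vectorspace.dim class_ring ((module_vec TYPE('k) n)\<lparr>carrier :=
      affine_tangent_space n variety (proj_point p)\<rparr>) = r"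
    by (simp add: tangent_space_torus_point[OF p])
  moreover have "proj_point p \<in> variety" using p n_pos by (subst variety_iff) (auto simp: cone_def)
  ultimately show ?thesis
    using local_dim_torus_point[OF p] r_pos by (simp add: regular_points_def one_enat_def)
qed

lemma orbit_fker_in_dual:
  fixes v :: "'k::field_char_0 vec"
  assumes v: "v \<in> orbit r fker" "v \<noteq> 0\<^sub>v n"
  shows "proj_point v \<in> dual_variety n variety"
proof -
  obtain t q where tq: "v = act r t q" "q \<in> fker" "\<And>l. l < r \<Longrightarrow> t l \<noteq> 0" using v(1) by (auto simp: orbit_def)
  \<comment> \<open>The torus point with inverse parameters: \<open>v\<close> and \<open>p\<close>
    multiply coordinatewise to \<open>q\<close>, so pairing \<open>v\<close> with a tangent vector
    at \<open>p\<close> is pairing the relation \<open>q\<close> with a combination of rows.\<close>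
  define p where "p = act r (\<lambda>l. 1 / t l) (vec n (\<lambda>_. 1))"
  have p: "p \<in> cone" unfolding p_def by (rule act_cone[OF one_cone order_refl])
  have pn: "p $ i \<noteq> 0" if "i < n" for i using that tq(3) torus_nonzero[of r "\<lambda>l. 1 / t l" i] by (simp add: p_def)
  have vp: "v $ i * p $ i = q $ i" if "i < n" for i
  proof -
    have "torus r t i * torus r (\<lambda>l. 1 / t l) i = 1"
      unfolding torus_def prod.distrib[symmetric] using tq(3)
      by (intro prod.neutral) (simp add: power_one_over)
    then show ?thesis using that by (simp add: tq(1) p_def mult.assoc)
  qed
  have vc: "v \<in> carrier_vec n" by (simp add: tq(1))
  have tangent: "tangent_vec p d \<in> hyperplane n (proj_point v)" for d
  proof -
    have "(\<Sum>i<n. v $ i * (p $ i * (\<Sum>j<r. of_nat (W j i) * d j))) = (\<Sum>i<n. \<Sum>j<r. q $ i * (of_nat (W j i) * d j))"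
      by (intro sum.cong) (auto simp: vp mult.assoc[symmetric] sum_distrib_left)
    also have "\<dots> = (\<Sum>j<r. d j * (\<Sum>i<n. of_nat (W j i) * q $ i))"
      by (subst sum.swap) (simp add: sum_distrib_left mult_ac)
    also have "\<dots> = 0" using tq(2) by (simp add: fker_def)
    finally have "v \<bullet> tangent_vec p d = 0" by (simp add: scalar_prod_def tangent_vec_def lessThan_atLeast0)
    then show ?thesis using vc by (auto simp: hyperplane_def proj_point_def tangent_vec_def)
  qed
  have "w \<in> hyperplane n (proj_point v)" if w: "w \<in> proj_point p" for w
  proof -
    obtain c where c: "w = c \<cdot>\<^sub>v p" using w by (auto simp: proj_point_def)
    \<comment> \<open>Since \<open>W 0\<close> is the row of ones, \<open>p\<close> and its
      multiples are tangent vectors themselves; the hyperplane therefore passes through the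
      point.\<close>
    have "w = tangent_vec p (\<lambda>j. if j = 0 then c else 0)"
      using r_pos W0 by (intro eq_vecI)
        (auto simp: c tangent_vec_def p_def if_distrib[of "\<lambda>x. _ * x"] cong: if_cong)
    then show ?thesis using tangent by simp
  qed
  then have "proj_point v \<in> {H \<in> proj_space n. \<exists>P \<in> regular_points n variety.
      P \<subseteq> hyperplane n H \<and> affine_tangent_space n variety P \<subseteq> hyperplane n H}"
    using torus_point_regular[OF p pn] tangent tangent_space_torus_point[OF p pn] vc v(2)
    by (auto simp: proj_space_def intro!: bexI[of _ "proj_point p"])
  then show ?thesis by (auto simp: dual_variety_def zariski_closure_def)
qed

lemma self_dual_shifted_binomial:
  fixes k k' :: "'k::field_char_0 vec"
  assumes sd: "self_dual n (variety :: 'k vec set set)"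
    and k: "k \<in> fker" "\<And>i. i < n \<Longrightarrow> k $ i \<noteq> 0" "k' \<in> fker" "u \<in> lker"
  shows "shifted_binomial n k u k' = 0"
proof -
  obtain M where M: "M \<in> carrier_mat n n" "(\<lambda>P. (*\<^sub>v) M ` P) ` variety = dual_variety n (variety :: 'k vec set set)"
    using sd by (auto simp: self_dual_def)
  have "v \<in> (*\<^sub>v) M ` cone" if v: "v \<in> orbit r fker" for v
  proof (cases "v = 0\<^sub>v n")
    \<comment> \<open>The origin represents no projective point, so it is matched by the origin of
      the cone instead.\<close>
    case True
    then show ?thesis using M(1) zero_cone by (auto intro!: image_eqI[of _ _ "0\<^sub>v n"])
  next
    case False
    then have "proj_point v \<in> (\<lambda>P. (*\<^sub>v) M ` P) ` variety" using orbit_fker_in_dual v M(2) by blast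
    then show ?thesis using proj_point_mem[of v] by (auto simp: variety_def)
  qed
  then show ?thesis using shifted_binomial_vanishes_on_fker[OF M(1) _ k] by blast
qed

end

section \<open>Toric data of a configuration\<close>

text \<open>
  Each further row either vanishes on the current lattice of relations or is added to \<open>W\<close>; in the
  latter case the dual family is corrected along a relation on which the new row does not vanish.
\<close>

lemma toric_data_exists_rows:
  fixes as :: "(nat \<Rightarrow> nat) list"
  assumes "0 < n"
  shows "\<exists>r W U D. toric_data n r W U D \<and> (\<forall>u. u \<in> toric_data.lker n r W \<longleftrightarrow>
     (\<Sum>i<n. u i) = 0 \<and> (\<forall>a \<in> set as. (\<Sum>i<n. int (a i) * u i) = 0))"
proof (induction as)
  case Nil
  let ?U = "\<lambda>(j::nat) (i::nat). if i = 0 then 1 else (0::int)"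
  have td: "toric_data n 1 (\<lambda>_ _. 1) ?U 1"
    by unfold_locales (use assms in auto)
  have "u \<in> toric_data.lker n 1 (\<lambda>_ _. 1) \<longleftrightarrow>
      (\<Sum>i<n. u i) = 0 \<and> (\<forall>a \<in> set []. (\<Sum>i<n. int (a i) * u i) = 0)" for u
    unfolding toric_data.lker_def[OF td] by simp
  then show ?case using td by blast
next
  case (Cons a as)
  then obtain r W U D where td: "toric_data n r W U D" and
    ker: "\<And>u. u \<in> toric_data.lker n r W \<longleftrightarrow>
       (\<Sum>i<n. u i) = 0 \<and> (\<forall>a \<in> set as. (\<Sum>i<n. int (a i) * u i) = 0)"
    by blast
  interpret T: toric_data n r W U D by (rule td)
  show ?case
  proof (cases "\<forall>u \<in> T.lker. (\<Sum>i<n. int (a i) * u i) = 0")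
    case True
    then have "\<forall>u. u \<in> T.lker \<longleftrightarrow> (\<Sum>i<n. u i) = 0 \<and> (\<forall>a \<in> set (a # as). (\<Sum>i<n. int (a i) * u i) = 0)"
      using ker by auto
    then show ?thesis using td by blast
  next
    case False
    then obtain u where u: "u \<in> T.lker" "(\<Sum>i<n. int (a i) * u i) \<noteq> 0" by blast
    define c where "c = (\<Sum>i<n. int (a i) * u i)"
    define s where "s j = (\<Sum>i<n. int (a i) * U j i)" for j
    define W' where "W' = W(r := a)"
    \<comment> \<open>Subtracting \<open>s j * u\<close> kills the pairing with the new row. Scaling
      by \<open>c\<close> instead of dividing keeps the family integral, and the common diagonal
      value becomes \<open>c * D\<close>.\<close>
    define U' where "U' j = (if j < r then (\<lambda>i. c * U j i - s j * u i) else (\<lambda>i. D * u i))" for j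
    have lin: "(\<Sum>i<n. int (w i) * U' j i) =
        (if j < r then c * (\<Sum>i<n. int (w i) * U j i) - s j * (\<Sum>i<n. int (w i) * u i)
         else D * (\<Sum>i<n. int (w i) * u i))" for w j
      by (simp add: U'_def right_diff_distrib sum_subtractf sum_distrib_left mult.left_commute)
    have Wu: "(\<Sum>i<n. int (W l i) * u i) = 0" if "l < r" for l using u(1) that by (simp add: T.lker_def)
    have td': "toric_data n (Suc r) W' U' (c * D)"
    proof
      show "0 < n" "0 < Suc r" using assms by auto
      show "W' 0 i = 1" if "i < n" for i using T.W0[OF that] T.r_pos by (simp add: W'_def)
      show "c * D \<noteq> 0" using u(2) T.D_nz by (simp add: c_def)
      show "(\<Sum>i<n. int (W' l i) * U' j i) = (if l = j then c * D else 0)"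
        if "l < Suc r" "j < Suc r" for l j
      proof (cases "l < r")
        case True
        then show ?thesis using that(2) Wu[OF True] T.dual[OF True, of j]
          unfolding lin by (auto simp: W'_def)
      next
        case False
        then have "l = r" using that by simp
        then show ?thesis using that(2) unfolding lin by (auto simp: W'_def c_def s_def)
      qed
    qed
    have "v \<in> toric_data.lker n (Suc r) W' \<longleftrightarrow> v \<in> T.lker \<and> (\<Sum>i<n. int (a i) * v i) = 0" for v
      unfolding toric_data.lker_def[OF td'] T.lker_def by (auto simp: W'_def less_Suc_eq)
    then have "\<forall>v. v \<in> toric_data.lker n (Suc r) W' \<longleftrightarrow>
       (\<Sum>i<n. v i) = 0 \<and> (\<forall>a \<in> set (a # as). (\<Sum>i<n. int (a i) * v i) = 0)"
      using ker by auto
    then show ?thesis using td' by blast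
  qed
qed

lemma mat_kernel_iff:
  "u \<in> mat_kernel A \<longleftrightarrow> u \<in> carrier_vec (dim_col A) \<and>
     (\<forall>k<dim_row A. (\<Sum>i<dim_col A. A $$ (k, i) * u $ i) = 0)"
proof -
  have "(A *\<^sub>v u) $ k = (\<Sum>i<dim_col A. A $$ (k, i) * u $ i)"
    if "u \<in> carrier_vec (dim_col A)" "k < dim_row A" for k
    using that by (simp add: scalar_prod_def lessThan_atLeast0)
  then show ?thesis by (auto simp: mat_kernel_def vec_eq_iff)
qed

lemma ones_in_rational_row_span_sum:
  assumes "ones_in_rational_row_span A" "\<And>k. k < dim_row A \<Longrightarrow> (\<Sum>i<dim_col A. A $$ (k, i) * u i) = 0"
  shows "(\<Sum>i<dim_col A. u i) = 0"
proof -
  let ?n = "dim_col A"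
  obtain q where q: "q \<in> carrier_vec (dim_row A)"
    "transpose_mat (map_mat rat_of_int A) *\<^sub>v q = vec ?n (\<lambda>_. 1)"
    using assms(1) by (auto simp: ones_in_rational_row_span_def)
  have one: "(\<Sum>k<dim_row A. rat_of_int (A $$ (k, i)) * q $ k) = 1" if "i < ?n" for i
  proof -
    have "(transpose_mat (map_mat rat_of_int A) *\<^sub>v q) $ i = 1" using that q(2) by simp
    then show ?thesis using that q(1) by (simp add: scalar_prod_def lessThan_atLeast0)
  qed
  have "rat_of_int (\<Sum>i<?n. u i) = (\<Sum>i<?n. (\<Sum>k<dim_row A. rat_of_int (A $$ (k, i)) * q $ k) * rat_of_int (u i))"
    using one by simp
  also have "\<dots> = (\<Sum>k<dim_row A. q $ k * rat_of_int (\<Sum>i<?n. A $$ (k, i) * u i))"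
    by (simp add: sum_distrib_left sum_distrib_right) (subst sum.swap, simp add: mult_ac)
  also have "\<dots> = 0" using assms(2) by simp
  finally have "rat_of_int (\<Sum>i<?n. u i) = rat_of_int 0" by simp
  then show ?thesis by (simp only: of_int_eq_iff)
qed

lemma toric_data_exists:
  assumes ones: "ones_in_rational_row_span A" and pos: "0 < dim_col A"
  shows "\<exists>r W U D. toric_data (dim_col A) r W U D \<and> (\<forall>u. u \<in> mat_kernel A \<longleftrightarrow>
     u \<in> carrier_vec (dim_col A) \<and> ($) u \<in> toric_data.lker (dim_col A) r W)"
proof -
  let ?n = "dim_col A"
  \<comment> \<open>Adding \<open>N\<close> to all entries makes the rows natural-valued. It adds a
    multiple of the row of ones, which lies in the rational row span and so vanishes on all
    relations.\<close>
  define N where "N = (\<Sum>k<dim_row A. \<Sum>i<?n. \<bar>A $$ (k, i)\<bar>)"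
  have N: "0 \<le> A $$ (k, i) + N" if "k < dim_row A" "i < ?n" for k i
  proof -
    have "\<bar>A $$ (k, i)\<bar> \<le> (\<Sum>i<?n. \<bar>A $$ (k, i)\<bar>)" using that by (intro member_le_sum) auto
    also have "\<dots> \<le> N" unfolding N_def
      using that by (intro member_le_sum[of k _ "\<lambda>k. \<Sum>i<?n. \<bar>A $$ (k, i)\<bar>"]) (auto intro: sum_nonneg)
    finally show ?thesis by simp
  qed
  define a where "a k = (\<lambda>i. nat (A $$ (k, i) + N))" for k
  have a: "(\<Sum>i<?n. int (a k i) * u i) = (\<Sum>i<?n. A $$ (k, i) * u i) + N * (\<Sum>i<?n. u i)"
    if "k < dim_row A" for k u
    unfolding sum_distrib_left sum.distrib[symmetric]
    by (rule sum.cong) (auto simp: a_def N[OF that] distrib_right)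
  obtain r W U D where td: "toric_data ?n r W U D" and
    ker: "\<forall>u. u \<in> toric_data.lker ?n r W \<longleftrightarrow>
     (\<Sum>i<?n. u i) = 0 \<and> (\<forall>a \<in> set (map a [0..<dim_row A]). (\<Sum>i<?n. int (a i) * u i) = 0)"
    using toric_data_exists_rows[OF pos, of "map a [0..<dim_row A]"] by blast
  have "u \<in> toric_data.lker ?n r W \<longleftrightarrow> (\<forall>k<dim_row A. (\<Sum>i<?n. A $$ (k, i) * u i) = 0)" for u
  proof -
    have "u \<in> toric_data.lker ?n r W \<longleftrightarrow>
      (\<Sum>i<?n. u i) = 0 \<and> (\<forall>k<dim_row A. (\<Sum>i<?n. int (a k i) * u i) = 0)"
      unfolding ker[rule_format] by auto
    also have "\<dots> \<longleftrightarrow> (\<Sum>i<?n. u i) = 0 \<and> (\<forall>k<dim_row A. (\<Sum>i<?n. A $$ (k, i) * u i) = 0)"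
      by (auto simp: a)
    also have "\<dots> \<longleftrightarrow> (\<forall>k<dim_row A. (\<Sum>i<?n. A $$ (k, i) * u i) = 0)"
      using ones_in_rational_row_span_sum[OF ones] by blast
    finally show ?thesis .
  qed
  then have "\<forall>u. u \<in> mat_kernel A \<longleftrightarrow> u \<in> carrier_vec ?n \<and> ($) u \<in> toric_data.lker ?n r W"
    by (simp add: mat_kernel_iff)
  with td show ?thesis by blast
qed

section \<open>The toric ideal and its zero locus\<close>

lemma vec_monomial_carrier: "vec_monomial n e \<in> carrier (mpoly_ring n)"
proof -
  have "Poly_Mapping.keys (\<Sum>i<n. Poly_Mapping.single i (e i)) \<subseteq> {..<n}"
    by (auto simp: in_keys_iff lookup_sum lookup_single when_def split: if_splits intro: ccontr)
  then show ?thesis by (auto simp: carrier_mpoly_ring vec_monomial_def)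
qed

lemma mpoly_eval_vec_monomial: "mpoly_eval (vec_monomial n e) v = power_product n v e"
proof -
  have "Poly_Mapping.lookup (\<Sum>i<n. Poly_Mapping.single i (e i)) j = e j" if "j < n" for j
    using that by (simp add: lookup_sum lookup_single when_def)
  moreover have "Poly_Mapping.keys (\<Sum>i<n. Poly_Mapping.single i (e i)) \<subseteq> {..<n}"
    by (auto simp: in_keys_iff lookup_sum lookup_single when_def split: if_splits intro: ccontr)
  ultimately show ?thesis
    by (simp add: vec_monomial_def mpoly_eval_single monomial_eval_superset[of "{..<n}"] power_product_def)
qed

lemma toric_binomial_carrier:
  "toric_binomial u \<in> carrier (mpoly_ring (dim_vec u))"
proof -
  have "p - q \<in> carrier (mpoly_ring n)" if "p \<in> carrier (mpoly_ring n)" "q \<in> carrier (mpoly_ring n)"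
    for p q :: "'a mpoly" and n
    using that Poly_Mapping.keys_diff[of p q] by (auto simp: carrier_mpoly_ring)
  then show ?thesis by (simp add: toric_binomial_def vec_monomial_carrier)
qed

lemma vanishing_on_points_ideal:
  "ideal {f \<in> carrier (mpoly_ring n :: 'k::field mpoly ring). \<forall>v\<in>P. mpoly_eval f v = 0} (mpoly_ring n)"
proof -
  interpret R: cring "mpoly_ring n :: 'k mpoly ring" by (rule mpoly_ring_cring)
  let ?J = "{f \<in> carrier (mpoly_ring n :: 'k mpoly ring). \<forall>v\<in>P. mpoly_eval f v = 0}"
  have ops: "x \<oplus>\<^bsub>mpoly_ring n\<^esub> y = x + y" "x \<otimes>\<^bsub>mpoly_ring n\<^esub> y = x * y"
    "\<zero>\<^bsub>mpoly_ring n\<^esub> = (0 :: 'k mpoly)" for x y :: "'k mpoly"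
    by (simp_all add: mpoly_ring_def)
  have inv: "\<ominus>\<^bsub>mpoly_ring n\<^esub> x = - x" if x: "x \<in> carrier (mpoly_ring n)" for x :: "'k mpoly"
  proof -
    have "- x \<in> carrier (mpoly_ring n)" using x by (simp add: carrier_mpoly_ring)
    then show ?thesis using x by (intro R.minus_equality) (simp_all add: ops)
  qed
  show ?thesis
  proof (rule idealI)
    show "ring (mpoly_ring n :: 'k mpoly ring)" by (rule R.ring_axioms)
    show "subgroup ?J (add_monoid (mpoly_ring n))"
    proof (rule subgroup.intro)
      show "?J \<subseteq> carrier (add_monoid (mpoly_ring n))" by auto
      show "x \<otimes>\<^bsub>add_monoid (mpoly_ring n)\<^esub> y \<in> ?J" if "x \<in> ?J" "y \<in> ?J" for x y
        using that R.a_closed[of x y] by (simp add: ops mpoly_eval_add)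
      show "\<one>\<^bsub>add_monoid (mpoly_ring n)\<^esub> \<in> ?J"
        using R.zero_closed by (simp add: ops)
      show "inv\<^bsub>add_monoid (mpoly_ring n)\<^esub> x \<in> ?J" if "x \<in> ?J" for x
        using that R.a_inv_closed[of x] inv[of x] unfolding a_inv_def[symmetric]
        by (simp add: mpoly_eval_uminus)
    qed
    show "x \<otimes>\<^bsub>mpoly_ring n\<^esub> a \<in> ?J" "a \<otimes>\<^bsub>mpoly_ring n\<^esub> x \<in> ?J"
      if "a \<in> ?J" "x \<in> carrier (mpoly_ring n)" for a x
      using that R.m_closed[of x a] R.m_closed[of a x] by (simp_all add: ops mpoly_eval_mult)
  qed
qed

lemma zero_locus_genideal:
  assumes "S \<subseteq> carrier (mpoly_ring n)"
  shows "zero_locus n (Idl\<^bsub>mpoly_ring n\<^esub> S) = zero_locus n (S :: 'k::field mpoly set)"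
proof -
  interpret R: cring "mpoly_ring n :: 'k mpoly ring" by (rule mpoly_ring_cring)
  have "S \<subseteq> Idl\<^bsub>mpoly_ring n\<^esub> S" using assms by (rule R.genideal_self)
  moreover have "mpoly_eval f v = 0"
    if "\<forall>f\<in>S. \<forall>v\<in>P. mpoly_eval f v = 0" "f \<in> Idl\<^bsub>mpoly_ring n\<^esub> S" "v \<in> P" for P f v
    using R.genideal_minimal[OF vanishing_on_points_ideal[of n P], of S] assms that by blast
  ultimately show ?thesis unfolding zero_locus_def by blast
qed

section \<open>Orders of vanishing and relations in general position\<close>

lemma const_poly_prod: "(\<Prod>i\<in>I. [:f i:]) = [:\<Prod>i\<in>I. f i :: 'k::comm_semiring_1:]"
  by (induction I rule: infinite_finite_induct) (simp_all add: one_pCons mult.commute)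

text \<open>Both exponents are the order of vanishing at \<open>0\<close> of one and the same
  polynomial.\<close>

lemma monomial_power_cancel:
  fixes P Q :: "'k::field poly"
  assumes eq: "[:0, 1:] ^ a * P = [:0, 1:] ^ b * Q" and nz: "poly P 0 \<noteq> 0" "poly Q 0 \<noteq> 0"
  shows "a = b"
proof -
  have aux: False if "a < b" "[:0, 1:] ^ a * P = [:0, 1:] ^ b * Q" "poly P 0 \<noteq> 0" for a b and P Q :: "'k poly"
  proof -
    have "[:0, 1:] ^ a * P = [:0, 1:] ^ a * ([:0, 1:] ^ (b - a) * Q)"
      using that by (simp add: mult.assoc[symmetric] power_add[symmetric])
    then have "P = [:0, 1:] ^ (b - a) * Q" by simp
    then have "poly P 0 = 0" using that(1) by simp
    then show False using that(3) by simp
  qed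
  show ?thesis using aux[of a b P Q] aux[of b a Q P] eq nz by (metis linorder_neqE_nat)
qed

text \<open>If \<open>w\<close> works for \<open>J\<close> but vanishes at \<open>j\<close>, then
  \<open>N * w + v\<close> works for both: \<open>N\<close> exceeds every
  \<open>\<bar>v i\<bar>\<close> with \<open>i\<close> in \<open>J\<close>, so no cancellation can
  occur there. The lemma yields relations of full support as well as relations whose zeros are
  exactly one class.\<close>

lemma avoid_coordinate_hyperplanes:
  fixes K :: "(nat \<Rightarrow> int) set"
  assumes "finite J" and comb: "\<And>u v a b. u \<in> K \<Longrightarrow> v \<in> K \<Longrightarrow> (\<lambda>i. a * u i + b * v i) \<in> K"
    and "K \<noteq> {}" and "\<And>j. j \<in> J \<Longrightarrow> \<exists>w \<in> K. w j \<noteq> 0"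
  shows "\<exists>w \<in> K. \<forall>j \<in> J. w j \<noteq> 0"
  using assms(1,4)
proof (induction J rule: finite_induct)
  case empty
  then show ?case using assms(3) by blast
next
  case (insert j J)
  then obtain w where w: "w \<in> K" "\<forall>i\<in>J. w i \<noteq> 0" by auto
  obtain v where v: "v \<in> K" "v j \<noteq> 0" using insert by auto
  show ?case
  proof (cases "w j = 0")
    case False
    then show ?thesis using w by auto
  next
    case True
    define N where "N = 1 + (\<Sum>i\<in>J. \<bar>v i\<bar>)"
    have "N * w i + 1 * v i \<noteq> 0" if i: "i \<in> J" for i
    proof
      assume "N * w i + 1 * v i = 0"
      then have "\<bar>N * w i\<bar> = \<bar>v i\<bar>" by simp
      moreover have "\<bar>v i\<bar> < N" using member_le_sum[OF i, of "\<lambda>i. \<bar>v i\<bar>"] insert.hyps(1) by (simp add: N_def)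
      moreover have "1 \<le> \<bar>w i\<bar>" using w(2) i by auto
      moreover have "0 \<le> N" by (simp add: N_def sum_nonneg)
      ultimately have "N * \<bar>w i\<bar> < N" by (simp add: abs_mult)
      moreover have "N * 1 \<le> N * \<bar>w i\<bar>" by (rule mult_left_mono) fact+
      ultimately show False by simp
    qed
    moreover have "N * w j + 1 * v j \<noteq> 0" using True v by simp
    ultimately show ?thesis using comb[OF w(1) v(1), of N 1] by (intro bexI[of _ "\<lambda>i. N * w i + 1 * v i"]) auto
  qed
qed

context toric_data
begin

lemma lker_comb: "u \<in> lker \<Longrightarrow> v \<in> lker \<Longrightarrow> (\<lambda>i. a * u i + b * v i) \<in> lker"
proof -
  assume uv: "u \<in> lker" "v \<in> lker"
  have "(\<Sum>i<n. int (W j i) * (a * u i + b * v i)) =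
     a * (\<Sum>i<n. int (W j i) * u i) + b * (\<Sum>i<n. int (W j i) * v i)" for j
    by (simp add: algebra_simps sum.distrib sum_distrib_left)
  then show ?thesis using uv by (simp add: lker_def)
qed

lemma toric_variety_eq_variety:
  assumes "dim_col A = n" and ker: "\<And>u. u \<in> mat_kernel A \<longleftrightarrow> u \<in> carrier_vec n \<and> ($) u \<in> lker"
  shows "toric_variety A = (variety :: 'k::field vec set set)"
proof -
  have "toric_binomial ` mat_kernel A \<subseteq> carrier (mpoly_ring n :: 'k mpoly ring)"
  proof
    fix f :: "'k mpoly" assume "f \<in> toric_binomial ` mat_kernel A"
    then obtain u where "u \<in> mat_kernel A" "f = toric_binomial u" by blast
    then show "f \<in> carrier (mpoly_ring n)"
      using ker toric_binomial_carrier[of u, where 'a = 'k] by auto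
  qed
  then have "toric_variety A = zero_locus n (toric_binomial ` mat_kernel A :: 'k mpoly set)"
    by (simp add: toric_variety_def toric_ideal_def assms(1) zero_locus_genideal)
  moreover have mem: "v \<in> cone \<longleftrightarrow> (\<forall>u\<in>mat_kernel A. mpoly_eval (toric_binomial u) v = 0)"
    if "v \<in> carrier_vec n" for v :: "'k vec"
  proof -
    have binom: "mpoly_eval (toric_binomial u) v =
        power_product n v (pos_exp (($) u)) - power_product n v (neg_exp (($) u))" if "u \<in> mat_kernel A" for u
    proof -
      have "dim_vec u = n" using that ker by auto
      then show ?thesis by (simp add: toric_binomial_def mpoly_eval_diff mpoly_eval_vec_monomial)
    qed
    have "power_product n v (pos_exp u) = power_product n v (neg_exp u)"
      if z: "\<forall>u\<in>mat_kernel A. mpoly_eval (toric_binomial u) v = 0" and u: "u \<in> lker" for u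
    proof -
      \<comment> \<open>Membership in \<open>lker\<close> involves only the values below
        \<open>n\<close>, so cutting the function \<open>u\<close> down to a vector stays within
        it.\<close>
      have "(\<Sum>i<n. int (W j i) * vec n u $ i) = (\<Sum>i<n. int (W j i) * u i)" for j
        by (rule sum.cong) auto
      then have "($) (vec n u) \<in> lker" using u by (simp add: lker_def)
      then have "vec n u \<in> mat_kernel A" using ker by simp
      then show ?thesis using z binom[of "vec n u"] by (simp add: power_product_def)
    qed
    then have "v \<in> cone" if "\<forall>u\<in>mat_kernel A. mpoly_eval (toric_binomial u) v = 0"
      using that \<open>v \<in> carrier_vec n\<close> by (simp add: cone_def)
    moreover have "mpoly_eval (toric_binomial u) v = 0" if "v \<in> cone" "u \<in> mat_kernel A" for u
      using that ker[of u] by (simp add: binom cone_def)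
    ultimately show ?thesis by blast
  qed
  moreover have "P \<subseteq> cone \<longleftrightarrow> (\<forall>f \<in> toric_binomial ` mat_kernel A. \<forall>v\<in>P. mpoly_eval f v = 0)"
    if "P \<in> proj_space n" for P :: "'k vec set"
    using proj_space_mem(1)[OF that] mem by blast
  ultimately show ?thesis
    unfolding variety_def zero_locus_def by blast
qed

lemma of_int_lker:
  assumes "u \<in> lker" "j < r" shows "(\<Sum>i<n. of_nat (W j i) * of_int (u i)) = (0 :: 'k::field)"
proof -
  have "(\<Sum>i<n. of_nat (W j i) * of_int (u i)) = (of_int (\<Sum>i<n. int (W j i) * u i) :: 'k)" by simp
  also have "\<dots> = 0" using assms unfolding lker_def by (simp del: of_int_sum)
  finally show ?thesis .
qed

lemma of_int_lker_fker: "u \<in> lker \<Longrightarrow> vec n (\<lambda>i. of_int (u i)) \<in> fker"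
  by (simp add: fker_def of_int_lker)

text \<open>
  Compare the orders of vanishing at \<open>s = 0\<close> of the two monomials of the binomial identity along the
  line \<open>y + s k\<close>, where \<open>y\<close> vanishes exactly on the coordinates in the class of \<open>i0\<close>.
\<close>

lemma self_dual_class_sum:
  assumes sd: "self_dual n (variety :: 'k::field_char_0 vec set set)"
    and nonfree: "\<And>i. i < n \<Longrightarrow> \<exists>w \<in> lker. w i \<noteq> 0" and "u \<in> lker" and "i0 < n"
  shows "(\<Sum>i | i < n \<and> (\<forall>w \<in> lker. w i0 = 0 \<longrightarrow> w i = 0). u i) = 0"
proof -
  let ?L = "{i. i < n \<and> (\<forall>w \<in> lker. w i0 = 0 \<longrightarrow> w i = 0)}"
  obtain k where k: "k \<in> lker" "\<forall>i<n. k i \<noteq> 0"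
  proof -
    have "lker \<noteq> {}" using \<open>u \<in> lker\<close> by blast
    then have "\<exists>k \<in> lker. \<forall>i \<in> {..<n}. k i \<noteq> 0"
      by (intro avoid_coordinate_hyperplanes lker_comb) (use nonfree in auto)
    then show ?thesis using that by auto
  qed
  have zero: "(\<lambda>_. 0) \<in> lker" by (simp add: lker_def)
  \<comment> \<open>By the definition of \<open>?L\<close>, every index outside it is nonzero on
    some relation vanishing at \<open>i0\<close>; a generic such relation avoids all these zeros at
    once.\<close>
  have "\<exists>y \<in> {y \<in> lker. y i0 = 0}. \<forall>i \<in> {..<n} - ?L. y i \<noteq> 0"
    by (rule avoid_coordinate_hyperplanes) (use zero lker_comb in auto)
  then obtain y where y: "y \<in> lker" "y i0 = 0" "\<And>i. i < n \<Longrightarrow> i \<notin> ?L \<Longrightarrow> y i \<noteq> 0" by auto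
  have yL: "y i = 0" if "i \<in> ?L" for i using that y by auto
  define \<gamma> where "\<gamma> i = [:of_int (y i), of_int (k i) :: 'k:]" for i
  define kv where "kv = vec n (\<lambda>i. of_int (k i) :: 'k)"
  have kv: "kv \<in> fker" "\<And>i. i < n \<Longrightarrow> kv $ i \<noteq> 0" using of_int_lker_fker k by (auto simp: kv_def)
  define P where "P e = (\<Prod>i<n. \<gamma> i ^ e i)" for e :: "nat \<Rightarrow> nat"
  have "poly ([:power_product n kv (neg_exp u):] * P (pos_exp u)) s =
      poly ([:power_product n kv (pos_exp u):] * P (neg_exp u)) s" for s
  proof -
    let ?k' = "vec n (\<lambda>i. poly (\<gamma> i) s)"
    have "(\<Sum>i<n. of_nat (W j i) * poly (\<gamma> i) s) =
      (\<Sum>i<n. of_nat (W j i) * of_int (y i)) + s * (\<Sum>i<n. of_nat (W j i) * of_int (k i))" for j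
      by (simp add: \<gamma>_def algebra_simps sum.distrib sum_distrib_left)
    then have "?k' \<in> fker" using y(1) k(1) by (simp add: fker_def of_int_lker)
    from self_dual_shifted_binomial[OF sd kv this \<open>u \<in> lker\<close>]
    have "power_product n ?k' (pos_exp u) * power_product n kv (neg_exp u) =
        power_product n ?k' (neg_exp u) * power_product n kv (pos_exp u)"
      by (simp add: shifted_binomial_def)
    moreover have "power_product n ?k' e = poly (P e) s" for e
      by (simp add: power_product_def P_def poly_prod)
    ultimately show ?thesis by (simp add: mult.commute)
  qed
  then have eq: "[:power_product n kv (neg_exp u):] * P (pos_exp u) =
      [:power_product n kv (pos_exp u):] * P (neg_exp u)"
    using poly_eq_poly_eq_iff by blast
  \<comment> \<open>On the class \<open>\<gamma> i\<close> is the monomial with coefficient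
    \<open>k i\<close>, which accounts for the power of the variable; \<open>R e\<close> collects
    what is nonzero at \<open>0\<close>.\<close>
  define R where "R e = [:\<Prod>i\<in>?L. of_int (k i) ^ e i:] * (\<Prod>i\<in>{..<n} - ?L. \<gamma> i ^ e i)" for e :: "nat \<Rightarrow> nat"
  have P: "P e = [:0, 1:] ^ (\<Sum>i\<in>?L. e i) * R e" for e
  proof -
    have "(\<Prod>i\<in>?L. \<gamma> i ^ e i) = (\<Prod>i\<in>?L. [:0, 1:] ^ e i * [:of_int (k i) ^ e i:])"
    proof (rule prod.cong)
      fix i assume "i \<in> ?L"
      from yL[OF this] have "\<gamma> i = [:0, 1:] * [:of_int (k i):]" by (simp add: \<gamma>_def)
      then show "\<gamma> i ^ e i = [:0, 1:] ^ e i * [:of_int (k i) ^ e i:]"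
        by (simp only: power_mult_distrib poly_const_pow)
    qed simp
    also have "\<dots> = [:0, 1:] ^ (\<Sum>i\<in>?L. e i) * [:\<Prod>i\<in>?L. of_int (k i) ^ e i:]"
      by (simp only: prod.distrib power_sum const_poly_prod)
    finally have "(\<Prod>i\<in>?L. \<gamma> i ^ e i) = [:0, 1:] ^ (\<Sum>i\<in>?L. e i) * [:\<Prod>i\<in>?L. of_int (k i) ^ e i:]" .
    moreover have "P e = (\<Prod>i\<in>?L. \<gamma> i ^ e i) * (\<Prod>i\<in>{..<n} - ?L. \<gamma> i ^ e i)"
      unfolding P_def by (subst prod.subset_diff[of ?L]) (auto simp: mult.commute)
    ultimately show ?thesis by (simp only: R_def mult.assoc)
  qed
  have R: "poly (R e) 0 \<noteq> 0" for e
    using k(2) y(3) by (auto simp: R_def poly_prod \<gamma>_def)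
  have "[:0, 1:] ^ (\<Sum>i\<in>?L. pos_exp u i) * ([:power_product n kv (neg_exp u):] * R (pos_exp u)) =
      [:0, 1:] ^ (\<Sum>i\<in>?L. neg_exp u i) * ([:power_product n kv (pos_exp u):] * R (neg_exp u))"
    using eq unfolding P by (simp only: mult.left_commute)
  then have "(\<Sum>i\<in>?L. pos_exp u i) = (\<Sum>i\<in>?L. neg_exp u i)"
    by (rule monomial_power_cancel) (use R power_product_nonzero[OF kv(2)] in auto)
  then have "int (\<Sum>i\<in>?L. pos_exp u i) - int (\<Sum>i\<in>?L. neg_exp u i) = 0" by simp
  then have "(\<Sum>i\<in>?L. int (nat (u i)) - int (nat (- u i))) = 0" by (simp add: sum_subtractf)
  moreover have "int (nat (u i)) - int (nat (- u i)) = u i" for i by simp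
  ultimately show ?thesis by simp
qed

end

section \<open>Generalized Lawrence matrices and their kernels\<close>

definition block_offset :: "'a list list \<Rightarrow> nat \<Rightarrow> nat" where
  "block_offset xss i = sum_list (take i (map length xss))"

lemma block_offset_0 [simp]: "block_offset xss 0 = 0"
  and block_offset_Cons_Suc [simp]: "block_offset (xs # xss) (Suc i) = length xs + block_offset xss i"
  by (simp_all add: block_offset_def)

lemma block_offset_cong: "map length xss = map length yss \<Longrightarrow> block_offset xss i = block_offset yss i"
  by (simp add: block_offset_def)

lemma concat_nth_block:
  "i < length xss \<Longrightarrow> j < length (xss ! i) \<Longrightarrow>
     block_offset xss i + j < length (concat xss) \<and> concat xss ! (block_offset xss i + j) = xss ! i ! j"
proof (induction xss arbitrary: i)
  case (Cons xs xss)
  then show ?case by (cases i) (auto simp: nth_append)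
qed simp

lemma sum_concat_blocks:
  fixes F :: "nat \<Rightarrow> 'b::comm_monoid_add"
  shows "(\<Sum>J<length (concat xss). F J) =
    (\<Sum>i<length xss. \<Sum>j<length (xss ! i). F (block_offset xss i + j))"
proof (induction xss arbitrary: F)
  case (Cons xs xss)
  have "(\<Sum>J<length (concat (xs # xss)). F J) =
      (\<Sum>J<length xs. F J) + (\<Sum>J<length (concat xss). F (length xs + J))"
  proof -
    have "(\<Sum>J<m + k. F J) = (\<Sum>J<m. F J) + (\<Sum>J<k. F (m + J))" for m k
      by (induction k) (auto simp: add.assoc)
    then show ?thesis by simp
  qed
  then show ?case by (simp add: Cons.IH sum.lessThan_Suc_shift add.assoc del: sum.lessThan_Suc)
qed simp

lemma dim_GLM_block [simp]:
  "dim_row (GLM_block c) = length c - 1" "dim_col (GLM_block c) = length c"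
  by (simp_all add: GLM_block_def)

text \<open>The kernel consists of the integral vectors proportional to \<open>c\<close> when
  \<open>c ! 0\<close> is nonzero. The trivial case \<open>j = 0\<close> is included to keep the
  condition uniform over the block.\<close>

lemma GLM_block_mult_vec:
  assumes u: "u \<in> carrier_vec (length c)"
  shows "GLM_block c *\<^sub>v u = 0\<^sub>v (length c - 1) \<longleftrightarrow>
    (\<forall>j<length c. c ! 0 * u $ j = c ! j * u $ 0)"
proof -
  have entry: "(GLM_block c *\<^sub>v u) $ r = c ! 0 * u $ Suc r - c ! Suc r * u $ 0" if "r < length c - 1" for r
  proof -
    have "(GLM_block c *\<^sub>v u) $ r =
        (\<Sum>j<length c. (if j = 0 then - (c ! Suc r) else if j = Suc r then c ! 0 else 0) * u $ j)"
      using that u by (simp add: GLM_block_def scalar_prod_def lessThan_atLeast0)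
    also have "\<dots> = (\<Sum>j\<in>{0, Suc r}. (if j = 0 then - (c ! Suc r) else if j = Suc r then c ! 0 else 0) * u $ j)"
      using that by (intro sum.mono_neutral_right) auto
    finally show ?thesis by simp
  qed
  have "GLM_block c *\<^sub>v u = 0\<^sub>v (length c - 1) \<longleftrightarrow>
      (\<forall>r<length c - 1. c ! 0 * u $ Suc r = c ! Suc r * u $ 0)"
    using entry by (auto simp: vec_eq_iff simp del: index_mult_mat_vec)
  also have "\<dots> \<longleftrightarrow> (\<forall>j<length c. c ! 0 * u $ j = c ! j * u $ 0)"
  proof
    assume *: "\<forall>r<length c - 1. c ! 0 * u $ Suc r = c ! Suc r * u $ 0"
    show "\<forall>j<length c. c ! 0 * u $ j = c ! j * u $ 0"
    proof (intro allI impI)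
      fix j assume "j < length c"
      with * show "c ! 0 * u $ j = c ! j * u $ 0" by (cases j) auto
    qed
  qed auto
  finally show ?thesis .
qed

lemma block_diagonal_mult_vec:
  assumes A: "A \<in> carrier_mat a b" and D: "D \<in> carrier_mat c d"
    and x: "x \<in> carrier_vec b" and y: "y \<in> carrier_vec d"
  shows "four_block_mat A (0\<^sub>m a d) (0\<^sub>m c b) D *\<^sub>v (x @\<^sub>v y) = A *\<^sub>v x @\<^sub>v D *\<^sub>v y"
  by (subst four_block_mat_mult_vec[OF A _ _ D x y]) (use A D x y in auto)

lemma diag_GLM_blocks_mult_vec:
  assumes "u \<in> carrier_vec (length (concat cs))"
  shows "diag_block_mat (map GLM_block cs) *\<^sub>v u = 0\<^sub>v (dim_row (diag_block_mat (map GLM_block cs))) \<longleftrightarrow>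
    (\<forall>i<length cs. \<forall>j<length (cs ! i).
       cs ! i ! 0 * u $ (block_offset cs i + j) = cs ! i ! j * u $ block_offset cs i)"
  using assms
proof (induction cs arbitrary: u)
  case Nil
  then show ?case by auto
next
  case (Cons c cs)
  define x y where "x = vec_first u (length c)" and "y = vec_last u (length (concat cs))"
  have x: "x \<in> carrier_vec (length c)" and y: "y \<in> carrier_vec (length (concat cs))"
    by (simp_all add: x_def y_def)
  have u: "u = x @\<^sub>v y"
    unfolding x_def y_def by (rule vec_first_last_append[symmetric]) (use Cons.prems in simp)
  let ?D = "diag_block_mat (map GLM_block cs)"
  have D: "?D \<in> carrier_mat (dim_row ?D) (length (concat cs))"
    by (rule carrier_matI) (auto simp: dim_diag_block_mat length_concat comp_def)
  have B: "GLM_block c \<in> carrier_mat (length c - 1) (length c)" by (rule carrier_matI) auto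
  have "diag_block_mat (map GLM_block (c # cs)) *\<^sub>v u = (GLM_block c *\<^sub>v x) @\<^sub>v (?D *\<^sub>v y)"
    using block_diagonal_mult_vec[OF B D x y]
    by (simp only: u list.map diag_block_mat.simps Let_def dim_GLM_block carrier_matD(2)[OF D])
  moreover have "0\<^sub>v (dim_row (diag_block_mat (map GLM_block (c # cs)))) =
      0\<^sub>v (length c - 1) @\<^sub>v (0\<^sub>v (dim_row ?D) :: int vec)"
    by (intro eq_vecI) (auto simp: Let_def)
  moreover have "(GLM_block c *\<^sub>v x) @\<^sub>v (?D *\<^sub>v y) = 0\<^sub>v (length c - 1) @\<^sub>v 0\<^sub>v (dim_row ?D) \<longleftrightarrow>
      GLM_block c *\<^sub>v x = 0\<^sub>v (length c - 1) \<and> ?D *\<^sub>v y = 0\<^sub>v (dim_row ?D)"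
    by (rule append_vec_eq[of _ "length c - 1"]) (rule carrier_vecI, simp)+
  ultimately have "diag_block_mat (map GLM_block (c # cs)) *\<^sub>v u =
        0\<^sub>v (dim_row (diag_block_mat (map GLM_block (c # cs)))) \<longleftrightarrow>
      (\<forall>j<length c. c ! 0 * x $ j = c ! j * x $ 0) \<and>
      (\<forall>i<length cs. \<forall>j<length (cs ! i).
         cs ! i ! 0 * y $ (block_offset cs i + j) = cs ! i ! j * y $ block_offset cs i)"
    by (simp only: GLM_block_mult_vec[OF x] Cons.IH[OF y])
  also have "\<dots> \<longleftrightarrow> (\<forall>i<length (c # cs). \<forall>j<length ((c # cs) ! i).
       (c # cs) ! i ! 0 * u $ (block_offset (c # cs) i + j) = (c # cs) ! i ! j * u $ block_offset (c # cs) i)"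
  proof -
    have ux: "u $ j = x $ j" if "j < length c" for j using that x y unfolding u by simp
    have uy: "u $ (length c + J) = y $ J" if "J < length (concat cs)" for J using that x y unfolding u by simp
    have "(\<forall>j<length c. c ! 0 * x $ j = c ! j * x $ 0) \<longleftrightarrow> (\<forall>j<length c. c ! 0 * u $ j = c ! j * u $ 0)"
      using ux by (metis gr_implies_not0 neq0_conv)
    moreover have "(\<forall>j<length (cs ! i). cs ! i ! 0 * y $ (block_offset cs i + j) = cs ! i ! j * y $ block_offset cs i) \<longleftrightarrow>
       (\<forall>j<length (cs ! i). cs ! i ! 0 * u $ (length c + block_offset cs i + j) = cs ! i ! j * u $ (length c + block_offset cs i))"
      if i: "i < length cs" for i
    proof -
      have "u $ (length c + block_offset cs i + j) = y $ (block_offset cs i + j)" if "j < length (cs ! i)" for j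
        using uy[of "block_offset cs i + j"] concat_nth_block[OF i that] by (simp add: add.assoc)
      moreover have "u $ (length c + block_offset cs i) = y $ block_offset cs i" if "j < length (cs ! i)" for j
      proof -
        have "0 < length (cs ! i)" using that by linarith
        from concat_nth_block[OF i this] show ?thesis using uy[of "block_offset cs i"] by simp
      qed
      ultimately show ?thesis by auto
    qed
    ultimately show ?thesis by (simp add: All_less_Suc2 add.assoc)
  qed
  finally show ?case .
qed

lemma GLM_dims:
  assumes "GLM_data d as cs ls"
  shows "dim_col (GLM d as cs ls) = length (concat cs)"
    and "length (concat (map2 (\<lambda>a l. map (\<lambda>x. x \<cdot>\<^sub>v a) l) as ls)) = length (concat cs)"
    and "map length (map2 (\<lambda>a l. map (\<lambda>x. x \<cdot>\<^sub>v a) l) as ls) = map length cs"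
proof -
  show *: "map length (map2 (\<lambda>a l. map (\<lambda>x. x \<cdot>\<^sub>v a) l) as ls) = map length cs"
    using assms by (intro nth_equalityI) (auto simp: GLM_data_def)
  then show "length (concat (map2 (\<lambda>a l. map (\<lambda>x. x \<cdot>\<^sub>v a) l) as ls)) = length (concat cs)"
    by (simp only: length_concat)
  then show "dim_col (GLM d as cs ls) = length (concat cs)"
    by (simp add: GLM_def append_rows_def)
qed

text \<open>The lower rows make each block of \<open>u\<close> proportional to its \<open>c\<close>,
  and the weighted sum with the coefficients \<open>ls ! i\<close> recovers the multiplier. The
  upper rows then say that the multipliers form a relation among the vectors
  \<open>as\<close>.\<close>

lemma mat_kernel_GLM:
  assumes G: "GLM_data d as cs ls" and u: "u \<in> carrier_vec (length (concat cs))"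
  shows "u \<in> mat_kernel (GLM d as cs ls) \<longleftrightarrow>
    (\<forall>i<length cs. \<forall>j<length (cs ! i).
       cs ! i ! 0 * u $ (block_offset cs i + j) = cs ! i ! j * u $ block_offset cs i) \<and>
    (\<forall>k<d. (\<Sum>i<length cs. (\<Sum>j<length (cs ! i). ls ! i ! j * u $ (block_offset cs i + j)) * as ! i $ k) = 0)"
proof -
  let ?css = "map2 (\<lambda>a l. map (\<lambda>x. x \<cdot>\<^sub>v a) l) as ls"
  let ?P = "mat_of_cols d (concat ?css)" and ?Q = "diag_block_mat (map GLM_block cs)"
  let ?n = "length (concat cs)"
  have len: "length as = length cs" "length ls = length cs"
    "\<And>i. i < length cs \<Longrightarrow> length (ls ! i) = length (cs ! i)" "\<And>i. i < length cs \<Longrightarrow> as ! i \<in> carrier_vec d"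
    using G by (auto simp: GLM_data_def)
  have P: "?P \<in> carrier_mat d ?n" using GLM_dims(2)[OF G] by (intro carrier_matI) auto
  have Q: "?Q \<in> carrier_mat (dim_row ?Q) ?n"
    by (rule carrier_matI) (auto simp: dim_diag_block_mat length_concat comp_def)
  have "u \<in> mat_kernel (GLM d as cs ls) \<longleftrightarrow> GLM d as cs ls *\<^sub>v u = 0\<^sub>v (dim_row (GLM d as cs ls))"
    using u GLM_dims(1)[OF G] by (simp add: mat_kernel_def)
  also have "GLM d as cs ls *\<^sub>v u = (?P *\<^sub>v u) @\<^sub>v (?Q *\<^sub>v u)"
    unfolding GLM_def by (rule mat_mult_append[OF P Q u])
  also have "0\<^sub>v (dim_row (GLM d as cs ls)) = 0\<^sub>v d @\<^sub>v (0\<^sub>v (dim_row ?Q) :: int vec)"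
    by (intro eq_vecI) (auto simp: GLM_def append_rows_def)
  also have "(?P *\<^sub>v u) @\<^sub>v (?Q *\<^sub>v u) = 0\<^sub>v d @\<^sub>v 0\<^sub>v (dim_row ?Q) \<longleftrightarrow>
      ?P *\<^sub>v u = 0\<^sub>v d \<and> ?Q *\<^sub>v u = 0\<^sub>v (dim_row ?Q)"
    by (rule append_vec_eq[of _ d]) (rule carrier_vecI, simp)+
  also have "?P *\<^sub>v u = 0\<^sub>v d \<longleftrightarrow>
    (\<forall>k<d. (\<Sum>i<length cs. (\<Sum>j<length (cs ! i). ls ! i ! j * u $ (block_offset cs i + j)) * as ! i $ k) = 0)"
  proof -
    have "(?P *\<^sub>v u) $ k =
        (\<Sum>i<length cs. (\<Sum>j<length (cs ! i). ls ! i ! j * u $ (block_offset cs i + j)) * as ! i $ k)"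
      if k: "k < d" for k
    proof -
      have "(?P *\<^sub>v u) $ k = (\<Sum>J<length (concat ?css). concat ?css ! J $ k * u $ J)"
        using k P u GLM_dims(2)[OF G]
        by (auto simp: scalar_prod_def lessThan_atLeast0 mat_of_cols_index intro!: sum.cong)
      also have "\<dots> = (\<Sum>i<length ?css. \<Sum>j<length (?css ! i).
          concat ?css ! (block_offset ?css i + j) $ k * u $ (block_offset ?css i + j))"
        by (rule sum_concat_blocks)
      also have "\<dots> = (\<Sum>i<length cs. \<Sum>j<length (cs ! i).
          ls ! i ! j * as ! i $ k * u $ (block_offset cs i + j))"
      proof (intro sum.cong)
        fix i assume "i \<in> {..<length cs}"
        then have i: "i < length cs" by simp
        show "{..<length (?css ! i)} = {..<length (cs ! i)}" using i len by simp
        fix j assume "j \<in> {..<length (cs ! i)}"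
        then have j: "j < length (cs ! i)" by simp
        have "concat ?css ! (block_offset ?css i + j) = ?css ! i ! j"
          using concat_nth_block[of i ?css j] i j len by simp
        also have "\<dots> $ k = ls ! i ! j * as ! i $ k" using i j k len(1,2,3) len(4)[OF i] by simp
        finally show "concat ?css ! (block_offset ?css i + j) $ k * u $ (block_offset ?css i + j) =
            ls ! i ! j * as ! i $ k * u $ (block_offset cs i + j)"
          using block_offset_cong[OF GLM_dims(3)[OF G]] by simp
      qed (use len in simp)
      finally show ?thesis by (simp add: sum_distrib_left mult_ac)
    qed
    then show ?thesis by (auto simp: vec_eq_iff simp del: index_mult_mat_vec)
  qed
  also have "?Q *\<^sub>v u = 0\<^sub>v (dim_row ?Q) \<longleftrightarrow> (\<forall>i<length cs. \<forall>j<length (cs ! i).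
       cs ! i ! 0 * u $ (block_offset cs i + j) = cs ! i ! j * u $ block_offset cs i)"
    by (rule diag_GLM_blocks_mult_vec[OF u])
  finally show ?thesis by blast
qed

section \<open>Primitive vectors with Bezout coefficients\<close>

lemma bezout_list:
  fixes xs :: "int list"
  shows "\<exists>ys. length ys = length xs \<and> (\<Sum>j<length xs. ys ! j * xs ! j) = Gcd (set xs)"
proof (induction xs)
  case (Cons x xs)
  then obtain ys where ys: "length ys = length xs" "(\<Sum>j<length xs. ys ! j * xs ! j) = Gcd (set xs)" by blast
  obtain a b where ab: "a * x + b * Gcd (set xs) = gcd x (Gcd (set xs))" using bezout_int by blast
  have "(\<Sum>j<length (x # xs). (a # map ((*) b) ys) ! j * (x # xs) ! j) = a * x + b * Gcd (set xs)"
    using ys by (simp add: sum.lessThan_Suc_shift mult.assoc sum_distrib_left[symmetric] ys(2)[symmetric] del: sum.lessThan_Suc)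
  with ab ys(1) show ?case by (intro exI[of _ "a # map ((*) b) ys"]) simp
qed simp

lemma primitive_direction:
  fixes xs :: "int list"
  assumes "xs \<noteq> []" "0 \<notin> set xs"
  shows "\<exists>m cs ls. m \<noteq> 0 \<and> length cs = length xs \<and> length ls = length xs \<and> Gcd (set cs) = 1 \<and>
     0 < cs ! 0 \<and> (\<Sum>j<length cs. ls ! j * cs ! j) = 1 \<and> (\<forall>j<length xs. xs ! j = m * cs ! j)"
proof -
  obtain ys where ys: "length ys = length xs" "(\<Sum>j<length xs. ys ! j * xs ! j) = Gcd (set xs)"
    using bezout_list by blast
  \<comment> \<open>The sign of the first entry goes into \<open>m\<close>, so that the quotient
    vector starts with a positive entry.\<close>
  define m where "m = sgn (xs ! 0) * Gcd (set xs)"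
  have x0: "xs ! 0 \<noteq> 0" "xs ! 0 \<in> set xs" using assms by (auto simp: in_set_conv_nth)
  then have g: "Gcd (set xs) \<noteq> 0" by (auto simp: Gcd_0_iff)
  then have gpos: "Gcd (set xs) > 0" by (simp add: order_less_le)
  have m: "m \<noteq> 0" using g x0 by (simp add: m_def sgn_0_0)
  define cs where "cs = map (\<lambda>x. x div m) xs"
  have "m dvd x" if "x \<in> set xs" for x
    using that x0(1) by (auto simp: m_def sgn_if)
  then have xs: "xs ! j = m * cs ! j" if "j < length xs" for j
    using that by (simp add: cs_def)
  define ls where "ls = map ((*) (sgn (xs ! 0))) ys"
  have "m * (\<Sum>j<length cs. ls ! j * cs ! j) = (\<Sum>j<length xs. ls ! j * xs ! j)"
    by (simp add: sum_distrib_left cs_def[symmetric] xs mult.left_commute) (simp add: cs_def)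
  also have "\<dots> = m"
    using ys by (simp add: ls_def m_def mult.assoc sum_distrib_left[symmetric])
  finally have one: "(\<Sum>j<length cs. ls ! j * cs ! j) = 1" using m by simp
  have "Gcd (set cs) dvd (\<Sum>j<length cs. ls ! j * cs ! j)"
    by (intro dvd_sum dvd_mult Gcd_dvd) auto
  then have "Gcd (set cs) = 1" unfolding one by simp
  moreover have "0 < cs ! 0"
  proof -
    have "xs ! 0 = m * cs ! 0" using xs[of 0] assms(1) by simp
    then show ?thesis using x0(1) gpos
      by (auto simp: m_def sgn_if zero_less_mult_iff split: if_splits)
        (metis not_less_iff_gr_or_eq mult_less_0_iff)
  qed
  moreover have "length cs = length xs" "length ls = length xs" using ys(1) by (simp_all add: cs_def ls_def)
  ultimately show ?thesis using m one xs by blast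
qed

section \<open>The classes of parallel Gale dual vectors\<close>

text \<open>The coordinates that are, as linear forms on the kernel, multiples of coordinate
  \<open>i\<close>. Non-pyramidality excludes zero forms and thereby makes this an equivalence
  relation.\<close>

definition column_class :: "int mat \<Rightarrow> nat \<Rightarrow> nat set" where
  "column_class A i = {j. j < dim_col A \<and> (\<forall>w \<in> mat_kernel A. w $ i = 0 \<longrightarrow> w $ j = 0)}"

lemma non_pyramidalD: "non_pyramidal A \<Longrightarrow> i < dim_col A \<Longrightarrow> \<exists>w \<in> mat_kernel A. w $ i \<noteq> 0"
  by (auto simp: non_pyramidal_def free_column_def)

lemma mat_kernel_comb:
  assumes "u \<in> mat_kernel A" "v \<in> mat_kernel (A :: int mat)"
  shows "vec (dim_col A) (\<lambda>i. a * u $ i + b * v $ i) \<in> mat_kernel A"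
proof -
  have "(\<Sum>i<dim_col A. A $$ (k, i) * (a * u $ i + b * v $ i)) =
     a * (\<Sum>i<dim_col A. A $$ (k, i) * u $ i) + b * (\<Sum>i<dim_col A. A $$ (k, i) * v $ i)" for k
    by (simp add: algebra_simps sum.distrib sum_distrib_left)
  then show ?thesis using assms by (simp add: mat_kernel_iff)
qed

text \<open>The relation \<open>w i * u - u i * w\<close> vanishes at \<open>i\<close>, hence at
  \<open>j\<close>.\<close>

lemma column_class_proportional:
  assumes "j \<in> column_class A i" "i < dim_col A" "u \<in> mat_kernel A" "w \<in> mat_kernel A"
  shows "w $ i * u $ j = u $ i * w $ j"
proof -
  have "vec (dim_col A) (\<lambda>l. w $ i * u $ l + - u $ i * w $ l) \<in> mat_kernel A"
    by (rule mat_kernel_comb[OF assms(3,4)])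
  then show ?thesis using assms(1,2) by (auto simp: column_class_def)
qed

lemma column_class_sym:
  assumes np: "non_pyramidal A" and j: "j \<in> column_class A i" and i: "i < dim_col A"
  shows "i \<in> column_class A j"
proof -
  obtain w where w: "w \<in> mat_kernel A" "w $ j \<noteq> 0"
    using non_pyramidalD[OF np] j by (auto simp: column_class_def)
  have "u $ i = 0" if "u \<in> mat_kernel A" "u $ j = 0" for u
    using column_class_proportional[OF j i that(1) w(1)] that(2) w(2) by simp
  then show ?thesis using i by (auto simp: column_class_def)
qed

lemma column_class_eq:
  assumes "non_pyramidal A" "j \<in> column_class A i" "i < dim_col A"
  shows "column_class A j = column_class A i"
  using assms column_class_sym[OF assms] by (auto simp: column_class_def)

text \<open>A single relation that is nonzero at \<open>i\<close> is nonzero on the whole class;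
  dividing out its content there gives the direction \<open>c\<close>. Its zero sum over the class
  is inherited by \<open>c\<close>. Every other relation is a multiple of \<open>c\<close> on the
  class, with the multiplier read off through the Bezout coefficients \<open>l\<close>.\<close>

lemma column_class_direction:
  assumes np: "non_pyramidal A" and i: "i < dim_col A"
    and sums: "\<And>u. u \<in> mat_kernel A \<Longrightarrow> (\<Sum>j\<in>column_class A i. u $ j) = 0"
    and L: "set L = column_class A i" "distinct L"
  shows "\<exists>c l. length c = length L \<and> length l = length L \<and> Gcd (set c) = 1 \<and> 0 < c ! 0 \<and> 0 \<notin> set c \<and>
     (\<Sum>j<length c. l ! j * c ! j) = 1 \<and> sum_list c = 0 \<and>
     (\<forall>u \<in> mat_kernel A. \<forall>j<length L. u $ (L ! j) = (\<Sum>j<length L. l ! j * u $ (L ! j)) * c ! j)"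
proof -
  obtain w where w: "w \<in> mat_kernel A" "w $ i \<noteq> 0" using non_pyramidalD[OF np i] by blast
  have mem: "L ! j \<in> column_class A i" if "j < length L" for j
    unfolding L(1)[symmetric] using that by (rule nth_mem)
  have lt: "L ! j < dim_col A" if "j < length L" for j using mem[OF that] by (simp add: column_class_def)
  define xs where "xs = map (($) w) L"
  have "i \<in> set L" using L i by (simp add: column_class_def)
  then have "xs \<noteq> []" by (auto simp: xs_def)
  moreover have "0 \<notin> set xs"
  proof
    assume "0 \<in> set xs"
    then obtain j where "j \<in> set L" "w $ j = 0" by (auto simp: xs_def)
    moreover from this have "i \<in> column_class A j" using column_class_sym[OF np _ i] L(1) by blast
    ultimately show False using w by (simp add: column_class_def)
  qed
  ultimately obtain m c l where m: "m \<noteq> 0" "length c = length xs" "length l = length xs" "Gcd (set c) = 1"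
    "0 < c ! 0" "(\<Sum>j<length c. l ! j * c ! j) = 1" "\<forall>j<length xs. xs ! j = m * c ! j"
    using primitive_direction[of xs] by blast
  have wc: "w $ (L ! j) = m * c ! j" if "j < length L" for j using m(7) that by (simp add: xs_def)
  have len: "length c = length L" "length l = length L" using m by (simp_all add: xs_def)
  have c0: "0 \<notin> set c"
    using \<open>0 \<notin> set xs\<close> m(7) len(1) by (force simp: in_set_conv_nth xs_def)
  have "m * sum_list c = (\<Sum>j<length L. w $ (L ! j))"
    using wc len(1) by (simp add: sum_list_sum_nth lessThan_atLeast0 sum_distrib_left)
  also have "\<dots> = sum_list (map (($) w) L)" by (simp add: sum_list_sum_nth lessThan_atLeast0)
  also have "\<dots> = (\<Sum>j\<in>column_class A i. w $ j)" using L by (simp add: sum_list_distinct_conv_sum_set)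
  also have "\<dots> = 0" by (rule sums[OF w(1)])
  finally have "sum_list c = 0" using m(1) by simp
  moreover have "u $ (L ! j) = (\<Sum>j<length L. l ! j * u $ (L ! j)) * c ! j"
    if u: "u \<in> mat_kernel A" and j: "j < length L" for u j
  proof -
    have cross: "u $ (L ! j) * c ! j' = u $ (L ! j') * c ! j" if "j' < length L" for j'
    proof -
      have "L ! j' \<in> column_class A (L ! j)" using column_class_eq[OF np mem[OF j] i] mem[OF that] by simp
      from column_class_proportional[OF this lt[OF j] u w(1)]
      have "m * (u $ (L ! j) * c ! j') = m * (u $ (L ! j') * c ! j)"
        by (auto simp: wc[OF j] wc[OF that] mult_ac)
      then show ?thesis using m(1) by simp
    qed
    have "u $ (L ! j) = u $ (L ! j) * (\<Sum>j'<length L. l ! j' * c ! j')"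
      using m(6) len(1) by simp
    also have "\<dots> = (\<Sum>j'<length L. l ! j' * (u $ (L ! j) * c ! j'))"
      by (simp add: sum_distrib_left mult.left_commute)
    also have "\<dots> = (\<Sum>j'<length L. l ! j' * (u $ (L ! j') * c ! j))"
      by (rule sum.cong) (auto simp: cross)
    finally show ?thesis by (simp add: sum_distrib_right mult.assoc)
  qed
  ultimately show ?thesis using len m(4,5,6) c0 by blast
qed

lemma toric_variety_cong:
  "dim_col A = dim_col B \<Longrightarrow> mat_kernel A = mat_kernel B \<Longrightarrow> toric_variety A = toric_variety B"
  by (simp add: toric_variety_def toric_ideal_def)

lemma mat_kernel_permute_columns:
  assumes \<pi>: "\<pi> permutes {..<dim_col A}" and u: "u \<in> carrier_vec (dim_col A)"
  shows "u \<in> mat_kernel (permute_columns \<pi> A) \<longleftrightarrow>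
    vec (dim_col A) (\<lambda>j. u $ inv_into UNIV \<pi> j) \<in> mat_kernel (A :: int mat)"
proof -
  let ?n = "dim_col A"
  have "(\<Sum>i<?n. A $$ (k, \<pi> i) * u $ i) = (\<Sum>i<?n. A $$ (k, i) * u $ inv_into UNIV \<pi> i)" for k
    using sum.permute[OF \<pi>, of "\<lambda>i. A $$ (k, i) * u $ inv_into UNIV \<pi> i"] permutes_inverses(2)[OF \<pi>]
    by (simp add: comp_def)
  then show ?thesis using u by (auto simp: mat_kernel_iff permute_columns_def)
qed

lemma distinct_list_permutation:
  assumes "distinct xs" "set xs = {..<length xs}"
  shows "(\<lambda>j. if j < length xs then xs ! j else j) permutes {..<length xs}"
proof (rule bij_imp_permutes)
  have "bij_betw ((!) xs) {..<length xs} {..<length xs}"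
    using bij_betw_nth[OF assms(1) refl refl] assms(2) by simp
  then show "bij_betw (\<lambda>j. if j < length xs then xs ! j else j) {..<length xs} {..<length xs}"
    by (subst bij_betw_cong[of _ _ "(!) xs"]) auto
qed auto

text \<open>Listing the classes consecutively defines the permutation. In both kernels block
  \<open>i\<close> of a vector is \<open>z i\<close> times the direction of its class, and in both
  the remaining condition says that \<open>z\<close> is a relation among the merged columns.\<close>

lemma GLM_of_column_classes:
  fixes A :: "int mat"
  assumes np: "non_pyramidal A"
    and sums: "\<And>i u. i < dim_col A \<Longrightarrow> u \<in> mat_kernel A \<Longrightarrow> (\<Sum>j\<in>column_class A i. u $ j) = 0"
  shows "\<exists>\<pi> d as cs ls. \<pi> permutes {..<dim_col A} \<and> GLM_data d as cs ls \<and>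
           dim_col (GLM d as cs ls) = dim_col A \<and>
           mat_kernel (permute_columns \<pi> A) = mat_kernel (GLM d as cs ls) \<and>
           non_pyramidal (mat_of_cols d as) \<and> (\<forall>i < length as. sum_list (cs ! i) = 0)"
proof -
  let ?n = "dim_col A"
  obtain Cs where Cs: "set Cs = column_class A ` {..<?n}" "distinct Cs"
    using finite_distinct_list[of "column_class A ` {..<?n}"] by auto
  define Ls where "Ls = map sorted_list_of_set Cs"
  define s where "s = length Ls"
  have fin: "finite C" if "C \<in> set Cs" for C using that Cs(1) by (auto simp: column_class_def)
  have Ls: "\<exists>i0<?n. set (Ls ! i) = column_class A i0" "distinct (Ls ! i)" if "i < s" for i
    using that Cs(1) fin nth_mem[of i Cs] by (auto simp: Ls_def s_def)
  have disj: "C = C'" if "C \<in> set Cs" "C' \<in> set Cs" "x \<in> C" "x \<in> C'" for C C' x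
    using that Cs(1) column_class_eq[OF np] by (metis imageE lessThan_iff)
  have dist: "distinct (concat Ls)"
  proof (rule distinct_concat)
    show "distinct Ls" using Cs(2) fin
      by (auto simp: Ls_def distinct_map intro!: inj_onI dest: sorted_list_of_set_inject)
    show "distinct ys" if "ys \<in> set Ls" for ys using that by (auto simp: Ls_def)
    show "set ys \<inter> set zs = {}" if "ys \<in> set Ls" "zs \<in> set Ls" "ys \<noteq> zs" for ys zs
      using that fin disj by (fastforce simp: Ls_def)
  qed
  have set_idx: "set (concat Ls) = {..<?n}"
    using Cs(1) fin by (auto simp: Ls_def column_class_def)
  then have n: "length (concat Ls) = ?n" using distinct_card[OF dist] by simp
  define \<pi> where "\<pi> j = (if j < length (concat Ls) then concat Ls ! j else j)" for j
  have \<pi>: "\<pi> permutes {..<?n}"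
    using distinct_list_permutation[OF dist] set_idx unfolding \<pi>_def n by simp
  define Q where "Q i c l \<longleftrightarrow> length c = length (Ls ! i) \<and> length l = length (Ls ! i) \<and> Gcd (set c) = 1 \<and>
     0 < c ! 0 \<and> 0 \<notin> set c \<and> (\<Sum>j<length c. l ! j * c ! j) = 1 \<and> sum_list c = 0 \<and>
     (\<forall>u \<in> mat_kernel A. \<forall>j<length (Ls ! i).
        u $ (Ls ! i ! j) = (\<Sum>j<length (Ls ! i). l ! j * u $ (Ls ! i ! j)) * c ! j)" for i c l
  have "\<exists>c l. Q i c l" if i: "i < s" for i
  proof -
    obtain i0 where "i0 < ?n" "set (Ls ! i) = column_class A i0" using Ls(1)[OF i] by blast
    then show ?thesis unfolding Q_def using column_class_direction[OF np _ _ _ Ls(2)[OF i]] sums by blast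
  qed
  then obtain cf lf where Q: "\<And>i. i < s \<Longrightarrow> Q i (cf i) (lf i)" by metis
  have cl: "\<And>i. i < s \<Longrightarrow> length (cf i) = length (Ls ! i)" "\<And>i. i < s \<Longrightarrow> length (lf i) = length (Ls ! i)"
    "\<And>i. i < s \<Longrightarrow> Gcd (set (cf i)) = 1" "\<And>i. i < s \<Longrightarrow> 0 < cf i ! 0" "\<And>i. i < s \<Longrightarrow> 0 \<notin> set (cf i)"
    "\<And>i. i < s \<Longrightarrow> (\<Sum>j<length (cf i). lf i ! j * cf i ! j) = 1" "\<And>i. i < s \<Longrightarrow> sum_list (cf i) = 0"
    "\<And>i u j. i < s \<Longrightarrow> u \<in> mat_kernel A \<Longrightarrow> j < length (Ls ! i) \<Longrightarrow>
        u $ (Ls ! i ! j) = (\<Sum>j<length (Ls ! i). lf i ! j * u $ (Ls ! i ! j)) * cf i ! j"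
    using Q unfolding Q_def by blast+
  define d where "d = dim_row A"
  define af where "af i = vec d (\<lambda>k. \<Sum>j<length (Ls ! i). cf i ! j * A $$ (k, Ls ! i ! j))" for i
  define as where "as = map af [0..<s]"
  define cs where "cs = map cf [0..<s]"
  define ls where "ls = map lf [0..<s]"
  have Lpos: "0 < length (Ls ! i)" if i: "i < s" for i
  proof -
    obtain i0 where "i0 < ?n" "set (Ls ! i) = column_class A i0" using Ls(1)[OF i] by blast
    then have "i0 \<in> set (Ls ! i)" by (simp add: column_class_def)
    then show ?thesis by (auto intro: length_pos_if_in_set)
  qed
  have G: "GLM_data d as cs ls"
    using cl Lpos by (auto simp: GLM_data_def as_def cs_def ls_def af_def Suc_le_eq)
  have lens: "map length cs = map length Ls"
    using cl(1) by (intro nth_equalityI) (auto simp: cs_def s_def)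
  then have ncs: "length (concat cs) = ?n" using n by (metis length_concat)
  have off: "block_offset cs = block_offset Ls"
    using block_offset_cong[OF lens] by blast
  have colsum: "(\<Sum>J<?n. A $$ (k, \<pi> J) * u $ J) =
      (\<Sum>i<s. \<Sum>j<length (Ls ! i). A $$ (k, Ls ! i ! j) * u $ (block_offset Ls i + j))" for k u
  proof -
    have "(\<Sum>J<length (concat Ls). A $$ (k, \<pi> J) * u $ J) =
        (\<Sum>i<s. \<Sum>j<length (Ls ! i). A $$ (k, \<pi> (block_offset Ls i + j)) * u $ (block_offset Ls i + j))"
      unfolding s_def by (rule sum_concat_blocks)
    also have "\<dots> = (\<Sum>i<s. \<Sum>j<length (Ls ! i). A $$ (k, Ls ! i ! j) * u $ (block_offset Ls i + j))"
      using concat_nth_block[of _ Ls] by (intro sum.cong) (auto simp: \<pi>_def s_def)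
    finally show ?thesis by (simp only: n)
  qed
  \<comment> \<open>For a vector that is a multiple of the direction on each block, the rows of the
    permuted matrix see only the multipliers.\<close>
  have colsum_prop: "(\<Sum>J<?n. A $$ (k, \<pi> J) * u $ J) = (\<Sum>i<s. z i * as ! i $ k)"
    if "k < d" and z: "\<And>i j. i < s \<Longrightarrow> j < length (Ls ! i) \<Longrightarrow> u $ (block_offset Ls i + j) = z i * cf i ! j" for k u z
    unfolding colsum using that(1)
    by (intro sum.cong) (auto simp: z as_def af_def sum_distrib_left mult_ac intro!: sum.cong)
  have kernel_iff: "u \<in> mat_kernel (permute_columns \<pi> A) \<longleftrightarrow> u \<in> mat_kernel (GLM d as cs ls)"
    if u: "u \<in> carrier_vec ?n" for u
  proof -
    define z where "z i = (\<Sum>j<length (Ls ! i). lf i ! j * u $ (block_offset Ls i + j))" for i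
    have perm: "u \<in> mat_kernel (permute_columns \<pi> A) \<longleftrightarrow> (\<forall>k<d. (\<Sum>J<?n. A $$ (k, \<pi> J) * u $ J) = 0)"
      using u permutes_in_image[OF \<pi>] by (auto simp: mat_kernel_iff permute_columns_def d_def)
    have glm: "u \<in> mat_kernel (GLM d as cs ls) \<longleftrightarrow>
        (\<forall>i<s. \<forall>j<length (Ls ! i).
           cf i ! 0 * u $ (block_offset Ls i + j) = cf i ! j * u $ block_offset Ls i) \<and>
        (\<forall>k<d. (\<Sum>i<s. z i * as ! i $ k) = 0)"
    proof -
      have "u \<in> carrier_vec (length (concat cs))" using u ncs by simp
      note mat_kernel_GLM[OF G this, unfolded off]
      moreover have "length cs = s" "\<And>i. i < s \<Longrightarrow> cs ! i = cf i" "\<And>i. i < s \<Longrightarrow> ls ! i = lf i"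
        by (simp_all add: cs_def ls_def)
      ultimately show ?thesis by (simp add: cl(1) z_def)
    qed
    show ?thesis
    proof
      assume uk: "u \<in> mat_kernel (permute_columns \<pi> A)"
      let ?v = "vec ?n (\<lambda>j. u $ inv_into UNIV \<pi> j)"
      have v: "?v \<in> mat_kernel A" using mat_kernel_permute_columns[OF \<pi> u] uk by simp
      have vL: "?v $ (Ls ! i ! j) = u $ (block_offset Ls i + j)" if "i < s" "j < length (Ls ! i)" for i j
      proof -
        have J: "block_offset Ls i + j < ?n" "\<pi> (block_offset Ls i + j) = Ls ! i ! j"
          using concat_nth_block[of i Ls j] that n by (auto simp: \<pi>_def s_def)
        then have "Ls ! i ! j < ?n" using permutes_in_image[OF \<pi>] by (metis lessThan_iff)
        then show ?thesis using J(2) permutes_inverses(2)[OF \<pi>] by (metis index_vec)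
      qed
      have multiple: "u $ (block_offset Ls i + j) = z i * cf i ! j" if "i < s" "j < length (Ls ! i)" for i j
        using cl(8)[OF that(1) v that(2)] that by (simp add: vL z_def)
      have "cf i ! 0 * u $ (block_offset Ls i + j) = cf i ! j * u $ block_offset Ls i"
        if "i < s" "j < length (Ls ! i)" for i j
        using multiple[OF that] multiple[OF that(1) Lpos[OF that(1)]] by simp
      then show "u \<in> mat_kernel (GLM d as cs ls)"
        unfolding glm using uk[unfolded perm] colsum_prop[of _ u z] multiple by auto
    next
      assume uk: "u \<in> mat_kernel (GLM d as cs ls)"
      have multiple: "u $ (block_offset Ls i + j) = z i * cf i ! j" if i: "i < s" and j: "j < length (Ls ! i)" for i j
      proof -
        have blk: "cf i ! 0 * u $ (block_offset Ls i + j') = cf i ! j' * u $ block_offset Ls i"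
          if "j' < length (Ls ! i)" for j' using uk[unfolded glm] i that by blast
        \<comment> \<open>Weighting the Lawrence rows by the Bezout coefficients \<open>lf i\<close>
          expresses the head of the block through \<open>z i\<close>; the positive integer
          \<open>cf i ! 0\<close> is then cancelled, so the multiplier is integral.\<close>
        have "cf i ! 0 * z i = (\<Sum>j'<length (Ls ! i). lf i ! j' * cf i ! j') * u $ block_offset Ls i"
          unfolding z_def sum_distrib_left sum_distrib_right
          by (rule sum.cong) (auto simp: blk mult.left_commute[of "cf i ! 0"] mult.assoc)
        then have "cf i ! 0 * z i = u $ block_offset Ls i" using cl(6)[OF i] cl(1)[OF i] by simp
        then have "cf i ! 0 * u $ (block_offset Ls i + j) = cf i ! 0 * (z i * cf i ! j)"
          using blk[OF j] by (simp add: mult_ac)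
        then show ?thesis using cl(4)[OF i] by simp
      qed
      then show "u \<in> mat_kernel (permute_columns \<pi> A)"
        unfolding perm using uk[unfolded glm] colsum_prop[of _ u z] by auto
    qed
  qed
  have dimc: "dim_col (GLM d as cs ls) = ?n" using GLM_dims(1)[OF G] ncs by simp
  have "mat_kernel (permute_columns \<pi> A) = mat_kernel (GLM d as cs ls)"
    using kernel_iff dimc by (auto simp: mat_kernel_def permute_columns_def)
  moreover have "non_pyramidal (mat_of_cols d as)"
    unfolding non_pyramidal_def free_column_def
  proof (intro allI impI)
    fix i assume "i < dim_col (mat_of_cols d as)"
    then have i: "i < s" by (simp add: as_def)
    have "Ls ! i ! 0 \<in> set (Ls ! i)" "Ls ! i \<in> set Ls" using Lpos[OF i] i by (auto simp: s_def)
    then have "Ls ! i ! 0 \<in> set (concat Ls)" by auto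
    then have "Ls ! i ! 0 < ?n" unfolding set_idx by simp
    then obtain u where u: "u \<in> mat_kernel A" "u $ (Ls ! i ! 0) \<noteq> 0" using non_pyramidalD[OF np] by blast
    \<comment> \<open>The multipliers of \<open>u\<close> on the classes form a relation among the
      merged columns, nonzero at \<open>i\<close> because \<open>u\<close> is nonzero at the head of
      class \<open>i\<close>.\<close>
    define z where "z i = (\<Sum>j<length (Ls ! i). lf i ! j * u $ (Ls ! i ! j))" for i
    define v where "v = vec ?n (\<lambda>J. u $ \<pi> J)"
    have "v $ (block_offset Ls i + j) = z i * cf i ! j" if "i < s" "j < length (Ls ! i)" for i j
      using concat_nth_block[of i Ls j] cl(8)[OF that(1) u(1) that(2)] that n
      by (auto simp: v_def \<pi>_def s_def z_def)
    then have "(\<Sum>J<?n. A $$ (k, \<pi> J) * v $ J) = (\<Sum>i<s. z i * as ! i $ k)" if "k < d" for k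
      using colsum_prop[OF that] by blast
    moreover have "(\<Sum>J<?n. A $$ (k, \<pi> J) * v $ J) = 0" if "k < d" for k
    proof -
      have "(\<Sum>J<?n. A $$ (k, \<pi> J) * v $ J) = (\<Sum>J<?n. A $$ (k, \<pi> J) * u $ \<pi> J)"
        by (rule sum.cong) (auto simp: v_def)
      also have "\<dots> = (\<Sum>J<?n. A $$ (k, J) * u $ J)"
        using sum.permute[OF \<pi>, of "\<lambda>J. A $$ (k, J) * u $ J"] by (simp add: comp_def)
      also have "\<dots> = 0" using u(1) that by (simp add: mat_kernel_iff d_def)
      finally show ?thesis .
    qed
    ultimately have "vec s z \<in> mat_kernel (mat_of_cols d as)"
      by (simp add: mat_kernel_iff as_def mat_of_cols_index mult.commute)
    moreover have "vec s z $ i \<noteq> 0"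
      using cl(8)[OF i u(1) Lpos[OF i]] u(2) i by (auto simp: z_def)
    ultimately show "\<not> (\<forall>u\<in>mat_kernel (mat_of_cols d as). u $ i = 0)" by blast
  qed
  moreover have "\<forall>i < length as. sum_list (cs ! i) = 0"
    using cl(7) by (simp add: as_def cs_def)
  ultimately show ?thesis using \<pi> G dimc by blast
qed

theorem theorem3p7:
  fixes A :: "int mat"
  assumes "ones_in_rational_row_span A"
    and "non_pyramidal A"
    and "self_dual (dim_col A) (toric_variety A :: ('k::{alg_closed_field, field_char_0}) vec set set)"
  shows "\<exists>(\<pi> :: nat \<Rightarrow> nat) (d :: nat) (as :: int vec list) (cs :: int list list) (ls :: int list list).
           \<pi> permutes {..<dim_col A} \<and>
           GLM_data d as cs ls \<and>
           dim_col (GLM d as cs ls) = dim_col A \<and>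
           (toric_variety (permute_columns \<pi> A) :: 'k vec set set) = toric_variety (GLM d as cs ls) \<and>
           non_pyramidal (mat_of_cols d as) \<and>
           (\<forall>i < length as. sum_list (cs ! i) = 0)"
proof -
  let ?n = "dim_col A"
  have sums: "(\<Sum>j\<in>column_class A i. u $ j) = 0" if i: "i < ?n" and u: "u \<in> mat_kernel A" for i u
  proof -
    \<comment> \<open>Toric data require at least one column, which the index \<open>i\<close>
      guarantees; for a matrix without columns the claim is vacuous.\<close>
    obtain r W U D where td: "toric_data ?n r W U D" and
      ker: "\<And>u. u \<in> mat_kernel A \<longleftrightarrow> u \<in> carrier_vec ?n \<and> ($) u \<in> toric_data.lker ?n r W"
      using toric_data_exists[OF assms(1)] i by fastforce
    interpret toric_data ?n r W U D by (rule td)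
    have lift: "\<exists>v \<in> mat_kernel A. \<forall>i<?n. v $ i = w i" if "w \<in> lker" for w
    proof (rule bexI)
      have "(\<Sum>i<?n. int (W j i) * vec ?n w $ i) = (\<Sum>i<?n. int (W j i) * w i)" for j
        by (rule sum.cong) auto
      then show "vec ?n w \<in> mat_kernel A" using that by (simp add: ker lker_def)
    qed simp
    have "self_dual ?n (variety :: 'k vec set set)"
      using assms(3) toric_variety_eq_variety[OF refl ker, where 'k = 'k] by simp
    moreover have "\<exists>w \<in> lker. w i \<noteq> 0" if "i < ?n" for i
      using non_pyramidalD[OF assms(2) that] ker by blast
    moreover have "($) u \<in> lker" using u ker by blast
    ultimately have "(\<Sum>j | j < ?n \<and> (\<forall>w \<in> lker. w i = 0 \<longrightarrow> w j = 0). u $ j) = 0"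
      using self_dual_class_sum i by blast
    moreover have "column_class A i = {j. j < ?n \<and> (\<forall>w \<in> lker. w i = 0 \<longrightarrow> w j = 0)}"
    proof -
      have "(\<forall>w \<in> mat_kernel A. w $ i = 0 \<longrightarrow> w $ j = 0) \<longleftrightarrow> (\<forall>w \<in> lker. w i = 0 \<longrightarrow> w j = 0)"
        if "j < ?n" for j
        using lift ker i that by metis
      then show ?thesis by (auto simp: column_class_def)
    qed
    ultimately show ?thesis by simp
  qed
  obtain \<pi> d as cs ls where *: "\<pi> permutes {..<dim_col A}" "GLM_data d as cs ls"
    "dim_col (GLM d as cs ls) = dim_col A"
    "mat_kernel (permute_columns \<pi> A) = mat_kernel (GLM d as cs ls)"
    "non_pyramidal (mat_of_cols d as)" "\<forall>i < length as. sum_list (cs ! i) = 0"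
    using GLM_of_column_classes[OF assms(2) sums] by blast
  have "(toric_variety (permute_columns \<pi> A) :: 'k vec set set) = toric_variety (GLM d as cs ls)"
    using *(3,4) by (intro toric_variety_cong) (simp_all add: permute_columns_def)
  with * show ?thesis by blast
qed

end
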